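(* Let $\mathcal D=\{a_1,a_2,a_3\}\subset\mathbb{CP}^1$ be any three distinct points. Let $\chi:\pi_1(\mathbb{CP}^1\setminus\mathcal D)\to GL(2,\mathbb C)$ be a reducible indecomposable representation which is diagonalizable at least at one of the points, i.e. in some basis all the monodromy matrices $G_1,G_2,G_3$ are upper triangular and at least one of them is diagonal. Then $\chi$ is realized by the monodromy of a Riemann equation with singular points $a_1,a_2,a_3$.
   Context: A Riemann equation with singular points $\mathcal D=\{a_1,a_2,a_3\}$ is a second order linear differential equation $y''+b_1(z)y'+b_2(z)y=0$ on the Riemann sphere whose coefficients are holomorphic outside $\mathcal D$ (with every point of $\mathbb{CP}^1\setminus\mathcal D$, including $\infty$ in the local coordinate $1/z$ if $\infty\notin\mathcal D$, being an ordinary point) and which is Fuchsian at each $a_i$: in a local coordinate $t$ centred at $a_i$, the coefficient of the $(2-j)$-th derivative has a pole of order at most $j$, $j=1,2$. Monodromy: continuing a basis (row) $Y$ of the two-dimensional solution space near a base point along a loop $\gamma$ in $\mathbb{CP}^1\setminus\mathcal D$ gives another basis $Y^*$ with $Y=Y^*G_\gamma$, $G_\gamma\in GL(2,\mathbb C)$. The matrix depends only on the homotopy class of $\gamma$, and $[\gamma]\mapsto G_\gamma$ is the monodromy representation, defined up to simultaneous conjugation (choice of basis). An equation realizes $\chi$ if $\chi$ is its monodromy representation in some basis of solutions. The group $\pi_1(\mathbb{CP}^1\setminus\mathcal D)$ is generated by loops around $a_1,a_2,a_3$ whose product is trivial; $G_i$ denotes the matrix corresponding to the loop around $a_i$. Indecomposable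 means not a direct sum of two one-dimensional representations. *)

theory Defs
  imports "HOL-Complex_Analysis.Complex_Analysis" "HOL-Algebra.Generated_Groups"
begin

section \<open>The Riemann sphere\<close>

datatype cp1 = CFin complex | CInf

definition chart_inf :: "complex \<Rightarrow> cp1" where
  "chart_inf w = (if w = 0 then CInf else CFin (inverse w))"

text \<open>The topology glued from the two charts \<open>CFin\<close> (coordinate \<open>z\<close>) and \<open>chart_inf\<close>
  (coordinate \<open>w = 1/z\<close>).\<close>

instantiation cp1 :: topological_space
begin

definition open_cp1 :: "cp1 set \<Rightarrow> bool" where
  "open_cp1 U \<longleftrightarrow> open (CFin -` U) \<and> open (chart_inf -` U)"

instance
proof
  show "open (UNIV :: cp1 set)"
    by (simp add: open_cp1_def)
  show "open (S \<inter> T)" if "open S" "open T" for S T :: "cp1 set"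
    using that by (simp add: open_cp1_def open_Int)
  show "open (\<Union> K)" if "\<forall>S\<in>K. open S" for K :: "cp1 set set"
    using that by (auto simp: open_cp1_def vimage_Union)
qed

end

definition cp1_holomorphic_on :: "(cp1 \<Rightarrow> complex) \<Rightarrow> cp1 set \<Rightarrow> bool" where
  "cp1_holomorphic_on f U \<longleftrightarrow>
     (\<lambda>z. f (CFin z)) holomorphic_on (CFin -` U) \<and>
     (\<lambda>w. f (chart_inf w)) holomorphic_on (chart_inf -` U)"

section \<open>The fundamental group\<close>

definition loops :: "'a::topological_space set \<Rightarrow> 'a \<Rightarrow> (real \<Rightarrow> 'a) set" where
  "loops S p = {g. path g \<and> path_image g \<subseteq> S \<and> pathstart g = p \<and> pathfinish g = p}"

definition loop_class :: "'a::topological_space set \<Rightarrow> (real \<Rightarrow> 'a) \<Rightarrow> (real \<Rightarrow> 'a) set" where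
  "loop_class S g = {h. homotopic_paths S g h}"

definition fundamental_group ::
  "'a::topological_space set \<Rightarrow> 'a \<Rightarrow> (real \<Rightarrow> 'a) set monoid" where
  "fundamental_group S p =
     \<lparr> carrier = loop_class S ` loops S p,
       mult = (\<lambda>A B. {h. \<exists>g\<in>A. \<exists>k\<in>B. homotopic_paths S (g +++ k) h}),
       one = loop_class S (\<lambda>_. p) \<rparr>"

lemma loop_class_eq_iff:
  "g \<in> loops S p \<Longrightarrow> loop_class S g = loop_class S h \<longleftrightarrow> homotopic_paths S g h"
  unfolding loop_class_def loops_def
  by (auto dest: homotopic_paths_trans homotopic_paths_sym intro: homotopic_paths_sym)

lemma loops_join: "g \<in> loops S p \<Longrightarrow> h \<in> loops S p \<Longrightarrow> g +++ h \<in> loops S p"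
  by (auto simp: loops_def subset_path_image_join)

lemma loops_const: "p \<in> S \<Longrightarrow> (\<lambda>_. p) \<in> loops S p"
  by (auto simp: loops_def path_def path_image_def pathstart_def pathfinish_def)

lemma loops_reversepath: "g \<in> loops S p \<Longrightarrow> reversepath g \<in> loops S p"
  by (auto simp: loops_def)

lemma loop_class_mult:
  assumes "g \<in> loops S p" "h \<in> loops S p"
  shows "loop_class S g \<otimes>\<^bsub>fundamental_group S p\<^esub> loop_class S h = loop_class S (g +++ h)"
proof -
  have "homotopic_paths S (g +++ h) k"
    if "homotopic_paths S g g'" "homotopic_paths S h h'" "homotopic_paths S (g' +++ h') k" for g' h' k
  proof -
    have "homotopic_paths S (g +++ h) (g' +++ h')"
      using that(1,2) assms by (intro homotopic_paths_join) (auto simp: loops_def)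
    then show ?thesis
      using that(3) homotopic_paths_trans by blast
  qed
  moreover have "homotopic_paths S g g" "homotopic_paths S h h"
    using assms by (auto simp: loops_def)
  ultimately show ?thesis
    unfolding fundamental_group_def loop_class_def by (auto simp del: homotopic_paths_refl)
qed

lemma group_fundamental_group:
  assumes "p \<in> S"
  shows "group (fundamental_group S p)"
proof (rule groupI)
  let ?G = "fundamental_group S p"
  have carr: "carrier ?G = loop_class S ` loops S p" and one: "\<one>\<^bsub>?G\<^esub> = loop_class S (\<lambda>_. p)"
    by (simp_all add: fundamental_group_def)
  show "\<one>\<^bsub>?G\<^esub> \<in> carrier ?G"
    using assms by (simp add: carr one loops_const)
  show "x \<otimes>\<^bsub>?G\<^esub> y \<in> carrier ?G" if "x \<in> carrier ?G" "y \<in> carrier ?G" for x y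
    using that by (auto simp: carr loop_class_mult loops_join)
  show "x \<otimes>\<^bsub>?G\<^esub> y \<otimes>\<^bsub>?G\<^esub> z = x \<otimes>\<^bsub>?G\<^esub> (y \<otimes>\<^bsub>?G\<^esub> z)"
    if xyz: "x \<in> carrier ?G" "y \<in> carrier ?G" "z \<in> carrier ?G" for x y z
  proof -
    obtain f g h where fgh: "f \<in> loops S p" "g \<in> loops S p" "h \<in> loops S p"
      and "x = loop_class S f" "y = loop_class S g" "z = loop_class S h"
      using xyz by (auto simp: carr)
    moreover have "homotopic_paths S ((f +++ g) +++ h) (f +++ (g +++ h))"
      using fgh by (intro homotopic_paths_sym[OF homotopic_paths_assoc]) (auto simp: loops_def)
    ultimately show ?thesis
      by (simp add: loop_class_mult loops_join loop_class_eq_iff[where p = p])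
  qed
  show "\<one>\<^bsub>?G\<^esub> \<otimes>\<^bsub>?G\<^esub> x = x" if x: "x \<in> carrier ?G" for x
  proof -
    obtain g where g: "g \<in> loops S p" and xg: "x = loop_class S g"
      using x by (auto simp: carr)
    have "continuous_on {0..1} (\<lambda>t::real. max 0 (2 * t - 1))"
      by (intro continuous_intros)
    then have "homotopic_paths S g ((\<lambda>_. p) +++ g)"
      using g by (intro homotopic_paths_reparametrize[where f = "\<lambda>t. max 0 (2 * t - 1)"])
        (auto simp: loops_def joinpaths_def pathstart_def)
    then show ?thesis
      using g assms
      by (metis homotopic_paths_sym loop_class_eq_iff loop_class_mult loops_const loops_join one xg)
  qed
  show "\<exists>y\<in>carrier ?G. y \<otimes>\<^bsub>?G\<^esub> x = \<one>\<^bsub>?G\<^esub>" if x: "x \<in> carrier ?G" for x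
  proof -
    obtain g where g: "g \<in> loops S p" and xg: "x = loop_class S g"
      using x by (auto simp: carr)
    have "homotopic_paths S (reversepath g +++ g) (\<lambda>_. p)"
    proof -
      define r where "r = reversepath g"
      have r: "continuous_on {0..1} r" "r 0 = p" "r 1 = p" "r \<in> {0..1} \<rightarrow> S"
        using loops_reversepath[OF g]
        by (auto simp: r_def loops_def path_def path_image_def pathstart_def pathfinish_def)
      let ?A = "{0..1::real} \<times> {0..1::real}"
      let ?m = "\<lambda>y::real\<times>real. (1 - fst y) * min (2 * snd y) (2 - 2 * snd y)"
      have m: "?m ` ?A \<subseteq> {0..1}"
        by (auto intro!: mult_le_one)
      have "continuous_on ?A (\<lambda>y. r (?m y))"
        by (rule continuous_on_compose2[OF r(1) _ m]) (intro continuous_intros)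
      moreover have "(\<lambda>y. r (?m y)) \<in> ?A \<rightarrow> S"
        using m r(4) by (fastforce simp: Pi_iff image_subset_iff)
      moreover have "r (?m (0, t)) = (reversepath g +++ g) t" if "t \<in> {0..1}" for t
        using that by (auto simp: joinpaths_def r_def reversepath_def min_def algebra_simps)
      ultimately show ?thesis
        using g r(2,3)
        by (auto simp: homotopic_paths intro!: exI[of _ "\<lambda>y. r (?m y)"])
           (auto simp: loops_def pathstart_def pathfinish_def joinpaths_def reversepath_def)
    qed
    then have "loop_class S (reversepath g) \<otimes>\<^bsub>?G\<^esub> x = \<one>\<^bsub>?G\<^esub>"
      using g loop_class_eq_iff loop_class_mult loops_join loops_reversepath one xg by metis
    then show ?thesis
      using loops_reversepath[OF g] by (auto simp: carr)
  qed
qed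

section \<open>Generators of the fundamental group of a punctured sphere\<close>

text \<open>The circle of radius \<open>r\<close> around a point in the coordinate \<open>z - c\<close> or \<open>w = 1/z\<close>,
  positively oriented with respect to that coordinate.\<close>

fun circle_at :: "cp1 \<Rightarrow> real \<Rightarrow> real \<Rightarrow> cp1" where
  "circle_at (CFin c) r = CFin \<circ> circlepath c r"
| "circle_at CInf r = chart_inf \<circ> circlepath 0 r"

fun disc_at :: "cp1 \<Rightarrow> real \<Rightarrow> cp1 set" where
  "disc_at (CFin c) r = CFin ` cball c r"
| "disc_at CInf r = chart_inf ` cball 0 r"

definition loop_around :: "cp1 set \<Rightarrow> cp1 \<Rightarrow> cp1 \<Rightarrow> (real \<Rightarrow> cp1) \<Rightarrow> bool" where
  "loop_around D p a g \<longleftrightarrow>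
     (\<exists>r q. r > 0 \<and> disc_at a r \<inter> D = {a} \<and>
        path q \<and> path_image q \<subseteq> - D \<and> pathstart q = p \<and> pathfinish q = pathstart (circle_at a r) \<and>
        homotopic_paths (- D) g (q +++ circle_at a r +++ reversepath q))"

definition standard_generators :: "(3 \<Rightarrow> cp1) \<Rightarrow> cp1 \<Rightarrow> (3 \<Rightarrow> real \<Rightarrow> cp1) \<Rightarrow> bool" where
  "standard_generators a p g \<longleftrightarrow>
     (let S = - range a; G = fundamental_group S p; c = (\<lambda>i. loop_class S (g i)) in
        (\<forall>i. g i \<in> loops S p \<and> loop_around (range a) p (a i) (g i)) \<and>
        generate G (range c) = carrier G \<and>
        c 1 \<otimes>\<^bsub>G\<^esub> c 2 \<otimes>\<^bsub>G\<^esub> c 3 = \<one>\<^bsub>G\<^esub>)"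

section \<open>Two-dimensional representations\<close>

definition GL :: "('a::field^'n^'n) monoid" where
  "GL = \<lparr> carrier = {A. invertible A}, mult = (**), one = mat 1 \<rparr>"

definition invariant_subspace ::
  "('g, 'b) monoid_scheme \<Rightarrow> ('g \<Rightarrow> complex^2^2) \<Rightarrow> (complex^2) set \<Rightarrow> bool" where
  "invariant_subspace G \<rho> V \<longleftrightarrow>
     vec.subspace V \<and> (\<forall>g\<in>carrier G. \<forall>v\<in>V. \<rho> g *v v \<in> V)"

definition reducible :: "('g, 'b) monoid_scheme \<Rightarrow> ('g \<Rightarrow> complex^2^2) \<Rightarrow> bool" where
  "reducible G \<rho> \<longleftrightarrow> (\<exists>V. invariant_subspace G \<rho> V \<and> V \<noteq> {0} \<and> V \<noteq> UNIV)"

definition indecomposable :: "('g, 'b) monoid_scheme \<Rightarrow> ('g \<Rightarrow> complex^2^2) \<Rightarrow> bool" where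
  "indecomposable G \<rho> \<longleftrightarrow>
     \<not> (\<exists>V W. invariant_subspace G \<rho> V \<and> invariant_subspace G \<rho> W \<and>
           vec.dim V = 1 \<and> vec.dim W = 1 \<and>
           V \<inter> W = {0} \<and> {v + w | v w. v \<in> V \<and> w \<in> W} = UNIV)"

definition upper_triangular :: "complex^2^2 \<Rightarrow> bool" where
  "upper_triangular A \<longleftrightarrow> A $ 2 $ 1 = 0"

definition diagonal :: "complex^2^2 \<Rightarrow> bool" where
  "diagonal A \<longleftrightarrow> A $ 1 $ 2 = 0 \<and> A $ 2 $ 1 = 0"

section \<open>Riemann equations\<close>

definition pole_order_le :: "nat \<Rightarrow> (complex \<Rightarrow> complex) \<Rightarrow> complex \<Rightarrow> bool" where
  "pole_order_le k f c \<longleftrightarrow>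
     (\<exists>h. h analytic_on {c} \<and> (\<forall>\<^sub>F z in at c. f z = h z / (z - c) ^ k))"

text \<open>Under \<open>w = 1/z\<close> one has \<open>dy/dz = - w\<^sup>2 dy/dw\<close> and
  \<open>d\<^sup>2y/dz\<^sup>2 = w\<^sup>4 d\<^sup>2y/dw\<^sup>2 + 2 w\<^sup>3 dy/dw\<close>, so \<open>y'' + b1 y' + b2 y = 0\<close> becomes the equation in \<open>w\<close>
  with the following coefficients.\<close>

definition coeff1_inf :: "(complex \<Rightarrow> complex) \<Rightarrow> complex \<Rightarrow> complex" where
  "coeff1_inf b1 w = 2 / w - b1 (1 / w) / w ^ 2"

definition coeff2_inf :: "(complex \<Rightarrow> complex) \<Rightarrow> complex \<Rightarrow> complex" where
  "coeff2_inf b2 w = b2 (1 / w) / w ^ 4"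

text \<open>At \<open>CInf\<close> an ordinary point is one where both coefficients have a removable singularity,
  since their formulas give no meaningful value at \<open>w = 0\<close>.\<close>

fun ordinary_point :: "(complex \<Rightarrow> complex) \<Rightarrow> (complex \<Rightarrow> complex) \<Rightarrow> cp1 \<Rightarrow> bool" where
  "ordinary_point b1 b2 (CFin c) \<longleftrightarrow> b1 analytic_on {c} \<and> b2 analytic_on {c}"
| "ordinary_point b1 b2 CInf \<longleftrightarrow>
     pole_order_le 0 (coeff1_inf b1) 0 \<and> pole_order_le 0 (coeff2_inf b2) 0"

fun fuchsian_point :: "(complex \<Rightarrow> complex) \<Rightarrow> (complex \<Rightarrow> complex) \<Rightarrow> cp1 \<Rightarrow> bool" where
  "fuchsian_point b1 b2 (CFin c) \<longleftrightarrow> pole_order_le 1 b1 c \<and> pole_order_le 2 b2 c"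
| "fuchsian_point b1 b2 CInf \<longleftrightarrow>
     pole_order_le 1 (coeff1_inf b1) 0 \<and> pole_order_le 2 (coeff2_inf b2) 0"

definition riemann_equation ::
  "cp1 set \<Rightarrow> (complex \<Rightarrow> complex) \<Rightarrow> (complex \<Rightarrow> complex) \<Rightarrow> bool" where
  "riemann_equation D b1 b2 \<longleftrightarrow>
     card D = 3 \<and> (\<forall>x\<in>- D. ordinary_point b1 b2 x) \<and> (\<forall>x\<in>D. fuchsian_point b1 b2 x)"

section \<open>Monodromy\<close>

text \<open>For \<open>p = CInf\<close> the equation is imposed at the finite points near \<open>p\<close>; since \<open>y\<close> is
  holomorphic at \<open>p\<close>, at an ordinary point \<open>p\<close> the equation in the coordinate \<open>w\<close> then also
  holds at \<open>w = 0\<close> by continuity.\<close>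

definition local_solution ::
  "(complex \<Rightarrow> complex) \<Rightarrow> (complex \<Rightarrow> complex) \<Rightarrow> cp1 \<Rightarrow> (cp1 \<Rightarrow> complex) \<Rightarrow> bool" where
  "local_solution b1 b2 p y \<longleftrightarrow>
     (\<exists>U. open U \<and> p \<in> U \<and> cp1_holomorphic_on y U \<and>
        (let f = (\<lambda>z. y (CFin z)) in
           \<forall>z. CFin z \<in> U \<longrightarrow> deriv (deriv f) z + b1 z * deriv f z + b2 z * f z = 0))"

text \<open>A basis, written as a row, of the space of germs of solutions at \<open>p\<close>.\<close>

definition solution_basis ::
  "(complex \<Rightarrow> complex) \<Rightarrow> (complex \<Rightarrow> complex) \<Rightarrow> cp1 \<Rightarrow> (cp1 \<Rightarrow> complex^2) \<Rightarrow> bool" where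
  "solution_basis b1 b2 p Y \<longleftrightarrow>
     (\<forall>j. local_solution b1 b2 p (\<lambda>x. Y x $ j)) \<and>
     (\<forall>c::complex^2. (\<forall>\<^sub>F x in nhds p. (\<Sum>j\<in>UNIV. c $ j * Y x $ j) = 0) \<longrightarrow> c = 0) \<and>
     (\<forall>y. local_solution b1 b2 p y \<longrightarrow>
        (\<exists>c::complex^2. \<forall>\<^sub>F x in nhds p. y x = (\<Sum>j\<in>UNIV. c $ j * Y x $ j)))"

text \<open>Analytic continuation of the germ of \<open>Y\<close> at the start of \<open>g\<close> to the germ of \<open>Y'\<close> at its end:
  \<open>F t\<close> represents the germ at \<open>g t\<close>.\<close>

definition continuation_along ::
  "(real \<Rightarrow> cp1) \<Rightarrow> (cp1 \<Rightarrow> complex^2) \<Rightarrow> (cp1 \<Rightarrow> complex^2) \<Rightarrow> bool" where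
  "continuation_along g Y Y' \<longleftrightarrow>
     (\<exists>F :: real \<Rightarrow> cp1 \<Rightarrow> complex^2.
        (\<forall>\<^sub>F x in nhds (pathstart g). F 0 x = Y x) \<and>
        (\<forall>\<^sub>F x in nhds (pathfinish g). F 1 x = Y' x) \<and>
        (\<forall>t\<in>{0..1}. \<exists>U. open U \<and> g t \<in> U \<and> (\<forall>j. cp1_holomorphic_on (\<lambda>x. F t x $ j) U) \<and>
           (\<exists>e>0. \<forall>s\<in>{0..1}. \<bar>s - t\<bar> < e \<longrightarrow>
              g s \<in> U \<and> (\<forall>\<^sub>F x in nhds (g s). F s x = F t x))))"

definition monodromy_matrix ::
  "(cp1 \<Rightarrow> complex^2) \<Rightarrow> (real \<Rightarrow> cp1) \<Rightarrow> complex^2^2 \<Rightarrow> bool" where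
  "monodromy_matrix Y g G \<longleftrightarrow>
     (\<exists>Y'. continuation_along g Y Y' \<and> (\<forall>\<^sub>F x in nhds (pathfinish g). Y x = Y' x v* G))"

definition realizes ::
  "cp1 set \<Rightarrow> cp1 \<Rightarrow> (complex \<Rightarrow> complex) \<Rightarrow> (complex \<Rightarrow> complex) \<Rightarrow>
     ((real \<Rightarrow> cp1) set \<Rightarrow> complex^2^2) \<Rightarrow> bool" where
  "realizes D p b1 b2 \<rho> \<longleftrightarrow>
     (\<exists>Y. solution_basis b1 b2 p Y \<and>
        (\<forall>g\<in>loops (- D) p. monodromy_matrix Y g (\<rho> (loop_class (- D) g))))"

end

theory Submission
  imports Defs
begin

text \<open>
  Let \<open>t\<close> be the coordinate that sends \<open>a1, a2, a3\<close> to \<open>0, 1, \<infinity>\<close>. The functions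
  \<open>u = t\<^bsup>\<alpha>0\<^esup> (t - 1)\<^bsup>\<alpha>1\<^esup>\<close> and \<open>u f\<close> with \<open>f' = t\<^bsup>\<beta>0\<^esup> (t - 1)\<^bsup>\<beta>1\<^esup>\<close> span the solutions of a Riemann
  equation. Its monodromy is upper triangular, and the exponents prescribe the diagonals at \<open>a1\<close> and
  \<open>a2\<close>. Any two of the three loops generate the fundamental group, so it remains to match the
  off-diagonal entries of two matrices up to conjugation by \<open>[[1, s], [0, k]]\<close>.

  If some \<open>G\<^sub>i\<close> has distinct eigenvalues, then at least two of them have, and after a cyclic
  relabelling these are \<open>G\<^sub>1\<close> and \<open>G\<^sub>2\<close>. Two triangular pairs with such diagonals are conjugate unless
  one of them is diagonalizable. If the monodromy of the equation were, then
  \<open>R = (f - s) t\<^bsup>-\<beta>0-1\<^esup> (t - 1)\<^bsup>-\<beta>1-1\<^esup>\<close> would be single-valued for some \<open>s\<close> and would satisfy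
  \<open>t (t - 1) R' + ((\<beta>0 + 1) (t - 1) + (\<beta>1 + 1) t) R = 1\<close>. As \<open>\<beta>0\<close> and \<open>\<beta>1\<close> are not integers, \<open>R\<close> would
  be entire; but if \<open>Re (\<beta>0 + \<beta>1) > - 2\<close>, the recurrence for its Taylor coefficients at \<open>0\<close> forces the
  radius of convergence \<open>1\<close>.

  If all \<open>G\<^sub>i\<close> have a double eigenvalue, one of them is scalar; it may be taken to be \<open>G\<^sub>2\<close>, and then
  \<open>f = log t\<close> works.
\<close>

(* frees $ for vector components *)
unbundle no Formal_Power_Series.fps_syntax

section \<open>Lifting paths to a sheaf of sections\<close>

lemma continuous_on_eventually_in_open:
  assumes "continuous_on T g" "t \<in> T" "open V" "g t \<in> V"
  shows "\<forall>\<^sub>F s in at t within T. g s \<in> V"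
  using assms unfolding continuous_on_def by (intro topological_tendstoD) auto

locale local_sections =
  fixes S :: "'a::real_normed_vector set"
    and is_section :: "'a set \<Rightarrow> ('a \<Rightarrow> 'b::topological_space) \<Rightarrow> bool"
    and fibre :: "'a \<Rightarrow> 'b set"
  assumes open_base: "open S"
    and section_open: "is_section U \<Psi> \<Longrightarrow> open U"
    and section_fibre: "is_section U \<Psi> \<Longrightarrow> x \<in> U \<Longrightarrow> \<Psi> x \<in> fibre x"
    and section_unique:
      "\<lbrakk>is_section U \<Psi>; is_section V \<Psi>'; open W; convex W; W \<subseteq> U \<inter> V; x \<in> W; \<Psi> x = \<Psi>' x; y \<in> W\<rbrakk>
        \<Longrightarrow> \<Psi> y = \<Psi>' y"
    and section_exists:
      "\<lbrakk>v \<in> fibre c; e > 0; ball c e \<subseteq> S\<rbrakk> \<Longrightarrow> \<exists>\<Psi>. is_section (ball c e) \<Psi> \<and> \<Psi> c = v"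
begin

definition lift_on :: "real set \<Rightarrow> (real \<Rightarrow> 'a) \<Rightarrow> (real \<Rightarrow> 'b) \<Rightarrow> bool" where
  "lift_on T g m \<longleftrightarrow> continuous_on T g \<and>
     (\<forall>t\<in>T. \<exists>U \<Psi>. is_section U \<Psi> \<and> g t \<in> U \<and> m t = \<Psi> (g t) \<and>
        (\<forall>\<^sub>F s in at t within T. m s = \<Psi> (g s)))"

abbreviation lift :: "(real \<Rightarrow> 'a) \<Rightarrow> (real \<Rightarrow> 'b) \<Rightarrow> bool" where
  "lift \<equiv> lift_on {0..1}"

lemma lift_on_sectionE:
  assumes "lift_on T g m" "t \<in> T"
  obtains U \<Psi> where "is_section U \<Psi>" "g t \<in> U" "m t = \<Psi> (g t)"
    "\<forall>\<^sub>F s in at t within T. m s = \<Psi> (g s)"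
  using assms unfolding lift_on_def by blast

lemma lift_on_choose_sections:
  assumes "lift_on T g m"
  obtains U \<Psi> where "\<And>t. t \<in> T \<Longrightarrow> is_section (U t) (\<Psi> t)"
    "\<And>t. t \<in> T \<Longrightarrow> g t \<in> U t" "\<And>t. t \<in> T \<Longrightarrow> m t = \<Psi> t (g t)"
proof -
  have "\<forall>t\<in>T. \<exists>U \<Psi>. is_section U \<Psi> \<and> g t \<in> U \<and> m t = \<Psi> (g t)"
    using lift_on_sectionE[OF assms] by metis
  then show thesis using that unfolding bchoice_iff by blast
qed

lemma lift_on_continuous: "lift_on T g m \<Longrightarrow> continuous_on T g"
  by (simp add: lift_on_def)

lemma lift_on_fibre:
  assumes "lift_on T g m" "t \<in> T"
  shows "m t \<in> fibre (g t)"
  using lift_on_sectionE[OF assms] section_fibre by metis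

lemma lift_on_cong:
  assumes "lift_on T g m" and "\<And>t. t \<in> T \<Longrightarrow> g' t = g t" "\<And>t. t \<in> T \<Longrightarrow> m' t = m t"
  shows "lift_on T g' m'"
  unfolding lift_on_def
proof (intro conjI ballI)
  show "continuous_on T g'"
    using lift_on_continuous[OF assms(1)] assms(2) by (simp cong: continuous_on_cong)
  fix t assume t: "t \<in> T"
  from lift_on_sectionE[OF assms(1) t] obtain U \<Psi>
    where "is_section U \<Psi>" "g t \<in> U" "m t = \<Psi> (g t)" "\<forall>\<^sub>F s in at t within T. m s = \<Psi> (g s)" .
  with t show "\<exists>U \<Psi>. is_section U \<Psi> \<and> g' t \<in> U \<and> m' t = \<Psi> (g' t) \<and>
      (\<forall>\<^sub>F s in at t within T. m' s = \<Psi> (g' s))"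
    using assms(2,3) by (auto simp: eventually_at_topological)
qed

lemma eventually_section_eq:
  assumes "is_section U \<Psi>" "is_section V \<Psi>'" "c \<in> U" "c \<in> V" "\<Psi> c = \<Psi>' c"
  shows "\<forall>\<^sub>F x in nhds c. \<Psi> x = \<Psi>' x"
proof -
  have "open (U \<inter> V)" using assms section_open by blast
  then obtain \<eta> where \<eta>: "\<eta> > 0" "ball c \<eta> \<subseteq> U \<inter> V"
    using assms open_contains_ball by blast
  then have "\<Psi> x = \<Psi>' x" if "x \<in> ball c \<eta>" for x
    using section_unique[OF assms(1,2) open_ball convex_ball \<eta>(2) _ assms(5) that] by simp
  then show ?thesis
    using \<eta>(1) unfolding eventually_nhds by (intro exI[of _ "ball c \<eta>"]) auto
qed

lemma lift_on_eventually_eq_section: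
  assumes m: "lift_on T g m" and t: "t \<in> T" and "is_section V \<Psi>'" "g t \<in> V" "m t = \<Psi>' (g t)"
  shows "\<forall>\<^sub>F s in at t within T. m s = \<Psi>' (g s)"
proof -
  from lift_on_sectionE[OF m t] obtain U \<Psi> where U: "is_section U \<Psi>" "g t \<in> U" "m t = \<Psi> (g t)"
    and near: "\<forall>\<^sub>F s in at t within T. m s = \<Psi> (g s)" .
  have "\<forall>\<^sub>F x in nhds (g t). \<Psi> x = \<Psi>' x"
    using eventually_section_eq[OF U(1) assms(3) U(2) assms(4)] U(3) assms(5) by simp
  moreover have "(g \<longlongrightarrow> g t) (at t within T)"
    using lift_on_continuous[OF m] t by (simp add: continuous_on_def)
  ultimately have "\<forall>\<^sub>F s in at t within T. \<Psi> (g s) = \<Psi>' (g s)"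
    by (rule eventually_compose_filterlim)
  with near show ?thesis by eventually_elim simp
qed

lemma lift_on_section:
  assumes "is_section U \<Psi>" "continuous_on T g" "g \<in> T \<rightarrow> U"
  shows "lift_on T g (\<lambda>t. \<Psi> (g t))"
  using assms unfolding lift_on_def by (auto intro!: exI[of _ U] exI[of _ \<Psi>])

lemma lift_const:
  assumes "c \<in> S" "v \<in> fibre c"
  shows "lift_on T (\<lambda>_. c) (\<lambda>_. v)"
proof -
  obtain e where e: "e > 0" "ball c e \<subseteq> S"
    using open_base assms open_contains_ball by blast
  then obtain \<Psi> where "is_section (ball c e) \<Psi>" "\<Psi> c = v"
    using section_exists assms by blast
  then show ?thesis
    using lift_on_section[of "ball c e" \<Psi> T "\<lambda>_. c"] e(1) by simp
qed

lemma lift_on_map: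
  assumes "lift_on T g m" and "\<And>U \<Psi>. is_section U \<Psi> \<Longrightarrow> is_section U (\<lambda>x. \<theta> (\<Psi> x))"
  shows "lift_on T g (\<lambda>t. \<theta> (m t))"
  unfolding lift_on_def
proof (intro conjI ballI lift_on_continuous[OF assms(1)])
  fix t assume "t \<in> T"
  from lift_on_sectionE[OF assms(1) this] obtain U \<Psi> where U: "is_section U \<Psi>" "g t \<in> U"
    "m t = \<Psi> (g t)"
    and near: "\<forall>\<^sub>F s in at t within T. m s = \<Psi> (g s)" .
  from near have "\<forall>\<^sub>F s in at t within T. \<theta> (m s) = \<theta> (\<Psi> (g s))"
    by eventually_elim simp
  then show "\<exists>U \<Psi>. is_section U \<Psi> \<and> g t \<in> U \<and> \<theta> (m t) = \<Psi> (g t) \<and>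
      (\<forall>\<^sub>F s in at t within T. \<theta> (m s) = \<Psi> (g s))"
    using assms(2)[OF U(1)] U(2,3) by (intro exI[of _ U] exI[of _ "\<lambda>x. \<theta> (\<Psi> x)"]) auto
qed

lemma lift_on_compose_continuous:
  assumes m: "lift_on T g m" and \<theta>: "\<And>U \<Psi>. is_section U \<Psi> \<Longrightarrow> continuous_on U (\<lambda>x. \<theta> (\<Psi> x))"
  shows "continuous_on T (\<lambda>t. \<theta> (m t))"
  unfolding continuous_on_def
proof
  fix t assume t: "t \<in> T"
  from lift_on_sectionE[OF m t] obtain U \<Psi> where U: "is_section U \<Psi>" "g t \<in> U" "m t = \<Psi> (g t)"
    and near: "\<forall>\<^sub>F s in at t within T. m s = \<Psi> (g s)" .
  have "isCont (\<lambda>x. \<theta> (\<Psi> x)) (g t)"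
    using \<theta>[OF U(1)] section_open[OF U(1)] U(2) by (simp add: continuous_on_eq_continuous_at)
  moreover have "(g \<longlongrightarrow> g t) (at t within T)"
    using lift_on_continuous[OF m] t by (simp add: continuous_on_def)
  ultimately have "((\<lambda>s. \<theta> (\<Psi> (g s))) \<longlongrightarrow> \<theta> (\<Psi> (g t))) (at t within T)"
    by (rule isCont_tendsto_compose)
  moreover from near have "\<forall>\<^sub>F s in at t within T. \<theta> (\<Psi> (g s)) = \<theta> (m s)"
    by eventually_elim simp
  ultimately show "((\<lambda>s. \<theta> (m s)) \<longlongrightarrow> \<theta> (m t)) (at t within T)"
    unfolding U(3) by (rule Lim_transform_eventually)
qed

lemma lift_on_reparametrize:
  assumes m: "lift_on T g m" and \<phi>: "continuous_on T' \<phi>" "\<phi> \<in> T' \<rightarrow> T"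
  shows "lift_on T' (\<lambda>t. g (\<phi> t)) (\<lambda>t. m (\<phi> t))"
  unfolding lift_on_def
proof (intro conjI ballI)
  show "continuous_on T' (\<lambda>t. g (\<phi> t))"
    using \<phi>(2) by (intro continuous_on_compose2[OF lift_on_continuous[OF m] \<phi>(1)]) blast
  fix t assume t: "t \<in> T'"
  then have "\<phi> t \<in> T" using \<phi>(2) by blast
  from lift_on_sectionE[OF m this] obtain U \<Psi> where U: "is_section U \<Psi>" "g (\<phi> t) \<in> U"
    "m (\<phi> t) = \<Psi> (g (\<phi> t))"
    and near: "\<forall>\<^sub>F s in at (\<phi> t) within T. m s = \<Psi> (g s)" .
  from near U(3) have near': "\<forall>\<^sub>F s in nhds (\<phi> t). s \<in> T \<longrightarrow> m s = \<Psi> (g s)"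
    by (auto simp: eventually_at_filter elim!: eventually_mono)
  have "(\<phi> \<longlongrightarrow> \<phi> t) (at t within T')"
    using \<phi>(1) t by (simp add: continuous_on_def)
  from eventually_compose_filterlim[OF near' this]
  have "\<forall>\<^sub>F s in at t within T'. m (\<phi> s) = \<Psi> (g (\<phi> s))"
    using \<phi>(2) by (auto simp: eventually_at_filter elim!: eventually_mono)
  then show "\<exists>U \<Psi>. is_section U \<Psi> \<and> g (\<phi> t) \<in> U \<and> m (\<phi> t) = \<Psi> (g (\<phi> t)) \<and>
      (\<forall>\<^sub>F s in at t within T'. m (\<phi> s) = \<Psi> (g (\<phi> s)))"
    using U by blast
qed

lemma lift_on_Un:
  assumes AB: "closed A" "closed B" and m: "lift_on A g m" "lift_on B g m"
  shows "lift_on (A \<union> B) g m"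
  unfolding lift_on_def
proof (intro conjI ballI)
  show "continuous_on (A \<union> B) g"
    using AB m lift_on_continuous by (intro continuous_on_closed_Un) auto
  have near: "\<forall>\<^sub>F s in at t within C. m s = \<Psi> (g s)"
    if "closed C" "lift_on C g m" "is_section U \<Psi>" "g t \<in> U" "m t = \<Psi> (g t)" for C U \<Psi> t
  proof (cases "t \<in> C")
    case False
    then show ?thesis
      using that(1) by (auto simp: eventually_at_topological intro!: exI[of _ "- C"])
  qed (use that in \<open>blast intro: lift_on_eventually_eq_section\<close>)
  fix t assume "t \<in> A \<union> B"
  then obtain C where "t \<in> C" "lift_on C g m" using m by blast
  then obtain U \<Psi> where U: "is_section U \<Psi>" "g t \<in> U" "m t = \<Psi> (g t)"
    by (metis lift_on_sectionE)
  have "\<forall>\<^sub>F s in at t within (A \<union> B). m s = \<Psi> (g s)"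
    using near[OF AB(1) m(1) U] near[OF AB(2) m(2) U] by (simp add: at_within_union eventually_sup)
  then show "\<exists>U \<Psi>. is_section U \<Psi> \<and> g t \<in> U \<and> m t = \<Psi> (g t) \<and>
      (\<forall>\<^sub>F s in at t within A \<union> B. m s = \<Psi> (g s))"
    using U by blast
qed

lemma lift_reversepath:
  assumes "lift g m"
  shows "lift (reversepath g) (reversepath m)"
  using lift_on_reparametrize[OF assms, of "{0..1}" "\<lambda>t. 1 - t"]
  by (simp add: reversepath_def[abs_def] continuous_intros)

lemma lift_join:
  assumes m: "lift g m" "lift g' m'" and ends: "pathfinish g = pathstart g'"
    "pathfinish m = pathstart m'"
  shows "lift (g +++ g') (m +++ m')"
proof -
  have "lift_on {0..1/2} (g +++ g') (m +++ m')"
    by (rule lift_on_cong[OF lift_on_reparametrize[OF m(1), of "{0..1/2}" "\<lambda>t. 2 * t"]])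
      (auto simp: joinpaths_def intro!: continuous_intros)
  moreover have "lift_on {1/2..1} (g +++ g') (m +++ m')"
  proof (rule lift_on_cong[OF lift_on_reparametrize[OF m(2), of "{1/2..1}" "\<lambda>t. 2 * t - 1"]])
    fix t :: real assume "t \<in> {1/2..1}"
    then have "2 * t = 1 \<or> \<not> t \<le> 1/2" by auto
    then show "(g +++ g') t = g' (2 * t - 1)" "(m +++ m') t = m' (2 * t - 1)"
      using ends by (auto simp: joinpaths_def pathstart_def pathfinish_def)
  qed (auto intro!: continuous_intros)
  moreover have "{0..1/2} \<union> {1/2..1} = {0..1::real}" by auto
  ultimately show ?thesis
    using lift_on_Un[of "{0..1/2}" "{1/2..1}"] by simp
qed

lemma lift_on_unique:
  assumes m: "lift_on T g m" "lift_on T g m'" and T: "connected T" "r \<in> T" "t \<in> T" and "m r = m' r"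
  shows "m t = m' t"
proof -
  have "\<exists>N. openin (top_of_set T) N \<and> t \<in> N \<and> (\<forall>x\<in>N. \<forall>y\<in>N. m x = m' x \<longrightarrow> m y = m' y)"
    if t: "t \<in> T" for t
  proof -
    from lift_on_sectionE[OF m(1) t] obtain U \<Psi> where U: "is_section U \<Psi>" "g t \<in> U" "m t = \<Psi> (g t)"
      and near: "\<forall>\<^sub>F s in at t within T. m s = \<Psi> (g s)" .
    from lift_on_sectionE[OF m(2) t] obtain V \<Psi>' where V: "is_section V \<Psi>'" "g t \<in> V"
      "m' t = \<Psi>' (g t)"
      and near': "\<forall>\<^sub>F s in at t within T. m' s = \<Psi>' (g s)" .
    obtain \<eta> where \<eta>: "\<eta> > 0" "ball (g t) \<eta> \<subseteq> U \<inter> V"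
      using U V section_open open_contains_ball by (metis IntI open_Int)
    have "\<forall>\<^sub>F s in at t within T. g s \<in> ball (g t) \<eta>"
      using lift_on_continuous[OF m(1)] t \<eta>(1)
      by (intro continuous_on_eventually_in_open) auto
    with near near' have "\<forall>\<^sub>F s in at t within T. g s \<in> ball (g t) \<eta> \<and> m s = \<Psi> (g s)
        \<and> m' s = \<Psi>' (g s)"
      by eventually_elim simp
    then obtain N where N: "open N" "t \<in> N"
      "\<And>s. s \<in> N \<Longrightarrow> s \<noteq> t \<Longrightarrow> s \<in> T \<Longrightarrow> g s \<in> ball (g t) \<eta> \<and> m s = \<Psi> (g s) \<and> m' s = \<Psi>' (g s)"
      unfolding eventually_at_topological by blast
    have near: "g s \<in> ball (g t) \<eta>" "m s = \<Psi> (g s)" "m' s = \<Psi>' (g s)" if "s \<in> N \<inter> T" for s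
      using N(3)[of s] that U(3) V(3) \<eta>(1) by (cases "s = t"; simp)+
    have agree: "m y = m' y" if "x \<in> N \<inter> T" "y \<in> N \<inter> T" "m x = m' x" for x y
      using section_unique[OF U(1) V(1) open_ball convex_ball \<eta>(2), of "g x" "g y"]
        near[OF that(1)] near[OF that(2)] that(3) by simp
    have "openin (top_of_set T) (N \<inter> T)" using N(1) by (metis Int_commute openin_open_Int)
    then show ?thesis
      using N(2) t agree by (intro exI[of _ "N \<inter> T"] conjI ballI impI) blast+
  qed
  then show ?thesis
    using T assms by (intro connected_induction_simple[of T r t "\<lambda>t. m t = m' t"]) auto
qed

lemma lift_on_ball_sections:
  assumes m: "lift_on T g m" and g': "continuous_on T g'"
    and e: "\<And>t. t \<in> T \<Longrightarrow> dist (g t) (g' t) < e"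
    and P: "\<And>t. t \<in> T \<Longrightarrow> is_section (ball (g t) e) (P t)" "\<And>t. t \<in> T \<Longrightarrow> P t (g t) = m t"
  shows "lift_on T g' (\<lambda>t. P t (g' t))"
  unfolding lift_on_def
proof (intro conjI ballI g')
  fix t assume t: "t \<in> T"
  have g't: "g' t \<in> ball (g t) e" using e[OF t] by simp
  have gt: "g t \<in> ball (g t) e" using le_less_trans[OF zero_le_dist e[OF t]] by simp
  have "\<forall>\<^sub>F s in at t within T. m s = P t (g s)"
    by (rule lift_on_eventually_eq_section[OF m t P(1)[OF t] gt]) (simp add: P(2)[OF t])
  moreover have "\<forall>\<^sub>F s in at t within T. g s \<in> ball (g t) e"
    using lift_on_continuous[OF m] t gt by (intro continuous_on_eventually_in_open) auto
  moreover have "\<forall>\<^sub>F s in at t within T. g' s \<in> ball (g t) e"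
    using g' t g't by (intro continuous_on_eventually_in_open) auto
  moreover have "\<forall>\<^sub>F s in at t within T. s \<in> T"
    by (simp add: eventually_at_filter)
  ultimately have "\<forall>\<^sub>F s in at t within T. P s (g' s) = P t (g' s)"
  proof eventually_elim
    case (elim s)
    let ?W = "ball (g s) e \<inter> ball (g t) e"
    have "g s \<in> ?W" "g' s \<in> ?W"
      using e[OF elim(4)] elim(2,3) le_less_trans[OF zero_le_dist e[OF elim(4)]] by auto
    moreover have "P s (g s) = P t (g s)" using P(2)[OF elim(4)] elim(1) by simp
    ultimately show ?case
      using section_unique[OF P(1)[OF elim(4)] P(1)[OF t] open_Int[OF open_ball open_ball]
          convex_Int[OF convex_ball convex_ball] order_refl, of "g s" "g' s"] by blast
  qed
  then show "\<exists>U \<Psi>. is_section U \<Psi> \<and> g' t \<in> U \<and> P t (g' t) = \<Psi> (g' t) \<and>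
      (\<forall>\<^sub>F s in at t within T. P s (g' s) = \<Psi> (g' s))"
    using P(1)[OF t] g't by blast
qed

lemma lift_on_perturb:
  assumes m: "lift_on T g m" and g': "continuous_on T g'"
    and e: "\<And>t. t \<in> T \<Longrightarrow> dist (g t) (g' t) < e" "\<And>t. t \<in> T \<Longrightarrow> ball (g t) e \<subseteq> S"
  obtains m' where "lift_on T g' m'" "\<And>t. t \<in> T \<Longrightarrow> g' t = g t \<Longrightarrow> m' t = m t"
proof -
  have "\<forall>t\<in>T. \<exists>\<Psi>. is_section (ball (g t) e) \<Psi> \<and> \<Psi> (g t) = m t"
  proof
    fix t assume t: "t \<in> T"
    have "e > 0" using e(1)[OF t] zero_le_dist[of "g t" "g' t"] by linarith
    then show "\<exists>\<Psi>. is_section (ball (g t) e) \<Psi> \<and> \<Psi> (g t) = m t"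
      using lift_on_fibre[OF m t] e(2)[OF t] by (intro section_exists)
  qed
  from bchoice[OF this] obtain P where P: "\<And>t. t \<in> T \<Longrightarrow> is_section (ball (g t) e) (P t)"
    "\<And>t. t \<in> T \<Longrightarrow> P t (g t) = m t"
    by blast
  have "lift_on T g' (\<lambda>t. P t (g' t))"
    by (rule lift_on_ball_sections[OF m g' e(1) P])
  then show thesis using that P(2) by simp
qed

lemma lift_uniform_step:
  fixes h :: "real \<times> real \<Rightarrow> 'a"
  assumes h: "continuous_on ({0..1} \<times> {0..1}) h" "h \<in> {0..1} \<times> {0..1} \<rightarrow> S"
  obtains \<delta> where "\<delta> > 0"
    "\<forall>s\<in>{0..1}. \<forall>s'\<in>{0..1}. \<forall>m. dist s s' < \<delta> \<longrightarrow> lift (\<lambda>t. h (s, t)) m \<longrightarrow>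
      (\<exists>m'. lift (\<lambda>t. h (s', t)) m' \<and> (\<forall>t\<in>{0..1}. h (s', t) = h (s, t) \<longrightarrow> m' t = m t))"
proof -
  let ?Q = "{0..1::real} \<times> {0..1::real}"
  have "compact (h ` ?Q)"
    by (intro compact_continuous_image h(1) compact_Times compact_Icc)
  then obtain e where e: "e > 0" "(\<Union>c\<in>h ` ?Q. ball c e) \<subseteq> S"
    using compact_subset_open_imp_ball_epsilon_subset[OF _ open_base, of "h ` ?Q"] h(2) by blast
  have "uniformly_continuous_on ?Q h"
    by (intro compact_uniformly_continuous h(1) compact_Times compact_Icc)
  then obtain \<delta> where \<delta>: "\<delta> > 0"
    "\<And>x y. x \<in> ?Q \<Longrightarrow> y \<in> ?Q \<Longrightarrow> dist y x < \<delta> \<Longrightarrow> dist (h y) (h x) < e"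
    using e(1) unfolding uniformly_continuous_on_def by metis
  show thesis
  proof (rule that[OF \<delta>(1)], intro ballI allI impI)
    fix s s' m assume s: "s \<in> {0..1}" "s' \<in> {0..1}" "dist s s' < \<delta>" and m: "lift (\<lambda>t. h (s, t)) m"
    have "continuous_on {0..1} (\<lambda>t. h (s', t))"
      by (rule continuous_on_compose2[OF h(1)]) (use s(2) in \<open>auto intro!: continuous_intros\<close>)
    moreover have "dist (h (s, t)) (h (s', t)) < e" if "t \<in> {0..1}" for t
      using \<delta>(2)[of "(s', t)" "(s, t)"] s that by (simp add: dist_Pair_Pair)
    moreover have "ball (h (s, t)) e \<subseteq> S" if "t \<in> {0..1}" for t
      using e(2) s(1) that by blast
    ultimately show "\<exists>m'. lift (\<lambda>t. h (s', t)) m' \<and> (\<forall>t\<in>{0..1}. h (s', t) = h (s, t) \<longrightarrow> m' t = m t)"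
      using lift_on_perturb[OF m] by metis
  qed
qed

lemma lift_along_homotopy:
  fixes h :: "real \<times> real \<Rightarrow> 'a"
  assumes h: "continuous_on ({0..1} \<times> {0..1}) h" "h \<in> {0..1} \<times> {0..1} \<rightarrow> S"
    and m: "lift (\<lambda>t. h (0, t)) m"
  obtains m' where "lift (\<lambda>t. h (1, t)) m'"
    "\<forall>t\<in>{0..1}. (\<forall>s\<in>{0..1}. h (s, t) = h (0, t)) \<longrightarrow> m' t = m t"
proof -
  define P where "P s \<longleftrightarrow> (\<exists>m'. lift (\<lambda>t. h (s, t)) m' \<and>
    (\<forall>t\<in>{0..1}. (\<forall>s\<in>{0..1}. h (s, t) = h (0, t)) \<longrightarrow> m' t = m t))" for s
  obtain \<delta> where \<delta>: "\<delta> > 0"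
    "\<forall>s\<in>{0..1}. \<forall>s'\<in>{0..1}. \<forall>m. dist s s' < \<delta> \<longrightarrow> lift (\<lambda>t. h (s, t)) m \<longrightarrow>
      (\<exists>m'. lift (\<lambda>t. h (s', t)) m' \<and> (\<forall>t\<in>{0..1}. h (s', t) = h (s, t) \<longrightarrow> m' t = m t))"
    by (rule lift_uniform_step[OF h])
  have step: "P s'" if s: "s \<in> {0..1}" "s' \<in> {0..1}" "dist s s' < \<delta>" and "P s" for s s'
  proof -
    obtain m1 where m1: "lift (\<lambda>t. h (s, t)) m1"
      "\<And>t. t \<in> {0..1} \<Longrightarrow> \<forall>s\<in>{0..1}. h (s, t) = h (0, t) \<Longrightarrow> m1 t = m t"
      using \<open>P s\<close> unfolding P_def by blast
    obtain m2 where "lift (\<lambda>t. h (s', t)) m2"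
      "\<And>t. t \<in> {0..1} \<Longrightarrow> h (s', t) = h (s, t) \<Longrightarrow> m2 t = m1 t"
      using \<delta>(2) s m1(1) by metis
    then show ?thesis
      using m1(2) s unfolding P_def by metis
  qed
  have "P 1"
  proof (rule connected_induction_simple[of "{0..1::real}" 0 1 P])
    show "P 0" using m unfolding P_def by blast
    fix s :: real assume s: "s \<in> {0..1}"
    show "\<exists>N. openin (top_of_set {0..1}) N \<and> s \<in> N \<and> (\<forall>x\<in>N. \<forall>y\<in>N. P x \<longrightarrow> P y)"
    proof (intro exI conjI ballI impI)
      show "openin (top_of_set {0..1}) ({0..1} \<inter> ball s (\<delta>/2))"
        by (simp add: openin_open_Int)
      show "s \<in> {0..1} \<inter> ball s (\<delta>/2)" using s \<delta>(1) by simp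
      fix x y assume "x \<in> {0..1} \<inter> ball s (\<delta>/2)" "y \<in> {0..1} \<inter> ball s (\<delta>/2)" "P x"
      then show "P y"
        using step[of x y] dist_triangle_half_r[of s x \<delta> y] by simp
    qed
  qed auto
  then show thesis using that unfolding P_def by blast
qed

lemma lift_exists:
  assumes g: "path g" "path_image g \<subseteq> S" and v: "v \<in> fibre (pathstart g)"
  obtains m where "lift g m" "m 0 = v"
proof -
  let ?h = "\<lambda>y::real\<times>real. g (fst y * snd y)"
  have unit: "(\<lambda>y::real\<times>real. fst y * snd y) \<in> {0..1} \<times> {0..1} \<rightarrow> {0..1}"
    by (auto intro: mult_le_one)
  have "continuous_on ({0..1} \<times> {0..1}) ?h"
  proof (rule continuous_on_compose2[where g = g])
    show "continuous_on {0..1} g" using g(1) by (simp add: path_def)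
    show "continuous_on ({0..1} \<times> {0..1}) (\<lambda>y::real\<times>real. fst y * snd y)"
      by (intro continuous_intros)
  qed (use unit in blast)
  moreover have "?h \<in> {0..1} \<times> {0..1} \<rightarrow> S"
    using unit g(2) unfolding path_image_def by blast
  moreover have "pathstart g \<in> S" using g(2) pathstart_in_path_image by blast
  then have "lift (\<lambda>t. ?h (0, t)) (\<lambda>_. v)"
    using lift_const v by (simp add: pathstart_def)
  ultimately obtain m where "lift (\<lambda>t. ?h (1, t)) m"
    "\<forall>t\<in>{0..1}. (\<forall>s\<in>{0..1}. ?h (s, t) = ?h (0, t)) \<longrightarrow> m t = v"
    by (rule lift_along_homotopy)
  then show thesis using that[of m] by auto
qed

lemma lift_homotopic:
  assumes "homotopic_paths S g g'" and m: "lift g m"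
  obtains m' where "lift g' m'" "m' 0 = m 0" "m' 1 = m 1"
proof -
  obtain h :: "real \<times> real \<Rightarrow> 'a" where h: "continuous_on ({0..1} \<times> {0..1}) h"
    "h \<in> {0..1} \<times> {0..1} \<rightarrow> S"
    and rows: "\<And>t. t \<in> {0..1} \<Longrightarrow> h (0, t) = g t" "\<And>t. t \<in> {0..1} \<Longrightarrow> h (1, t) = g' t"
    and ends: "\<And>s. s \<in> {0..1} \<Longrightarrow> h (s, 0) = g 0" "\<And>s. s \<in> {0..1} \<Longrightarrow> h (s, 1) = g 1"
    using assms(1) unfolding homotopic_paths by (auto simp: pathstart_def pathfinish_def)
  obtain m' where m': "lift (\<lambda>t. h (1, t)) m'"
    "\<forall>t\<in>{0..1}. (\<forall>s\<in>{0..1}. h (s, t) = h (0, t)) \<longrightarrow> m' t = m t"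
    by (rule lift_along_homotopy[OF h lift_on_cong[OF m rows(1) refl]])
  show thesis
    using lift_on_cong[OF m'(1)] rows(2) m'(2) ends by (intro that[of m']) auto
qed

end

section \<open>First-order Fuchsian equations\<close>

abbreviation two_pi_i :: complex where
  "two_pi_i \<equiv> 2 * of_real pi * \<i>"

lemma exp_two_pi_i_of_nat: "exp (two_pi_i * of_nat n) = 1"
  by (simp add: exp_of_nat2_mult)

lemma of_nat_add_nonzero_if_exp_ne_1:
  assumes "exp (two_pi_i * b) \<noteq> 1"
  shows "of_nat n + b \<noteq> 0"
proof
  assume "of_nat n + b = 0"
  then have "two_pi_i * b = - (two_pi_i * of_nat n)"
    by (simp add: add_eq_0_iff2)
  with assms show False by (simp add: exp_minus exp_two_pi_i_of_nat)
qed

lemma filterlim_of_nat_add_at_infinity: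
  "filterlim (\<lambda>n. of_nat n + (b::complex)) at_infinity sequentially"
  by (rule tendsto_add_filterlim_at_infinity'[OF tendsto_of_nat tendsto_const])

lemma has_field_derivative_eq_on_convex:
  fixes f g :: "complex \<Rightarrow> complex"
  assumes W: "convex W"
    and f: "\<And>x. x \<in> W \<Longrightarrow> (f has_field_derivative d x) (at x)"
    and g: "\<And>x. x \<in> W \<Longrightarrow> (g has_field_derivative d x) (at x)"
    and xy: "x \<in> W" "y \<in> W" and eq: "f x = g x"
  shows "f y = g y"
proof -
  have "((\<lambda>z. f z - g z) has_field_derivative 0) (at z within W)" if "z \<in> W" for z
    using DERIV_diff[OF f[OF that] g[OF that]] by (auto intro: has_field_derivative_at_within)
  then obtain k where "\<And>z. z \<in> W \<Longrightarrow> f z - g z = k"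
    using has_field_derivative_zero_constant[OF W] by metis
  from this[OF xy(1)] this[OF xy(2)] show ?thesis using eq by simp
qed

lemma has_field_derivative_imp_holomorphic_on:
  assumes "\<And>x. x \<in> A \<Longrightarrow> (f has_field_derivative f' x) (at x)"
  shows "f holomorphic_on A"
  using assms unfolding holomorphic_on_def field_differentiable_def
  by (blast intro: has_field_derivative_at_within)

lemma primitive_on_ball:
  fixes f :: "complex \<Rightarrow> complex"
  assumes "f holomorphic_on ball c e"
  obtains F where "F c = v" "\<forall>x\<in>ball c e. (F has_field_derivative f x) (at x)"
proof -
  obtain F where F: "\<And>x. x \<in> ball c e \<Longrightarrow> (F has_field_derivative f x) (at x)"
    using holomorphic_convex_primitive'[OF convex_ball open_ball assms]
    by (metis at_within_open open_ball)
  show thesis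
  proof (rule that[of "\<lambda>x. F x - F c + v"])
    show "\<forall>x\<in>ball c e. ((\<lambda>x. F x - F c + v) has_field_derivative f x) (at x)"
      using F by (auto intro!: derivative_eq_intros)
  qed simp
qed

lemma fps_conv_radius_divide_of_nat_add:
  fixes G :: "complex fps"
  shows "fps_conv_radius G \<le> fps_conv_radius (Abs_fps (\<lambda>n. fps_nth G n / (of_nat n + b)))"
  unfolding fps_conv_radius_def[of "Abs_fps _"]
proof (rule conv_radius_geI_ex')
  fix s assume "0 < s" "ereal s < fps_conv_radius G"
  then have "summable (\<lambda>n. norm (fps_nth G n * of_real s ^ n))"
    by (intro norm_summable_fps) simp
  moreover have "\<forall>\<^sub>F n in sequentially. norm (of_nat n + b) \<ge> 1"
    using filterlim_of_nat_add_at_infinity[of b] by (simp add: filterlim_at_infinity[of 0])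
  then have "\<forall>\<^sub>F n in sequentially.
      norm (fps_nth G n / (of_nat n + b) * of_real s ^ n) \<le> norm (fps_nth G n * of_real s ^ n)"
  proof eventually_elim
    case (elim n)
    then have "norm (fps_nth G n) / norm (of_nat n + b) \<le> norm (fps_nth G n) / 1"
      by (intro divide_left_mono) auto
    then have "norm (fps_nth G n / (of_nat n + b)) \<le> norm (fps_nth G n)"
      by (simp add: norm_divide)
    then show ?case unfolding norm_mult by (rule mult_right_mono) simp
  qed
  ultimately have "summable (\<lambda>n. fps_nth G n / (of_nat n + b) * of_real s ^ n)"
    by (rule summable_comparison_test_ev[rotated])
  then show "summable (\<lambda>n. fps_nth (Abs_fps (\<lambda>n. fps_nth G n / (of_nat n + b))) n * of_real s ^ n)"
    by simp
qed

lemma fps_fuchsian_solution: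
  fixes G :: "complex fps"
  assumes b: "\<And>n. of_nat n + b \<noteq> 0"
  defines "F \<equiv> Abs_fps (\<lambda>n. fps_nth G n / (of_nat n + b))"
  shows "fps_X * fps_deriv F + fps_const b * F = G"
proof (rule fps_ext)
  fix n
  have "fps_nth (fps_X * fps_deriv F + fps_const b * F) n = (of_nat n + b) * fps_nth F n"
    by (cases n) (simp_all add: ring_distribs)
  then show "fps_nth (fps_X * fps_deriv F + fps_const b * F) n = fps_nth G n"
    using b[of n] by (simp add: F_def)
qed

lemma frobenius_solution:
  assumes g: "g holomorphic_on ball a r" and b: "\<And>n. of_nat n + b \<noteq> (0::complex)"
  obtains f f' where "\<forall>x\<in>ball a r. (f has_field_derivative f' x) (at x)"
    "\<forall>x\<in>ball a r. (x - a) * f' x + b * f x = g x"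
proof -
  define G where "G = fps_expansion g a"
  define F where "F = Abs_fps (\<lambda>n. fps_nth G n / (of_nat n + b))"
  have G: "ereal r \<le> fps_conv_radius G" "\<And>x. x \<in> ball a r \<Longrightarrow> eval_fps G (x - a) = g x"
    using conv_radius_fps_expansion[of g a "ereal r"] eval_fps_expansion[of g a "ereal r"] g
    by (simp_all add: G_def)
  have F: "norm (x - a) < fps_conv_radius F" if "x \<in> ball a r" for x
  proof -
    have "ereal (norm (x - a)) < ereal r" using that by (simp add: dist_norm norm_minus_commute)
    also have "\<dots> \<le> fps_conv_radius F"
      using G(1) fps_conv_radius_divide_of_nat_add[of G b] unfolding F_def by (rule order_trans)
    finally show ?thesis .
  qed
  have ode: "fps_X * fps_deriv F + fps_const b * F = G"
    unfolding F_def using b by (rule fps_fuchsian_solution)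
  show thesis
  proof (rule that[of "\<lambda>x. eval_fps F (x - a)" "\<lambda>x. eval_fps (fps_deriv F) (x - a)"]; intro ballI)
    fix x assume x: "x \<in> ball a r"
    have "((\<lambda>x. x - a) has_field_derivative 1) (at x)" by (auto intro!: derivative_eq_intros)
    from DERIV_chain2[OF has_field_derivative_eval_fps[OF F[OF x]] this]
    show "((\<lambda>x. eval_fps F (x - a)) has_field_derivative eval_fps (fps_deriv F) (x - a)) (at x)"
      by simp
    have F': "norm (x - a) < fps_conv_radius (fps_deriv F)"
      using F[OF x] fps_conv_radius_deriv by (rule less_le_trans)
    have "norm (x - a) < fps_conv_radius (fps_X * fps_deriv F)"
      "norm (x - a) < fps_conv_radius (fps_const b * F)"
      using F[OF x] F' by (auto intro: less_le_trans[OF _ fps_conv_radius_mult])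
    then have "eval_fps (fps_X * fps_deriv F + fps_const b * F) (x - a) =
        (x - a) * eval_fps (fps_deriv F) (x - a) + b * eval_fps F (x - a)"
      using F[OF x] F' by (simp add: eval_fps_add eval_fps_mult)
    then show "(x - a) * eval_fps (fps_deriv F) (x - a) + b * eval_fps F (x - a) = g x"
      by (simp add: ode G(2)[OF x])
  qed
qed

lemma exp_rotation_in_punctured_ball:
  assumes x: "x \<noteq> a" and w: "Re w < ln (r / norm (x - a))" and r: "r > 0"
  shows "a + (x - a) * exp w \<in> ball a r - {a}"
proof -
  have pos: "norm (x - a) > 0" using x by simp
  have "exp (Re w) < exp (ln (r / norm (x - a)))"
    using w by simp
  also have "\<dots> = r / norm (x - a)"
    using pos r by simp
  finally have "norm (x - a) * exp (Re w) < r"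
    using pos by (simp add: pos_less_divide_eq mult.commute)
  then show ?thesis
    using x by (simp add: dist_norm norm_mult)
qed

text \<open>Along \<open>w \<mapsto> a + (x - a) e\<^sup>w\<close> the solution is a multiple of \<open>e\<^bsup>-b w\<^esup>\<close>, which is not
  \<open>2\<pi>i\<close>-periodic.\<close>

lemma homogeneous_fuchsian_single_valued_eq_0:
  assumes f: "\<And>x. x \<in> ball a r - {a} \<Longrightarrow> (f has_field_derivative f' x) (at x)"
    and ode: "\<And>x. x \<in> ball a r - {a} \<Longrightarrow> (x - a) * f' x + b * f x = 0"
    and b: "exp (two_pi_i * b) \<noteq> 1" and x: "x \<in> ball a r - {a}"
  shows "f x = 0"
proof -
  define \<phi> where "\<phi> w = a + (x - a) * exp w" for w
  define W where "W = {w. Re w < ln (r / norm (x - a))}"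
  have nx: "0 < norm (x - a)" "norm (x - a) < r"
    using x by (auto simp: dist_norm norm_minus_commute)
  then have "0 < r" by linarith
  then have \<phi>: "\<phi> w \<in> ball a r - {a}" if "w \<in> W" for w
    using exp_rotation_in_punctured_ball[of x a w r] x that by (simp add: \<phi>_def W_def)
  have deriv: "((\<lambda>w. f (\<phi> w) * exp (b * w)) has_field_derivative 0) (at w)" if "w \<in> W" for w
  proof -
    have "(\<phi> has_field_derivative \<phi> w - a) (at w)"
      unfolding \<phi>_def by (auto intro!: derivative_eq_intros)
    from DERIV_chain2[OF f[OF \<phi>[OF that]] this]
    have "((\<lambda>w. f (\<phi> w) * exp (b * w)) has_field_derivative
        ((\<phi> w - a) * f' (\<phi> w) + b * f (\<phi> w)) * exp (b * w)) (at w)"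
      by (auto intro!: derivative_eq_intros simp: algebra_simps)
    then show ?thesis using ode[OF \<phi>[OF that]] by simp
  qed
  have "convex W"
    unfolding W_def by (rule convex_halfspace_Re_lt)
  moreover have "0 < ln (r / norm (x - a))"
    using nx by (intro ln_gt_zero) (simp add: pos_less_divide_eq)
  then have "0 \<in> W" "two_pi_i \<in> W"
    by (simp_all add: W_def)
  ultimately have "f (\<phi> 0) * exp (b * 0) = f (\<phi> two_pi_i) * exp (b * two_pi_i)"
    using has_field_derivative_eq_on_convex[of W "\<lambda>w. f (\<phi> w) * exp (b * w)" "\<lambda>_. 0"
        "\<lambda>_. f (\<phi> 0) * exp (b * 0)" 0 two_pi_i] deriv by simp
  then show ?thesis
    using b by (simp add: \<phi>_def mult.commute)
qed

lemma fuchsian_single_valued_removable: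
  assumes f: "\<And>x. x \<in> ball a r - {a} \<Longrightarrow> (f has_field_derivative f' x) (at x)"
    and ode: "\<And>x. x \<in> ball a r - {a} \<Longrightarrow> (x - a) * f' x + k x * f x = g x"
    and k: "k holomorphic_on ball a r" "exp (two_pi_i * k a) \<noteq> 1" and g: "g holomorphic_on ball a r"
  obtains F where "F holomorphic_on ball a r" "\<forall>x\<in>ball a r - {a}. F x = f x"
proof -
  define q where "q x = (if x = a then deriv k a else (k x - k a) / (x - a))" for x
  have "q holomorphic_on ball a r"
    unfolding q_def by (rule pole_lemma_open[OF k(1) open_ball])
  then obtain E where "E a = 0" and "\<forall>x\<in>ball a r. (E has_field_derivative q x) (at x)"
    by (rule primitive_on_ball)
  then have E: "(E has_field_derivative q x) (at x)" if "x \<in> ball a r" for x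
    using that by blast
  then have hol: "E holomorphic_on ball a r"
    by (rule has_field_derivative_imp_holomorphic_on)
  have "(\<lambda>x. exp (E x) * g x) holomorphic_on ball a r"
    using hol g by (intro holomorphic_intros)
  from frobenius_solution[OF this of_nat_add_nonzero_if_exp_ne_1[OF k(2)]]
  obtain K K' where K: "\<forall>x\<in>ball a r. (K has_field_derivative K' x) (at x)"
    "\<forall>x\<in>ball a r. (x - a) * K' x + k a * K x = exp (E x) * g x" .
  have "exp (E x) * f x - K x = 0" if "x \<in> ball a r - {a}" for x
  proof (rule homogeneous_fuchsian_single_valued_eq_0[OF _ _ k(2) that])
    fix x assume x: "x \<in> ball a r - {a}"
    show "((\<lambda>x. exp (E x) * f x - K x) has_field_derivative
        exp (E x) * (f' x + q x * f x) - K' x) (at x)"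
      using f[OF x] E[of x] bspec[OF K(1), of x] x
      by (auto intro!: derivative_eq_intros simp: algebra_simps)
    have "(x - a) * (exp (E x) * (f' x + q x * f x) - K' x) + k a * (exp (E x) * f x - K x) =
        exp (E x) * ((x - a) * f' x + ((x - a) * q x + k a) * f x) - ((x - a) * K' x + k a * K x)"
      by (simp add: algebra_simps)
    also have "(x - a) * q x + k a = k x" using x by (simp add: q_def)
    finally show
      "(x - a) * (exp (E x) * (f' x + q x * f x) - K' x) + k a * (exp (E x) * f x - K x) = 0"
      using ode[OF x] K(2) x by simp
  qed
  then have "\<forall>x\<in>ball a r - {a}. exp (- E x) * K x = f x"
    by (simp add: exp_minus field_simps)
  moreover have "(\<lambda>x. exp (- E x) * K x) holomorphic_on ball a r"
    using hol has_field_derivative_imp_holomorphic_on[OF bspec[OF K(1)]]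
    by (intro holomorphic_intros)
  ultimately show thesis by (rule that[rotated])
qed

lemma conv_radius_eq_1_if_recurrence:
  fixes F :: "nat \<Rightarrow> complex"
  assumes F0: "F 0 \<noteq> 0" and rec: "\<And>n. (of_nat n + b) * F n = (of_nat (Suc n) + c) * F (Suc n)"
    and b: "\<And>n. of_nat n + b \<noteq> 0"
  shows "conv_radius F = 1"
proof -
  have nz: "F n \<noteq> 0" for n
  proof (induction n)
    case 0
    show ?case by (fact F0)
  next
    case (Suc n)
    then show ?case using rec[of n] b[of n] by auto
  qed
  have "(\<lambda>n. (1 + c - b) / (of_nat n + b)) \<longlonglongrightarrow> 0"
    by (rule tendsto_divide_0[OF tendsto_const filterlim_of_nat_add_at_infinity])
  from tendsto_norm[OF tendsto_add[OF tendsto_const[of 1] this]]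
  have "(\<lambda>n. norm (1 + (1 + c - b) / (of_nat n + b))) \<longlonglongrightarrow> 1"
    by simp
  moreover have "norm (1 + (1 + c - b) / (of_nat n + b)) = norm (F n) / norm (F (Suc n))" for n
  proof -
    have "1 + (1 + c - b) / (of_nat n + b) = (of_nat (Suc n) + c) / (of_nat n + b)"
      using b[of n] by (simp add: field_simps)
    also have "\<dots> = F n / F (Suc n)"
      using rec[of n] b[of n] nz[of "Suc n"] by (simp add: divide_eq_eq eq_divide_eq mult_ac)
    finally show ?thesis by (simp add: norm_divide)
  qed
  ultimately show ?thesis
    using nz by (intro conv_radius_ratio_limit_nonzero[of _ 1]) (simp_all add: one_ereal_def)
qed

lemma no_entire_hypergeometric_primitive:
  assumes hol: "f holomorphic_on UNIV"
    and ode: "\<And>t. t * (t - 1) * deriv f t + (c * (t - 1) + d * t) * f t = (1::complex)"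
    and c: "\<And>n. of_nat n + c \<noteq> 0" and cd: "\<And>n. of_nat n + (c + d) \<noteq> 0"
  shows False
proof -
  define F where "F = fps_expansion f 0"
  have F: "f has_fps_expansion F"
    using analytic_at_imp_has_fps_expansion_0 holomorphic_on_imp_analytic_at[OF hol]
    by (simp add: F_def)
  have "(\<lambda>t. t * (t - 1) * deriv f t + (c * (t - 1) + d * t) * f t) has_fps_expansion
      fps_X * (fps_X - 1) * fps_deriv F + (fps_const c * (fps_X - 1) + fps_const d * fps_X) * F"
    by (intro fps_expansion_intros F)
  then have expansion: "(\<lambda>_. 1) has_fps_expansion
      fps_X * (fps_X - 1) * fps_deriv F + (fps_const c * (fps_X - 1) + fps_const d * fps_X) * F"
    by (simp only: ode)
  have eq: "fps_X * (fps_X - 1) * fps_deriv F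
      + (fps_const c * (fps_X - 1) + fps_const d * fps_X) * F = 1"
    by (rule trans[OF fps_expansion_eqI[OF expansion, symmetric]
      fps_expansion_eqI[OF has_fps_expansion_1]])
  have "fps_X * (fps_X * fps_deriv F + (fps_const c + fps_const d) * F)
      - (fps_X * fps_deriv F + fps_const c * F) = 1"
    by (rule trans[OF _ eq]) (simp add: algebra_simps del: fps_const_add)
  then have "fps_X * (fps_X * fps_deriv F + fps_const (c + d) * F)
      - (fps_X * fps_deriv F + fps_const c * F) = 1"
    by simp
  then have coeff: "fps_nth (fps_X * (fps_X * fps_deriv F + fps_const (c + d) * F)
      - (fps_X * fps_deriv F + fps_const c * F)) n = fps_nth 1 n" for n
    by simp
  have F0: "c * fps_nth F 0 = - 1"
    using coeff[of 0] by (simp add: minus_equation_iff)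
  have Fn: "(of_nat n + (c + d)) * fps_nth F n = (of_nat (Suc n) + c) * fps_nth F (Suc n)" for n
  proof -
    have "of_nat n * fps_nth F n + (c + d) * fps_nth F n
        - (of_nat (Suc n) * fps_nth F (Suc n) + c * fps_nth F (Suc n)) = 0"
      using coeff[of "Suc n"] by (cases n) simp_all
    then show ?thesis by (simp add: algebra_simps)
  qed
  have "conv_radius (fps_nth F) = 1"
    using F0 by (intro conv_radius_eq_1_if_recurrence[OF _ Fn cd]) auto
  moreover have "fps_conv_radius F = \<infinity>"
    using conv_radius_fps_expansion[of f 0 \<infinity>] hol by (simp add: F_def)
  ultimately show False by (simp add: fps_conv_radius_def)
qed

lemma holomorphic_on_extend_point:
  assumes f: "f holomorphic_on S - {a}" and S: "open S" and r: "r > 0"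
    and g: "g holomorphic_on ball a r" "\<And>x. x \<in> ball a r - {a} \<Longrightarrow> g x = f x"
  shows "(\<lambda>x. if x = a then g a else f x) holomorphic_on S"
proof -
  let ?F = "\<lambda>x. if x = a then g a else f x"
  have "?F holomorphic_on S - {a}"
    using f by (rule holomorphic_transform) auto
  moreover have "?F holomorphic_on ball a r"
    using g(1) by (rule holomorphic_transform) (use g(2) in auto)
  ultimately have "?F holomorphic_on (S - {a}) \<union> ball a r"
    using S by (intro holomorphic_on_Un open_Diff) auto
  then show ?thesis by (rule holomorphic_on_subset) (use r in auto)
qed

lemma single_valued_hypergeometric_primitive_entire:
  fixes f f' :: "complex \<Rightarrow> complex"
  assumes f: "\<And>x. x \<in> - {0, 1} \<Longrightarrow> (f has_field_derivative f' x) (at x)"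
    and ode: "\<And>x. x \<in> - {0, 1} \<Longrightarrow> x * (x - 1) * f' x + (c * (x - 1) + d * x) * f x = 1"
    and cd: "exp (two_pi_i * c) \<noteq> 1" "exp (two_pi_i * d) \<noteq> 1"
  obtains F where "F holomorphic_on UNIV" "\<forall>x\<in>- {0, 1}. F x = f x"
proof -
  have nz: "x - 1 \<noteq> 0" if "x \<in> ball 0 1" for x :: complex using that by auto
  have nz': "x \<noteq> 0" if "x \<in> ball 1 1" for x :: complex using that by auto
  have ode0: "(x - 0) * f' x + (c + d * x / (x - 1)) * f x = 1 / (x - 1)"
    if x: "x \<in> ball 0 1 - {0}" for x
  proof -
    have "(x - 0) * f' x + (c + d * x / (x - 1)) * f x
        = (x * (x - 1) * f' x + (c * (x - 1) + d * x) * f x) / (x - 1)"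
      using nz x by (simp add: field_simps)
    then show ?thesis using ode[of x] nz x by auto
  qed
  have ode1: "(x - 1) * f' x + (d + c * (x - 1) / x) * f x = 1 / x" if x: "x \<in> ball 1 1 - {1}" for x
  proof -
    have "(x - 1) * f' x + (d + c * (x - 1) / x) * f x
        = (x * (x - 1) * f' x + (c * (x - 1) + d * x) * f x) / x"
      using nz' x by (simp add: field_simps)
    then show ?thesis using ode[of x] nz' x by auto
  qed
  have "(\<lambda>x. c + d * x / (x - 1)) holomorphic_on ball 0 1"
    "(\<lambda>x. 1 / (x - 1)) holomorphic_on ball 0 1"
    "(\<lambda>x. d + c * (x - 1) / x) holomorphic_on ball 1 1" "(\<lambda>x. 1 / x) holomorphic_on ball 1 1"
    using nz nz' by (intro holomorphic_intros; blast)+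
  note hol = this
  obtain F0 where F0: "F0 holomorphic_on ball 0 1" "\<forall>x\<in>ball 0 1 - {0}. F0 x = f x"
    by (rule fuchsian_single_valued_removable[OF f ode0 hol(1) _ hol(2)]) (use cd(1) nz in auto)
  obtain F1 where F1: "F1 holomorphic_on ball 1 1" "\<forall>x\<in>ball 1 1 - {1}. F1 x = f x"
    by (rule fuchsian_single_valued_removable[OF f ode1 hol(3) _ hol(4)]) (use cd(2) nz' in auto)
  have "f holomorphic_on (UNIV - {1}) - {0}"
    by (rule has_field_derivative_imp_holomorphic_on[OF f]) auto
  then have "(\<lambda>x. if x = 0 then F0 0 else f x) holomorphic_on UNIV - {1}"
    by (rule holomorphic_on_extend_point[OF _ _ _ F0(1)]) (use F0(2) in auto)
  then have "(\<lambda>x. if x = 1 then F1 1 else if x = 0 then F0 0 else f x) holomorphic_on UNIV"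
    by (rule holomorphic_on_extend_point[OF _ open_UNIV _ F1(1)]) (use F1(2) in auto)
  then show thesis by (rule that) auto
qed

lemma no_single_valued_hypergeometric_primitive:
  fixes f f' :: "complex \<Rightarrow> complex"
  assumes f: "\<And>x. x \<in> - {0, 1} \<Longrightarrow> (f has_field_derivative f' x) (at x)"
    and ode: "\<And>x. x \<in> - {0, 1} \<Longrightarrow> x * (x - 1) * f' x + (c * (x - 1) + d * x) * f x = 1"
    and cd: "exp (two_pi_i * c) \<noteq> 1" "exp (two_pi_i * d) \<noteq> 1" "Re (c + d) > 0"
  shows False
proof -
  obtain F where hol: "F holomorphic_on UNIV" and F: "\<forall>x\<in>- {0, 1}. F x = f x"
    using single_valued_hypergeometric_primitive_entire[OF f ode cd(1,2)] .
  let ?P = "\<lambda>x. x * (x - 1) * deriv F x + (c * (x - 1) + d * x) * F x"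
  have S: "open (- {0, 1 :: complex})" by (simp add: open_Compl)
  have P: "?P x = 1" if x: "x \<in> - {0, 1}" for x
  proof -
    have "(F has_field_derivative f' x) (at x)"
      by (rule has_field_derivative_transform_within_open[OF f[OF x] S x]) (simp add: F)
    then show ?thesis using ode[OF x] F x by (simp add: DERIV_imp_deriv)
  qed
  have "continuous_on UNIV ?P"
    using hol holomorphic_deriv[OF hol open_UNIV]
    by (intro continuous_intros holomorphic_on_imp_continuous_on)
  moreover have "closure (- {0, 1}) = (UNIV :: complex set)"
    by (simp add: closure_complement empty_interior_finite)
  ultimately have "?P x = 1" for x
    using continuous_constant_on_closure[of "- {0, 1}" ?P 1 x] P by simp
  then show False
  proof (rule no_entire_hypergeometric_primitive[OF hol])
    show "of_nat n + c \<noteq> 0" for n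
      using cd(1) by (rule of_nat_add_nonzero_if_exp_ne_1)
    show "of_nat n + (c + d) \<noteq> 0" for n
      using cd(3) by (auto simp: complex_eq_iff)
  qed
qed

section \<open>Branches of the logarithms and of a primitive of their exponential\<close>

type_synonym branch_value = "complex \<times> complex \<times> complex"

abbreviation log0 :: "branch_value \<Rightarrow> complex" where "log0 v \<equiv> fst v"
abbreviation log1 :: "branch_value \<Rightarrow> complex" where "log1 v \<equiv> fst (snd v)"
abbreviation prim :: "branch_value \<Rightarrow> complex" where "prim v \<equiv> snd (snd v)"

definition branch_fibre :: "complex \<Rightarrow> branch_value set" where
  "branch_fibre x = {v. exp (log0 v) = x \<and> exp (log1 v) = x - 1}"

definition base_value :: "complex \<Rightarrow> branch_value" where
  "base_value x = (Ln x, Ln (x - 1), 0)"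

lemma base_value_in_fibre: "x \<in> - {0, 1} \<Longrightarrow> base_value x \<in> branch_fibre x"
  by (simp add: base_value_def branch_fibre_def)

lemma branch_fibre_imp_base: "v \<in> branch_fibre x \<Longrightarrow> x \<in> - {0, 1}"
  by (auto simp: branch_fibre_def)

lemma log_on_ball:
  fixes a c v :: complex
  assumes a: "a \<notin> ball c e" and "e > 0" and v: "exp v = c - a"
  obtains L where "L c = v"
    "\<forall>x\<in>ball c e. exp (L x) = x - a \<and> (L has_field_derivative 1 / (x - a)) (at x)"
proof -
  have "(\<lambda>x. x - a) holomorphic_on ball c e" by (intro holomorphic_intros)
  then obtain l where l: "l holomorphic_on ball c e" "\<And>x. x \<in> ball c e \<Longrightarrow> x - a = exp (l x)"
    by (rule contractible_imp_holomorphic_log[OF _ convex_imp_contractible[OF convex_ball]])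
      (use a in auto)
  define L where "L x = l x - l c + v" for x
  have "exp (L x) = x - a" if "x \<in> ball c e" for x
  proof -
    have "exp (L x) = exp (l x) * (exp v / exp (l c))"
      by (simp add: L_def exp_add exp_diff)
    also have "\<dots> = x - a"
      using l(2)[OF that] l(2)[of c] v \<open>e > 0\<close> by simp
    finally show ?thesis .
  qed
  moreover have "(L has_field_derivative 1 / (x - a)) (at x)" if x: "x \<in> ball c e" for x
  proof -
    obtain d where d: "(l has_field_derivative d) (at x)"
      using l(1) x by (meson holomorphic_on_open open_ball)
    then have "((\<lambda>x. exp (l x)) has_field_derivative exp (l x) * d) (at x)"
      by (rule DERIV_chain2[OF DERIV_exp])
    moreover have "((\<lambda>x. exp (l x)) has_field_derivative 1) (at x)"
      by (rule has_field_derivative_transform_within_open[of "\<lambda>x. x - a" 1 x "ball c e"])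
        (use l(2) x in \<open>auto intro!: derivative_eq_intros\<close>)
    ultimately have "exp (l x) * d = 1" by (rule DERIV_unique)
    then have "d = 1 / (x - a)"
      using l(2)[OF x] by (metis exp_not_eq_zero nonzero_mult_div_cancel_left)
    with d show ?thesis
      unfolding L_def by (auto intro!: derivative_eq_intros)
  qed
  ultimately show thesis
    by (intro that[of L]) (simp_all add: L_def)
qed

locale branched_primitive =
  fixes \<beta>0 \<beta>1 :: complex
begin

abbreviation integrand :: "branch_value \<Rightarrow> complex" where
  "integrand v \<equiv> exp (\<beta>0 * log0 v + \<beta>1 * log1 v)"

definition branch :: "complex set \<Rightarrow> (complex \<Rightarrow> branch_value) \<Rightarrow> bool" where
  "branch U \<Psi> \<longleftrightarrow> open U \<and> (\<forall>x\<in>U. \<Psi> x \<in> branch_fibre x \<and>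
     ((\<lambda>x. log0 (\<Psi> x)) has_field_derivative 1 / x) (at x) \<and>
     ((\<lambda>x. log1 (\<Psi> x)) has_field_derivative 1 / (x - 1)) (at x) \<and>
     ((\<lambda>x. prim (\<Psi> x)) has_field_derivative integrand (\<Psi> x)) (at x))"

lemma branchD:
  assumes "branch U \<Psi>"
  shows "open U" "x \<in> U \<Longrightarrow> exp (log0 (\<Psi> x)) = x" "x \<in> U \<Longrightarrow> exp (log1 (\<Psi> x)) = x - 1"
    "x \<in> U \<Longrightarrow> ((\<lambda>x. log0 (\<Psi> x)) has_field_derivative 1 / x) (at x)"
    "x \<in> U \<Longrightarrow> ((\<lambda>x. log1 (\<Psi> x)) has_field_derivative 1 / (x - 1)) (at x)"
    "x \<in> U \<Longrightarrow> ((\<lambda>x. prim (\<Psi> x)) has_field_derivative integrand (\<Psi> x)) (at x)"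
  using assms unfolding branch_def branch_fibre_def by auto

lemma branch_unique:
  assumes \<Psi>: "branch U \<Psi>" "branch V \<Psi>'" and W: "convex W" "W \<subseteq> U \<inter> V"
    and x: "x \<in> W" "\<Psi> x = \<Psi>' x" and y: "y \<in> W"
  shows "\<Psi> y = \<Psi>' y"
proof -
  have WU: "z \<in> U" "z \<in> V" if "z \<in> W" for z using W(2) that by auto
  have log0: "log0 (\<Psi> z) = log0 (\<Psi>' z)" if "z \<in> W" for z
    by (rule has_field_derivative_eq_on_convex[OF W(1) branchD(4)[OF \<Psi>(1) WU(1)]
      branchD(4)[OF \<Psi>(2) WU(2)] x(1) that])
      (simp_all add: x)
  have log1: "log1 (\<Psi> z) = log1 (\<Psi>' z)" if "z \<in> W" for z
    by (rule has_field_derivative_eq_on_convex[OF W(1) branchD(5)[OF \<Psi>(1) WU(1)]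
      branchD(5)[OF \<Psi>(2) WU(2)] x(1) that])
      (simp_all add: x)
  have prim: "((\<lambda>x. prim (\<Psi>' x)) has_field_derivative integrand (\<Psi> z)) (at z)"
    if "z \<in> W" for z
    using branchD(6)[OF \<Psi>(2) WU(2)[OF that]] log0[OF that] log1[OF that] by simp
  have "prim (\<Psi> y) = prim (\<Psi>' y)"
    by (rule has_field_derivative_eq_on_convex[OF W(1) branchD(6)[OF \<Psi>(1) WU(1)] prim x(1) y])
      (simp_all add: x)
  then show ?thesis
    using log0[OF y] log1[OF y] by (simp add: prod_eq_iff)
qed

lemma branch_exists:
  assumes v: "v \<in> branch_fibre c" and e: "e > 0" "ball c e \<subseteq> - {0, 1}"
  shows "\<exists>\<Psi>. branch (ball c e) \<Psi> \<and> \<Psi> c = v"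
proof -
  have out: "0 \<notin> ball c e" "1 \<notin> ball c e" using e(2) by blast+
  obtain L0 where L0: "L0 c = log0 v"
    "\<forall>x\<in>ball c e. exp (L0 x) = x - 0 \<and> (L0 has_field_derivative 1 / (x - 0)) (at x)"
    using log_on_ball[OF out(1) e(1), of "log0 v"] v unfolding branch_fibre_def by auto
  obtain L1 where L1: "L1 c = log1 v"
    "\<forall>x\<in>ball c e. exp (L1 x) = x - 1 \<and> (L1 has_field_derivative 1 / (x - 1)) (at x)"
    using log_on_ball[OF out(2) e(1), of "log1 v"] v unfolding branch_fibre_def by auto
  have "L0 holomorphic_on ball c e"
    by (rule has_field_derivative_imp_holomorphic_on[where f' = "\<lambda>x. 1 / (x - 0)"])
      (use L0(2) in simp)
  moreover have "L1 holomorphic_on ball c e"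
    by (rule has_field_derivative_imp_holomorphic_on[where f' = "\<lambda>x. 1 / (x - 1)"])
      (use L1(2) in simp)
  ultimately have "(\<lambda>x. exp (\<beta>0 * L0 x + \<beta>1 * L1 x)) holomorphic_on ball c e"
    by (intro holomorphic_intros)
  then obtain \<Phi> where "\<Phi> c = prim v"
    "\<forall>x\<in>ball c e. (\<Phi> has_field_derivative exp (\<beta>0 * L0 x + \<beta>1 * L1 x)) (at x)"
    by (rule primitive_on_ball)
  then show ?thesis
    using L0 L1 unfolding branch_def branch_fibre_def
    by (intro exI[of _ "\<lambda>x. (L0 x, L1 x, \<Phi> x)"]) (auto simp: prod_eq_iff)
qed

sublocale local_sections "- {0, 1}" branch branch_fibre
proof
  show "open (- {0, 1 :: complex})" by (simp add: open_Compl)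
  show "open U" if "branch U \<Psi>" for U \<Psi>
    using that by (rule branchD)
  show "\<Psi> x \<in> branch_fibre x" if "branch U \<Psi>" "x \<in> U" for U \<Psi> x
    using that by (simp add: branch_def)
  show "\<Psi> y = \<Psi>' y"
    if "branch U \<Psi>" "branch V \<Psi>'" "convex W" "W \<subseteq> U \<inter> V" "x \<in> W" "\<Psi> x = \<Psi>' x" "y \<in> W"
    for U V W \<Psi> \<Psi>' x y
    using that by (rule branch_unique)
  show "\<exists>\<Psi>. branch (ball c e) \<Psi> \<and> \<Psi> c = v"
    if "v \<in> branch_fibre c" "e > 0" "ball c e \<subseteq> - {0, 1}" for v c e
    using that by (rule branch_exists)
qed

lemma branch_holomorphic:
  assumes "branch U \<Psi>"
  shows "(\<lambda>x. log0 (\<Psi> x)) holomorphic_on U" "(\<lambda>x. log1 (\<Psi> x)) holomorphic_on U"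
    "(\<lambda>x. prim (\<Psi> x)) holomorphic_on U"
  using has_field_derivative_imp_holomorphic_on[OF branchD(4)[OF assms]]
    has_field_derivative_imp_holomorphic_on[OF branchD(5)[OF assms]]
    has_field_derivative_imp_holomorphic_on[OF branchD(6)[OF assms]] by simp_all

lemma lift_imp_path:
  assumes "lift g m"
  shows "path g" "path_image g \<subseteq> - {0, 1}"
proof -
  show "path g" using lift_on_continuous[OF assms] by (simp add: path_def)
  show "path_image g \<subseteq> - {0, 1}"
    using branch_fibre_imp_base[OF lift_on_fibre[OF assms]] unfolding path_image_def
    by (rule image_subsetI)
qed

lemma lift_log_increment:
  assumes m: "lift g m"
  shows "log0 (m 1) - log0 (m 0) = two_pi_i * winding_number g 0"
    and "log1 (m 1) - log1 (m 0) = two_pi_i * winding_number g 1"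
proof -
  have fib: "exp (log0 (m t)) = g t" "exp (log1 (m t)) = g t - 1" if "0 \<le> t" "t \<le> 1" for t
    using lift_on_fibre[OF m, of t] that by (simp_all add: branch_fibre_def)
  have path: "path (\<lambda>t. log0 (m t))" "path (\<lambda>t. log1 (m t))"
    unfolding path_def
    by (intro lift_on_compose_continuous[OF m] holomorphic_on_imp_continuous_on branch_holomorphic;
      assumption)+
  have "winding_number g 0 = winding_number (exp \<circ> (\<lambda>t. log0 (m t))) 0"
    by (rule winding_number_cong) (simp add: fib)
  then show "log0 (m 1) - log0 (m 0) = two_pi_i * winding_number g 0"
    using winding_number_compose_exp[OF path(1)] by (simp add: pathstart_def pathfinish_def)
  have "winding_number g 1 = winding_number (\<lambda>t. g t - 1) 0"
    by (rule winding_number_offset)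
  also have "\<dots> = winding_number (exp \<circ> (\<lambda>t. log1 (m t))) 0"
    by (rule winding_number_cong) (simp add: fib)
  finally show "log1 (m 1) - log1 (m 0) = two_pi_i * winding_number g 1"
    using winding_number_compose_exp[OF path(2)] by (simp add: pathstart_def pathfinish_def)
qed

subsection \<open>Deck transformations\<close>

text \<open>A loop adds periods to the logarithms; hence it multiplies the integrand by a constant and changes
  its primitive by an affine map.\<close>

definition deck :: "branch_value \<Rightarrow> branch_value \<Rightarrow> branch_value" where
  "deck d v = (log0 d + log0 v, log1 d + log1 v, integrand d * prim v + prim d)"

definition periods :: "branch_value set" where
  "periods = {d. exp (log0 d) = 1 \<and> exp (log1 d) = 1}"

lemma deck_assoc: "deck (deck d d') v = deck d (deck d' v)"
  by (simp add: deck_def algebra_simps exp_add)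

lemma deck_inject: "deck d v = deck d' v \<longleftrightarrow> d = d'"
  by (auto simp: deck_def prod_eq_iff)

lemma deck_transitive:
  assumes "v \<in> branch_fibre x" "v' \<in> branch_fibre x"
  obtains d where "d \<in> periods" "v' = deck d v"
proof (rule that)
  let ?u0 = "log0 v' - log0 v" and ?u1 = "log1 v' - log1 v"
  let ?d = "(?u0, ?u1, prim v' - exp (\<beta>0 * ?u0 + \<beta>1 * ?u1) * prim v)"
  show "?d \<in> periods"
    using assms branch_fibre_imp_base[OF assms(1)]
    by (simp add: periods_def branch_fibre_def exp_diff)
  show "v' = deck ?d v" by (simp add: deck_def)
qed

lemma branch_deck:
  assumes "branch U \<Psi>" "d \<in> periods"
  shows "branch U (\<lambda>x. deck d (\<Psi> x))"
  unfolding branch_def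
proof (intro conjI ballI branchD(1)[OF assms(1)])
  fix x assume x: "x \<in> U"
  note b = branchD(2-6)[OF assms(1) x]
  show "deck d (\<Psi> x) \<in> branch_fibre x"
    using assms(2) b(1,2) by (simp add: branch_fibre_def deck_def periods_def exp_add)
  show "((\<lambda>x. log0 (deck d (\<Psi> x))) has_field_derivative 1 / x) (at x)"
    "((\<lambda>x. log1 (deck d (\<Psi> x))) has_field_derivative 1 / (x - 1)) (at x)"
    using b(3,4) by (auto simp: deck_def intro!: derivative_eq_intros)
  show "((\<lambda>x. prim (deck d (\<Psi> x))) has_field_derivative
      integrand (deck d (\<Psi> x))) (at x)"
    using b(5) by (auto simp: deck_def ring_distribs exp_add intro!: derivative_eq_intros)
qed

lemma lift_deck: "lift g m \<Longrightarrow> d \<in> periods \<Longrightarrow> lift g (\<lambda>t. deck d (m t))"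
  using lift_on_map branch_deck by blast

definition has_deck :: "(real \<Rightarrow> complex) \<Rightarrow> branch_value \<Rightarrow> bool" where
  "has_deck g d \<longleftrightarrow> (\<exists>m. lift g m \<and> m 0 = base_value (pathstart g) \<and>
     m 1 = deck d (base_value (pathstart g)))"

lemma has_deck_log:
  assumes "has_deck g d"
  shows "log0 d = two_pi_i * winding_number g 0" "log1 d = two_pi_i * winding_number g 1"
proof -
  obtain m where "lift g m" "m 0 = base_value (pathstart g)"
    "m 1 = deck d (base_value (pathstart g))"
    using assms unfolding has_deck_def by blast
  then show "log0 d = two_pi_i * winding_number g 0" "log1 d = two_pi_i * winding_number g 1"
    using lift_log_increment[of g m] by (simp_all add: deck_def)
qed

lemma has_deck_periods:
  assumes "has_deck g d" "pathfinish g = pathstart g"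
  shows "d \<in> periods"
proof -
  obtain m where m: "lift g m" "m 0 = base_value (pathstart g)"
    "m 1 = deck d (base_value (pathstart g))"
    using assms(1) unfolding has_deck_def by blast
  have fibre: "m 0 \<in> branch_fibre (pathstart g)" "m 1 \<in> branch_fibre (pathstart g)"
    using lift_on_fibre[OF m(1), of 0] lift_on_fibre[OF m(1), of 1] assms(2)
    by (simp_all add: pathstart_def pathfinish_def)
  show ?thesis
    using fibre branch_fibre_imp_base[OF fibre(1)] unfolding m
    by (auto simp: periods_def branch_fibre_def deck_def exp_add)
qed

lemma has_deck_exists:
  assumes "g \<in> loops (- {0, 1}) x"
  obtains d where "has_deck g d"
proof -
  have g: "path g" "path_image g \<subseteq> - {0, 1}" "pathstart g = x" "pathfinish g = x"
    using assms by (simp_all add: loops_def)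
  then have "x \<in> - {0, 1}" using pathstart_in_path_image by blast
  then have base: "base_value x \<in> branch_fibre x" by (rule base_value_in_fibre)
  then obtain m where m: "lift g m" "m 0 = base_value x"
    using lift_exists[OF g(1,2)] g(3) by metis
  have "m 1 \<in> branch_fibre x" using lift_on_fibre[OF m(1), of 1] g(4) by (simp add: pathfinish_def)
  then obtain d where "m 1 = deck d (base_value x)"
    using deck_transitive[OF base] by blast
  then show thesis using that m g(3) unfolding has_deck_def by blast
qed

lemma has_deck_unique:
  assumes "has_deck g d" "has_deck g d'"
  shows "d = d'"
proof -
  obtain m m' where m: "lift g m" "m 0 = base_value (pathstart g)"
    "m 1 = deck d (base_value (pathstart g))"
    and m': "lift g m'" "m' 0 = base_value (pathstart g)"
      "m' 1 = deck d' (base_value (pathstart g))"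
    using assms unfolding has_deck_def by blast
  have "m 1 = m' 1"
    by (rule lift_on_unique[OF m(1) m'(1), where r = 0]) (simp_all add: m m')
  then show ?thesis using m(3) m'(3) by (simp add: deck_inject)
qed

lemma has_deck_homotopic:
  assumes "homotopic_paths (- {0, 1}) g h" "has_deck g d"
  shows "has_deck h d"
proof -
  obtain m where m: "lift g m" "m 0 = base_value (pathstart g)"
    "m 1 = deck d (base_value (pathstart g))"
    using assms(2) unfolding has_deck_def by blast
  obtain m' where "lift h m'" "m' 0 = m 0" "m' 1 = m 1"
    by (rule lift_homotopic[OF assms(1) m(1)])
  then show ?thesis
    using m homotopic_paths_imp_pathstart[OF assms(1)] unfolding has_deck_def by auto
qed

lemma has_deck_join:
  assumes d: "has_deck g d" "has_deck h d'"
    and loops: "pathfinish g = pathstart g" "pathstart h = pathstart g"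
  shows "has_deck (g +++ h) (deck d d')"
proof -
  let ?b = "base_value (pathstart g)"
  obtain m m' where m: "lift g m" "m 0 = ?b" "m 1 = deck d ?b"
    and m': "lift h m'" "m' 0 = ?b" "m' 1 = deck d' ?b"
    using d loops(2) unfolding has_deck_def by auto
  have "lift (g +++ h) (m +++ (\<lambda>t. deck d (m' t)))"
    using lift_deck[OF m'(1) has_deck_periods[OF d(1) loops(1)]] m m' loops
    by (intro lift_join) (auto simp: pathstart_def pathfinish_def)
  moreover have "(m +++ (\<lambda>t. deck d (m' t))) 0 = ?b"
    "(m +++ (\<lambda>t. deck d (m' t))) 1 = deck (deck d d') ?b"
    using m m' by (simp_all add: joinpaths_def deck_assoc)
  ultimately show ?thesis unfolding has_deck_def by auto
qed

lemma has_deck_logarithm: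
  assumes \<beta>: "\<beta>0 = - 1" "\<beta>1 = 0" and "has_deck g d"
  shows "prim d = log0 d"
proof -
  define b where "b = base_value (pathstart g)"
  obtain m where m: "lift g m" "m 0 = b" "m 1 = deck d b"
    using assms(3) unfolding has_deck_def b_def by blast
  define \<theta> where "\<theta> v = (log0 v, log1 v, log0 v - log0 b)" for v :: branch_value
  have "branch U (\<lambda>x. \<theta> (\<Psi> x))" if "branch U \<Psi>" for U \<Psi>
    using that \<beta> unfolding branch_def branch_fibre_def
    by (auto simp: \<theta>_def exp_minus inverse_eq_divide intro!: derivative_eq_intros)
  then have "lift g (\<lambda>t. \<theta> (m t))"
    by (rule lift_on_map[OF m(1)])
  then have "\<theta> (m 1) = m 1"
    by (rule lift_on_unique[OF _ m(1), where r = 0]) (auto simp: m(2) \<theta>_def b_def base_value_def)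
  then show ?thesis
    unfolding m(3) by (auto simp: \<theta>_def deck_def prod_eq_iff b_def base_value_def)
qed

end

section \<open>The monodromy of the primitive is not diagonalizable\<close>

context branched_primitive
begin

text \<open>If \<open>prim - s\<close> is only multiplied by constants under continuation, then dividing it by
  \<open>t\<^bsup>\<beta>0+1\<^esup> (t - 1)\<^bsup>\<beta>1+1\<^esup>\<close> gives a single-valued function.\<close>

definition reduced_prim :: "complex \<Rightarrow> branch_value \<Rightarrow> complex" where
  "reduced_prim s v = (prim v - s) * exp (- ((\<beta>0 + 1) * log0 v + (\<beta>1 + 1) * log1 v))"

lemma reduced_prim_deck:
  assumes "d \<in> periods" "prim d = s * (1 - integrand d)"
  shows "reduced_prim s (deck d v) = reduced_prim s v"
proof -
  define B where "B = integrand d"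
  have "prim (deck d v) - s = B * (prim v - s)"
    unfolding deck_def snd_conv assms(2) B_def[symmetric] by (simp add: algebra_simps)
  moreover have "exp (- ((\<beta>0 + 1) * log0 (deck d v) + (\<beta>1 + 1) * log1 (deck d v)))
      = exp (- ((\<beta>0 + 1) * log0 v + (\<beta>1 + 1) * log1 v)) / B"
    using assms(1)
    by (simp add: B_def deck_def periods_def algebra_simps exp_add exp_diff exp_minus field_simps)
  moreover have "B \<noteq> 0" by (simp add: B_def)
  ultimately show ?thesis by (simp add: reduced_prim_def)
qed

lemma reduced_prim_ode:
  assumes b: "branch U \<Psi>" and x: "x \<in> U"
  obtains D where "((\<lambda>x. reduced_prim s (\<Psi> x)) has_field_derivative D) (at x)"
    "x * (x - 1) * D + ((\<beta>0 + 1) * (x - 1) + (\<beta>1 + 1) * x) * reduced_prim s (\<Psi> x) = 1"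
proof -
  note e = branchD(2,3)[OF b x]
  have x01: "x \<noteq> 0" "x - 1 \<noteq> 0" using e by (metis exp_not_eq_zero)+
  define w where "w x = exp (- ((\<beta>0 + 1) * log0 (\<Psi> x) + (\<beta>1 + 1) * log1 (\<Psi> x)))" for x
  define q where "q = (\<beta>0 + 1) / x + (\<beta>1 + 1) / (x - 1)"
  have "integrand (\<Psi> x) * w x = exp (- log0 (\<Psi> x) - log1 (\<Psi> x))"
    unfolding w_def exp_add[symmetric] by (simp add: algebra_simps)
  also have "\<dots> = 1 / (exp (log0 (\<Psi> x)) * exp (log1 (\<Psi> x)))"
    by (simp add: exp_diff exp_minus divide_inverse)
  also have "\<dots> = 1 / (x * (x - 1))"
    by (simp only: e)
  finally have product: "integrand (\<Psi> x) * w x = 1 / (x * (x - 1))" .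
  have "(w has_field_derivative - q * w x) (at x)"
    unfolding w_def by (rule derivative_eq_intros branchD(4,5)[OF b x] refl)+
      (simp add: q_def algebra_simps)
  from DERIV_mult'[OF DERIV_diff[OF branchD(6)[OF b x] DERIV_const[of s]] this]
  have "((\<lambda>x. reduced_prim s (\<Psi> x)) has_field_derivative
      1 / (x * (x - 1)) - q * reduced_prim s (\<Psi> x)) (at x)"
    unfolding reduced_prim_def w_def[symmetric] by (simp add: product mult.left_commute)
  moreover have "x * (x - 1) * q = (\<beta>0 + 1) * (x - 1) + (\<beta>1 + 1) * x"
    using x01 by (simp add: q_def field_simps)
  then have "x * (x - 1) * (1 / (x * (x - 1)) - q * reduced_prim s (\<Psi> x))
      + ((\<beta>0 + 1) * (x - 1) + (\<beta>1 + 1) * x) * reduced_prim s (\<Psi> x) = 1"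
    using x01 by (simp add: right_diff_distrib flip: mult.assoc)
  ultimately show thesis by (rule that)
qed

definition reachable :: "complex \<Rightarrow> complex \<Rightarrow> branch_value \<Rightarrow> bool" where
  "reachable x0 x v \<longleftrightarrow> (\<exists>q m. lift q m \<and> pathstart q = x0 \<and> pathfinish q = x \<and>
     m 0 = base_value x0 \<and> m 1 = v)"

lemma reachable_exists:
  assumes "x0 \<in> - {0, 1}" "x \<in> - {0, 1}"
  obtains v where "reachable x0 x v" "v \<in> branch_fibre x"
proof -
  have "path_connected (- {0, 1 :: complex})"
    by (rule path_connected_complement_countable) auto
  then obtain q where q: "path q" "path_image q \<subseteq> - {0, 1}" "pathstart q = x0" "pathfinish q = x"
    using assms unfolding path_connected_def by blast
  have "base_value x0 \<in> branch_fibre (pathstart q)"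
    unfolding q(3) using assms(1) by (rule base_value_in_fibre)
  then obtain m where m: "lift q m" "m 0 = base_value x0"
    by (rule lift_exists[OF q(1,2)])
  then have "reachable x0 x (m 1)" using q unfolding reachable_def by blast
  moreover have "m 1 \<in> branch_fibre x"
    using lift_on_fibre[OF m(1), of 1] q(4) by (simp add: pathfinish_def)
  ultimately show thesis by (rule that)
qed

lemma reachable_branch:
  assumes v: "reachable x0 c (\<Psi> c)" and b: "branch (ball c e) \<Psi>" and x: "x \<in> ball c e"
  shows "reachable x0 x (\<Psi> x)"
proof -
  obtain q m where q: "lift q m" "pathstart q = x0" "pathfinish q = c" "m 0 = base_value x0"
    "m 1 = \<Psi> c"
    using v unfolding reachable_def by blast
  have "c \<in> ball c e" using x le_less_trans[OF zero_le_dist] by fastforce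
  then have "closed_segment c x \<subseteq> ball c e"
    using x by (rule closed_segment_subset[OF _ _ convex_ball])
  then have "lift (linepath c x) (\<lambda>t. \<Psi> (linepath c x t))"
    using path_image_linepath[of c x] by (intro lift_on_section[OF b]) (auto simp: path_image_def)
  then have "lift (q +++ linepath c x) (m +++ (\<lambda>t. \<Psi> (linepath c x t)))"
    using q by (intro lift_join) (auto simp: pathstart_def pathfinish_def linepath_def)
  moreover have "(m +++ (\<lambda>t. \<Psi> (linepath c x t))) 0 = base_value x0"
    "(m +++ (\<lambda>t. \<Psi> (linepath c x t))) 1 = \<Psi> x"
    using q(4) by (simp_all add: joinpaths_def linepath_def)
  ultimately show ?thesis
    using q(2) unfolding reachable_def
    by (intro exI[of _ "q +++ linepath c x"] exI[of _ "m +++ (\<lambda>t. \<Psi> (linepath c x t))"]) simp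
qed

lemma reachable_deck:
  assumes "reachable x0 x v" "reachable x0 x v'"
  obtains g d where "g \<in> loops (- {0, 1}) x0" "has_deck g d" "v = deck d v'"
proof -
  obtain q m where q: "lift q m" "pathstart q = x0" "pathfinish q = x" "m 0 = base_value x0"
    "m 1 = v"
    using assms(1) unfolding reachable_def by blast
  obtain q' m' where q': "lift q' m'" "pathstart q' = x0" "pathfinish q' = x" "m' 0 = base_value x0"
    "m' 1 = v'"
    using assms(2) unfolding reachable_def by blast
  have "v \<in> branch_fibre x" "v' \<in> branch_fibre x"
    using lift_on_fibre[OF q(1), of 1] lift_on_fibre[OF q'(1), of 1] q q'
    by (simp_all add: pathfinish_def)
  then obtain d where d: "d \<in> periods" "v = deck d v'"
    by (metis deck_transitive)
  let ?m = "m +++ (\<lambda>t. deck d (reversepath m' t))"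
  have "lift (q +++ reversepath q') ?m"
    using q q' d lift_deck[OF lift_reversepath[OF q'(1)] d(1)]
    by (intro lift_join[OF q(1)]) (auto simp: pathstart_def pathfinish_def reversepath_def)
  moreover have "?m 0 = base_value x0" "?m 1 = deck d (base_value x0)"
    using q(4) q'(4) by (simp_all add: joinpaths_def reversepath_def)
  ultimately have "has_deck (q +++ reversepath q') d"
    using q(2) unfolding has_deck_def by auto
  moreover have "q +++ reversepath q' \<in> loops (- {0, 1}) x0"
    using lift_imp_path[OF q(1)] lift_imp_path[OF q'(1)] q(2,3) q'(2,3)
    by (auto simp: loops_def subset_path_image_join)
  ultimately show thesis using that d(2) by blast
qed

lemma single_valued_reduced_prim:
  assumes x0: "x0 \<in> - {0, 1}"
    and decks: "\<And>g d. g \<in> loops (- {0, 1}) x0 \<Longrightarrow> has_deck g d \<Longrightarrow>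
      prim d = s * (1 - integrand d)"
  obtains f f' where "\<forall>x\<in>- {0, 1}. (f has_field_derivative f' x) (at x) \<and>
    x * (x - 1) * f' x + ((\<beta>0 + 1) * (x - 1) + (\<beta>1 + 1) * x) * f x = 1"
proof -
  define f where "f x = reduced_prim s (SOME v. reachable x0 x v)" for x
  have f: "f x = reduced_prim s v" if v: "reachable x0 x v" for x v
  proof -
    have "reachable x0 x (SOME v. reachable x0 x v)" using v by (rule someI)
    then obtain g d where "g \<in> loops (- {0, 1}) x0" "has_deck g d"
      "(SOME v. reachable x0 x v) = deck d v"
      using reachable_deck v by metis
    then show ?thesis
      using reduced_prim_deck[OF has_deck_periods decks] by (simp add: f_def loops_def)
  qed
  have "\<exists>D. (f has_field_derivative D) (at c) \<and>
      c * (c - 1) * D + ((\<beta>0 + 1) * (c - 1) + (\<beta>1 + 1) * c) * f c = 1" if c: "c \<in> - {0, 1}" for c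
  proof -
    obtain v where v: "reachable x0 c v" "v \<in> branch_fibre c"
      using reachable_exists[OF x0 c] .
    obtain e where e: "e > 0" "ball c e \<subseteq> - {0, 1}"
      using openE[OF open_base c] .
    then obtain \<Psi> where \<Psi>: "branch (ball c e) \<Psi>" "\<Psi> c = v"
      using section_exists v(2) by blast
    have c: "c \<in> ball c e" using e(1) by simp
    have eq: "f x = reduced_prim s (\<Psi> x)" if "x \<in> ball c e" for x
      using reachable_branch[OF _ \<Psi>(1) that] v(1) \<Psi>(2) by (intro f) simp
    obtain D where D: "((\<lambda>x. reduced_prim s (\<Psi> x)) has_field_derivative D) (at c)"
      "c * (c - 1) * D + ((\<beta>0 + 1) * (c - 1) + (\<beta>1 + 1) * c) * reduced_prim s (\<Psi> c) = 1"
      using reduced_prim_ode[OF \<Psi>(1) c] .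
    have "(f has_field_derivative D) (at c)"
      by (rule has_field_derivative_transform_within_open[OF D(1) open_ball c]) (simp add: eq)
    then show ?thesis using D(2) eq[OF c] by auto
  qed
  then obtain f' where "\<forall>c\<in>- {0, 1}. (f has_field_derivative f' c) (at c) \<and>
      c * (c - 1) * f' c + ((\<beta>0 + 1) * (c - 1) + (\<beta>1 + 1) * c) * f c = 1"
    by metis
  then show thesis by (rule that)
qed

theorem deck_not_coboundary:
  assumes "x0 \<in> - {0, 1}"
    and "exp (two_pi_i * \<beta>0) \<noteq> 1" "exp (two_pi_i * \<beta>1) \<noteq> 1" "Re (\<beta>0 + \<beta>1) > - 2"
  obtains g d where "g \<in> loops (- {0, 1}) x0" "has_deck g d"
    "prim d \<noteq> s * (1 - integrand d)"
proof -
  have shift: "exp (two_pi_i * (b + 1)) = exp (two_pi_i * b)" for b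
    by (simp add: distrib_left exp_add)
  have False
    if decks: "\<And>g d. g \<in> loops (- {0, 1}) x0 \<Longrightarrow> has_deck g d \<Longrightarrow>
      prim d = s * (1 - integrand d)"
  proof -
    obtain f f' where "\<forall>x\<in>- {0, 1}. (f has_field_derivative f' x) (at x) \<and>
        x * (x - 1) * f' x + ((\<beta>0 + 1) * (x - 1) + (\<beta>1 + 1) * x) * f x = 1"
      by (rule single_valued_reduced_prim[OF assms(1) decks])
    then show False
      using no_single_valued_hypergeometric_primitive[of f f' "\<beta>0 + 1" "\<beta>1 + 1"] assms(2-4)
      by (simp add: shift)
  qed
  then show thesis using that by blast
qed

end

section \<open>Coordinates on the Riemann sphere\<close>

text \<open>\<open>[hnum x : hden x]\<close> are homogeneous coordinates of \<open>x\<close>, and \<open>lin_form a\<close> is the linear form in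
  them that vanishes at \<open>a\<close>.\<close>

fun hnum :: "cp1 \<Rightarrow> complex" where
  "hnum (CFin z) = z"
| "hnum CInf = 1"

fun hden :: "cp1 \<Rightarrow> complex" where
  "hden (CFin z) = 1"
| "hden CInf = 0"

definition lin_form :: "cp1 \<Rightarrow> cp1 \<Rightarrow> complex" where
  "lin_form a x = hden a * hnum x - hnum a * hden x"

definition of_homogeneous :: "complex \<Rightarrow> complex \<Rightarrow> cp1" where
  "of_homogeneous x y = (if y = 0 then CInf else CFin (x / y))"

lemma lin_form_eq_0_iff: "lin_form a x = 0 \<longleftrightarrow> x = a"
  by (cases a; cases x) (auto simp: lin_form_def)

lemma lin_form_swap: "lin_form x y = - lin_form y x"
  by (simp add: lin_form_def)

lemma lin_form_CFin: "lin_form a (CFin z) = hden a * z - hnum a"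
  by (simp add: lin_form_def)

lemma lin_form_chart_inf:
  "lin_form a (chart_inf w) = (hden a - hnum a * w) / (if w = 0 then 1 else w)"
  by (auto simp: lin_form_def chart_inf_def field_simps)

lemma lin_form_of_homogeneous:
  "x \<noteq> 0 \<or> y \<noteq> 0 \<Longrightarrow>
    lin_form a (of_homogeneous x y) = (hden a * x - hnum a * y) / (if y = 0 then x else y)"
  by (auto simp: lin_form_def of_homogeneous_def field_simps)

lemma inj_chart_inf: "inj chart_inf"
  by (auto simp: inj_def chart_inf_def split: if_splits)

lemma open_Compl_finite_cp1:
  assumes "finite D"
  shows "open (- D :: cp1 set)"
proof -
  have "finite (CFin -` D)" "finite (chart_inf -` D)"
    using assms inj_chart_inf by (auto intro!: finite_vimageI simp: inj_def)
  then show ?thesis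
    by (simp add: open_cp1_def vimage_Compl open_Compl finite_imp_closed)
qed

lemma continuous_on_of_homogeneous:
  assumes "open T" "continuous_on T f" "continuous_on T g" and nz: "\<And>t. t \<in> T \<Longrightarrow> f t \<noteq> 0 \<or> g t \<noteq> 0"
  shows "continuous_on T (\<lambda>t. of_homogeneous (f t) (g t))"
  unfolding continuous_on_open_vimage[OF assms(1)]
proof (intro allI impI)
  fix U :: "cp1 set" assume U: "open U"
  let ?A = "T \<inter> g -` (- {0})" and ?B = "T \<inter> f -` (- {0})"
  have AB: "open ?A" "open ?B"
    using assms by (auto intro!: continuous_open_preimage)
  have "continuous_on ?A (\<lambda>t. f t / g t)" "continuous_on ?B (\<lambda>t. g t / f t)"
    using assms(2,3) by (auto intro!: continuous_intros intro: continuous_on_subset)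
  then have "open (?A \<inter> (\<lambda>t. f t / g t) -` (CFin -` U))"
    "open (?B \<inter> (\<lambda>t. g t / f t) -` (chart_inf -` U))"
    using AB U by (auto intro!: continuous_open_preimage simp: open_cp1_def)
  moreover have "(\<lambda>t. of_homogeneous (f t) (g t)) -` U \<inter> T =
      (?A \<inter> (\<lambda>t. f t / g t) -` (CFin -` U)) \<union> (?B \<inter> (\<lambda>t. g t / f t) -` (chart_inf -` U))"
    using nz by (auto simp: of_homogeneous_def chart_inf_def split: if_splits)
  ultimately show "open ((\<lambda>t. of_homogeneous (f t) (g t)) -` U \<inter> T)"
    by (simp add: open_Un)
qed

lemma continuous_on_CFin: "continuous_on UNIV CFin"
proof -
  have eq: "CFin = (\<lambda>z. of_homogeneous z 1)" by (simp add: fun_eq_iff of_homogeneous_def)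
  show ?thesis
    by (subst eq, intro continuous_on_of_homogeneous) (auto intro: continuous_intros)
qed

lemma continuous_on_chart_inf: "continuous_on UNIV chart_inf"
proof -
  have eq: "chart_inf = (\<lambda>w. of_homogeneous 1 w)"
    by (auto simp: fun_eq_iff chart_inf_def of_homogeneous_def inverse_eq_divide)
  show ?thesis
    by (subst eq, intro continuous_on_of_homogeneous) (auto intro: continuous_intros)
qed

lemma cp1_holomorphic_on_imp_continuous_on:
  assumes "open U" "cp1_holomorphic_on f U"
  shows "continuous_on U f"
  unfolding continuous_on_open_vimage[OF assms(1)]
proof (intro allI impI)
  fix V :: "complex set" assume V: "open V"
  have "open (CFin -` U)" "open (chart_inf -` U)" using assms(1) by (auto simp: open_cp1_def)
  moreover have "continuous_on (CFin -` U) (\<lambda>z. f (CFin z))"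
    "continuous_on (chart_inf -` U) (\<lambda>z. f (chart_inf z))"
    using assms(2) by (auto simp: cp1_holomorphic_on_def holomorphic_on_imp_continuous_on)
  ultimately have "open (CFin -` U \<inter> (\<lambda>z. f (CFin z)) -` V)"
    "open (chart_inf -` U \<inter> (\<lambda>z. f (chart_inf z)) -` V)"
    using V by (auto intro!: continuous_open_preimage)
  moreover have "CFin -` (f -` V \<inter> U) = CFin -` U \<inter> (\<lambda>z. f (CFin z)) -` V"
    "chart_inf -` (f -` V \<inter> U) = chart_inf -` U \<inter> (\<lambda>z. f (chart_inf z)) -` V" by auto
  ultimately show "open (f -` V \<inter> U)" by (simp add: open_cp1_def)
qed

lemma cp1_holomorphic_on_subset: "cp1_holomorphic_on f U \<Longrightarrow> V \<subseteq> U \<Longrightarrow> cp1_holomorphic_on f V"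
  unfolding cp1_holomorphic_on_def by (meson holomorphic_on_subset vimage_mono)

lemma cp1_holomorphic_on_compose:
  assumes "cp1_holomorphic_on f U" "h holomorphic_on V" "f ` U \<subseteq> V"
  shows "cp1_holomorphic_on (\<lambda>x. h (f x)) U"
proof -
  have "(\<lambda>z. f (CFin z)) ` (CFin -` U) \<subseteq> V" "(\<lambda>z. f (chart_inf z)) ` (chart_inf -` U) \<subseteq> V"
    using assms(3) by auto
  then show ?thesis
    using assms(1,2) holomorphic_on_compose_gen[of _ _ h V]
    unfolding cp1_holomorphic_on_def o_def by blast
qed

lemma open_CFin_image: "open V \<Longrightarrow> open (CFin ` V)"
proof -
  assume V: "open V"
  then have "open ((- {0}) \<inter> inverse -` V)"
    by (intro continuous_open_preimage continuous_intros) auto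
  moreover have "chart_inf -` (CFin ` V) = (- {0}) \<inter> inverse -` V"
    by (auto simp: chart_inf_def split: if_splits)
  moreover have "CFin -` (CFin ` V) = V" by auto
  ultimately show ?thesis using V by (simp add: open_cp1_def)
qed

lemma CFin_vimage_chart_inf_image: "CFin -` (chart_inf ` V) = inverse ` (V - {0})"
proof (intro subset_antisym subsetI)
  fix z assume "z \<in> inverse ` (V - {0})"
  then obtain w where w: "w \<in> V" "w \<noteq> 0" "z = inverse w" by blast
  then have "CFin z = chart_inf w" by (simp add: chart_inf_def)
  then show "z \<in> CFin -` (chart_inf ` V)" using w(1) by simp
qed (auto simp: chart_inf_def image_iff split: if_splits)

lemma open_chart_inf_image: "open V \<Longrightarrow> open (chart_inf ` V)"
proof -
  assume V: "open V"
  have "inverse ` (V - {0}) = (- {0}) \<inter> inverse -` V"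
  proof (intro subset_antisym subsetI)
    fix z assume "z \<in> (- {0}) \<inter> inverse -` V"
    then show "z \<in> inverse ` (V - {0})" by (intro image_eqI[of _ _ "inverse z"]) auto
  qed auto
  moreover have "open ((- {0}) \<inter> inverse -` V)"
    using V by (intro continuous_open_preimage continuous_intros) auto
  moreover have "chart_inf -` (chart_inf ` V) = V" using inj_chart_inf by (rule inj_vimage_image_eq)
  ultimately show ?thesis using V by (simp add: open_cp1_def CFin_vimage_chart_inf_image)
qed

lemma cp1_connected_neighbourhood:
  assumes "open U" "p \<in> U"
  obtains N where "open N" "p \<in> N" "N \<subseteq> U" "connected (CFin -` N)"
proof (cases p)
  case (CFin z)
  then obtain r where r: "r > 0" "ball z r \<subseteq> CFin -` U"
    using assms open_contains_ball unfolding open_cp1_def by (metis vimageI)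
  show thesis
  proof (rule that)
    show "open (CFin ` ball z r)" by (rule open_CFin_image) simp
    have "CFin -` CFin ` ball z r = ball z r" by auto
    then show "connected (CFin -` CFin ` ball z r)" by (simp only: connected_ball)
  qed (use r CFin in auto)
next
  case CInf
  then have "0 \<in> chart_inf -` U" using assms(2) by (simp add: chart_inf_def)
  then obtain r where r: "r > 0" "ball 0 r \<subseteq> chart_inf -` U"
    using assms(1) open_contains_ball unfolding open_cp1_def by metis
  show thesis
  proof (rule that)
    show "open (chart_inf ` ball 0 r)" by (rule open_chart_inf_image) simp
    show "p \<in> chart_inf ` ball 0 r"
      using r(1) CInf by (intro image_eqI[of _ _ 0]) (auto simp: chart_inf_def)
    show "connected (CFin -` chart_inf ` ball 0 r)"
      unfolding CFin_vimage_chart_inf_image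
      by (intro connected_continuous_image continuous_intros connected_punctured_ball) auto
  qed (use r(2) in blast)
qed

lemma cp1_holomorphic_on_eqI:
  assumes f: "cp1_holomorphic_on f N" and g: "cp1_holomorphic_on g N" and N: "open N"
    and eq: "\<And>z. CFin z \<in> N \<Longrightarrow> f (CFin z) = g (CFin z)" and x: "x \<in> N"
  shows "f x = g x"
proof (cases x)
  case CInf
  let ?h = "\<lambda>w. f (chart_inf w) - g (chart_inf w)"
  have V: "open (chart_inf -` N)" "0 \<in> chart_inf -` N"
    using N x CInf by (auto simp: open_cp1_def chart_inf_def)
  have "?h holomorphic_on (chart_inf -` N)"
    using f g unfolding cp1_holomorphic_on_def by (intro holomorphic_on_diff) auto
  then have "isCont ?h 0"
    using V by (auto dest: holomorphic_on_imp_continuous_on simp: continuous_on_eq_continuous_at)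
  then have "(?h \<longlongrightarrow> ?h 0) (at 0)" by (rule isContD)
  moreover have "\<forall>\<^sub>F w in at 0. ?h w = 0"
    unfolding eventually_at_topological
    by (intro exI[of _ "chart_inf -` N"]) (use V eq in \<open>auto simp: chart_inf_def\<close>)
  then have "(?h \<longlongrightarrow> 0) (at 0)" by (rule tendsto_eventually)
  ultimately have "?h 0 = 0" by (rule tendsto_unique[OF at_neq_bot])
  then show ?thesis using CInf by (simp add: chart_inf_def)
qed (use eq x in simp)

fun chart_at :: "cp1 \<Rightarrow> complex \<Rightarrow> cp1" where
  "chart_at (CFin c) u = CFin (c + u)"
| "chart_at CInf u = chart_inf u"

lemma continuous_on_chart_at: "continuous_on A (chart_at a)"
proof (cases a)
  case (CFin c)
  have "continuous_on A (\<lambda>u. CFin (c + u))"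
    by (rule continuous_on_compose2[OF continuous_on_CFin]) (auto intro: continuous_intros)
  then show ?thesis by (simp add: CFin fun_eq_iff cong: continuous_on_cong)
next
  case CInf
  then show ?thesis
    using continuous_on_subset[OF continuous_on_chart_inf] by (simp cong: continuous_on_cong)
qed

lemma chart_at_0: "chart_at a 0 = a"
  by (cases a) (auto simp: chart_inf_def)

lemma chart_at_inject: "chart_at a u = chart_at a v \<longleftrightarrow> u = v"
  by (cases a) (auto simp: inj_eq[OF inj_chart_inf])

lemma circle_at_eq_chart_at: "circle_at a r = chart_at a \<circ> circlepath 0 r"
  by (cases a) (auto simp: fun_eq_iff circlepath)

lemma disc_at_eq_chart_at: "disc_at a r = chart_at a ` cball 0 r"
proof (cases a)
  case (CFin c)
  have "cball c r = (\<lambda>u. c + u) ` cball 0 r" by (simp add: image_add_cball)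
  moreover have "chart_at (CFin c) = (\<lambda>u. CFin (c + u))" by (simp add: fun_eq_iff)
  ultimately show ?thesis by (simp only: CFin disc_at.simps image_image)
qed (simp add: image_def)

lemma circle_at_path:
  assumes r: "r > 0" and disc: "disc_at a r \<inter> D = {a}"
  shows "path (circle_at a r)" "path_image (circle_at a r) \<subseteq> - D"
    "pathfinish (circle_at a r) = pathstart (circle_at a r)"
proof -
  show "path (circle_at a r)"
    unfolding circle_at_eq_chart_at
    by (intro path_continuous_image continuous_on_chart_at path_circlepath)
  show "pathfinish (circle_at a r) = pathstart (circle_at a r)"
    by (simp add: circle_at_eq_chart_at pathstart_compose pathfinish_compose)
  show "path_image (circle_at a r) \<subseteq> - D"
  proof
    fix x assume "x \<in> path_image (circle_at a r)"
    then obtain u where u: "x = chart_at a u" "norm u = r"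
      using r unfolding circle_at_eq_chart_at path_image_compose by auto
    then have "x \<in> disc_at a r" "x \<noteq> a"
      using r chart_at_inject[of a u 0] by (auto simp: disc_at_eq_chart_at chart_at_0)
    then show "x \<in> - D" using disc by blast
  qed
qed

text \<open>The linear form of \<open>b\<close> at \<open>chart_at a u\<close>, up to a factor that depends only on \<open>a\<close> and \<open>u\<close>.\<close>

fun chart_form :: "cp1 \<Rightarrow> cp1 \<Rightarrow> complex \<Rightarrow> complex" where
  "chart_form b (CFin c) u = hden b * (c + u) - hnum b"
| "chart_form b CInf u = hden b - hnum b * u"

lemma lin_form_chart_quotient:
  "lin_form b (chart_at a u) / lin_form b' (chart_at a u) = chart_form b a u / chart_form b' a u"
  by (cases a) (auto simp: lin_form_CFin lin_form_chart_inf)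

lemma chart_form_eq_0_iff: "chart_form b a u = 0 \<longleftrightarrow> chart_at a u = b"
  using lin_form_eq_0_iff[of b "chart_at a u"]
  by (cases a) (auto simp: lin_form_CFin lin_form_chart_inf split: if_splits)

lemma continuous_on_chart_form: "continuous_on A (chart_form b a)"
  by (cases a) (auto simp: continuous_intros cong: continuous_on_cong)

lemma chart_form_self: "chart_form a a u = (if a = CInf then - u else u)"
  by (cases a) auto

section \<open>The coordinate sending three points to 0, 1 and infinity\<close>

locale three_points =
  fixes a1 a2 a3 :: cp1
  assumes distinct: "a1 \<noteq> a2" "a2 \<noteq> a3" "a1 \<noteq> a3"
begin

abbreviation D :: "cp1 set" where
  "D \<equiv> {a1, a2, a3}"

definition ratio_scale :: complex where
  "ratio_scale = lin_form a3 a2 / lin_form a1 a2"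

definition cross_ratio :: "cp1 \<Rightarrow> complex" where
  "cross_ratio x = ratio_scale * lin_form a1 x / lin_form a3 x"

definition cross_ratio_inv :: "complex \<Rightarrow> cp1" where
  "cross_ratio_inv t =
     of_homogeneous (t * hnum a3 - ratio_scale * hnum a1) (t * hden a3 - ratio_scale * hden a1)"

lemma ratio_scale_nonzero: "ratio_scale \<noteq> 0"
  using distinct by (simp add: ratio_scale_def lin_form_eq_0_iff)

lemma cross_ratio_a1: "cross_ratio a1 = 0" and cross_ratio_a2: "cross_ratio a2 = 1"
  using distinct by (simp_all add: cross_ratio_def ratio_scale_def lin_form_eq_0_iff)

lemma cross_ratio_diff:
  assumes "x \<noteq> a3" "y \<noteq> a3"
  shows "cross_ratio x - cross_ratio y =
    ratio_scale * lin_form a1 a3 * lin_form x y / (lin_form a3 x * lin_form a3 y)"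
proof -
  have "cross_ratio x - cross_ratio y =
      ratio_scale * (lin_form a1 x * lin_form a3 y - lin_form a1 y * lin_form a3 x) /
        (lin_form a3 x * lin_form a3 y)"
    using assms by (simp add: cross_ratio_def lin_form_eq_0_iff field_simps)
  also have "lin_form a1 x * lin_form a3 y - lin_form a1 y * lin_form a3 x
      = lin_form a1 a3 * lin_form x y"
    by (simp add: lin_form_def algebra_simps)
  finally show ?thesis by (simp add: mult.assoc)
qed

lemma cross_ratio_inject:
  assumes "x \<noteq> a3" "y \<noteq> a3"
  shows "cross_ratio x = cross_ratio y \<longleftrightarrow> x = y"
  using cross_ratio_diff[OF assms] assms ratio_scale_nonzero distinct
  by (auto simp: lin_form_eq_0_iff simp flip: eq_iff_diff_eq_0)

lemma cross_ratio_in: "x \<in> - D \<Longrightarrow> cross_ratio x \<in> - {0, 1}"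
  using cross_ratio_inject[of x a1] cross_ratio_inject[of x a2] cross_ratio_a1 cross_ratio_a2
    distinct by auto

lemma cross_ratio_CFin:
  "cross_ratio (CFin z) = ratio_scale * (hden a1 * z - hnum a1) / (hden a3 * z - hnum a3)"
  by (simp add: cross_ratio_def lin_form_CFin)

lemma cross_ratio_holomorphic: "cp1_holomorphic_on cross_ratio (- {a3})"
proof -
  have "hden a3 * z - hnum a3 \<noteq> 0" if "CFin z \<noteq> a3" for z
    using that lin_form_eq_0_iff[of a3 "CFin z"] by (simp add: lin_form_CFin)
  moreover have "hden a3 - hnum a3 * w \<noteq> 0" if "chart_inf w \<noteq> a3" for w
    using that lin_form_eq_0_iff[of a3 "chart_inf w"]
    by (auto simp: lin_form_chart_inf split: if_splits)
  moreover have "cross_ratio (chart_inf w) =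
      ratio_scale * (hden a1 - hnum a1 * w) / (hden a3 - hnum a3 * w)" for w
    by (simp add: cross_ratio_def lin_form_chart_inf)
  ultimately show ?thesis
    unfolding cp1_holomorphic_on_def cross_ratio_CFin by (auto intro!: holomorphic_intros)
qed

lemma open_Compl_D: "open (- D)"
  by (rule open_Compl_finite_cp1) simp

lemma cross_ratio_continuous: "continuous_on (- D) cross_ratio"
  using cross_ratio_holomorphic open_Compl_D
  by (auto intro!: cp1_holomorphic_on_imp_continuous_on intro: cp1_holomorphic_on_subset)

lemma cross_ratio_inv_nondegenerate:
  "t * hnum a3 - ratio_scale * hnum a1 \<noteq> 0 \<or> t * hden a3 - ratio_scale * hden a1 \<noteq> 0"
proof (rule ccontr)
  assume *: "\<not> ?thesis"
  have "ratio_scale * lin_form a1 a3 =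
      hden a3 * (t * hnum a3 - ratio_scale * hnum a1)
      - hnum a3 * (t * hden a3 - ratio_scale * hden a1)"
    by (simp add: lin_form_def algebra_simps)
  then show False using * ratio_scale_nonzero distinct lin_form_eq_0_iff by auto
qed

lemma continuous_on_cross_ratio_inv: "continuous_on UNIV cross_ratio_inv"
  unfolding cross_ratio_inv_def using cross_ratio_inv_nondegenerate
  by (intro continuous_on_of_homogeneous continuous_intros) auto

lemma cross_ratio_cross_ratio_inv: "cross_ratio (cross_ratio_inv t) = t"
  and cross_ratio_inv_neq_a3: "cross_ratio_inv t \<noteq> a3"
proof -
  define r where "r = (if t * hden a3 - ratio_scale * hden a1 = 0
    then t * hnum a3 - ratio_scale * hnum a1
    else t * hden a3 - ratio_scale * hden a1)"
  have r: "r \<noteq> 0" using cross_ratio_inv_nondegenerate[of t] by (auto simp: r_def)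
  have lin: "lin_form a (cross_ratio_inv t) =
      (hden a * (t * hnum a3 - ratio_scale * hnum a1)
        - hnum a * (t * hden a3 - ratio_scale * hden a1)) / r" for a
    unfolding cross_ratio_inv_def lin_form_of_homogeneous[OF cross_ratio_inv_nondegenerate] r_def
    by simp
  have a1: "lin_form a1 (cross_ratio_inv t) = t * lin_form a1 a3 / r"
    and a3: "lin_form a3 (cross_ratio_inv t) = ratio_scale * lin_form a1 a3 / r"
    unfolding lin by (simp_all add: lin_form_def algebra_simps)
  have nz: "lin_form a1 a3 \<noteq> 0" using distinct by (simp add: lin_form_eq_0_iff)
  then show "cross_ratio (cross_ratio_inv t) = t"
    using r ratio_scale_nonzero by (simp add: cross_ratio_def a1 a3)
  show "cross_ratio_inv t \<noteq> a3"
    using a3 r nz ratio_scale_nonzero lin_form_eq_0_iff[of a3 "cross_ratio_inv t"] by auto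
qed

lemma cross_ratio_inv_cross_ratio: "x \<noteq> a3 \<Longrightarrow> cross_ratio_inv (cross_ratio x) = x"
  using cross_ratio_inject[OF cross_ratio_inv_neq_a3] cross_ratio_cross_ratio_inv by blast

lemma cross_ratio_inv_in: "t \<in> - {0, 1} \<Longrightarrow> cross_ratio_inv t \<in> - D"
  using cross_ratio_cross_ratio_inv[of t] cross_ratio_inv_neq_a3[of t] cross_ratio_a1 cross_ratio_a2
  by auto

lemma cross_ratio_compose_path:
  assumes "path g" "path_image g \<subseteq> - D"
  shows "path (cross_ratio \<circ> g)" "path_image (cross_ratio \<circ> g) \<subseteq> - {0, 1}"
  using assms cross_ratio_in
  by (auto intro!: path_continuous_image continuous_on_subset[OF cross_ratio_continuous]
      simp: path_image_compose)

lemma cross_ratio_compose_loops: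
  "g \<in> loops (- D) p \<Longrightarrow> cross_ratio \<circ> g \<in> loops (- {0, 1}) (cross_ratio p)"
  using cross_ratio_compose_path[of g] by (simp add: loops_def pathstart_compose pathfinish_compose)

lemma cross_ratio_inv_compose_loops:
  assumes p: "p \<in> - D" and h: "h \<in> loops (- {0, 1}) (cross_ratio p)"
  shows "cross_ratio_inv \<circ> h \<in> loops (- D) p"
proof -
  have "path (cross_ratio_inv \<circ> h)"
    using h
    by (intro path_continuous_image continuous_on_subset[OF continuous_on_cross_ratio_inv])
      (auto simp: loops_def)
  moreover have "path_image (cross_ratio_inv \<circ> h) \<subseteq> - D"
    unfolding path_image_compose using h cross_ratio_inv_in by (force simp: loops_def)
  ultimately show ?thesis
    using h p cross_ratio_inv_cross_ratio[of p]
    by (simp add: loops_def pathstart_compose pathfinish_compose)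
qed

end

section \<open>Winding numbers of simple loops around the singular points\<close>

lemma winding_number_mult:
  assumes p: "path p" "0 \<notin> path_image p" and q: "path q" "0 \<notin> path_image q"
  shows "winding_number (\<lambda>t. p t * q t) 0 = winding_number p 0 + winding_number q 0"
proof -
  obtain l where l: "path l" "pathfinish l - pathstart l = two_pi_i * winding_number p 0"
    "\<And>t. t \<in> {0..1} \<Longrightarrow> p t = 0 + exp (l t)"
    by (rule winding_number_as_continuous_log[OF p]) auto
  obtain k where k: "path k" "pathfinish k - pathstart k = two_pi_i * winding_number q 0"
    "\<And>t. t \<in> {0..1} \<Longrightarrow> q t = 0 + exp (k t)"
    by (rule winding_number_as_continuous_log[OF q]) auto
  have "winding_number (\<lambda>t. p t * q t) 0 = winding_number (exp \<circ> (\<lambda>t. l t + k t)) 0"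
    using l(3) k(3) by (intro winding_number_cong) (simp add: exp_add)
  also have "\<dots> = (pathfinish l - pathstart l + (pathfinish k - pathstart k)) / two_pi_i"
    using l(1) k(1) by (subst winding_number_compose_exp)
      (auto simp: path_def pathstart_def pathfinish_def intro!: continuous_intros)
  also have "\<dots> = winding_number p 0 + winding_number q 0"
    unfolding l(2) k(2) by (simp add: add_divide_distrib)
  finally show ?thesis .
qed

lemma winding_number_circlepath_image_eq_0:
  assumes f: "continuous_on (cball 0 r) f" "\<And>u. u \<in> cball 0 r \<Longrightarrow> f u \<noteq> 0" and r: "r > 0"
  shows "winding_number (\<lambda>t. f (circlepath 0 r t)) 0 = 0"
proof -
  obtain L where L: "continuous_on (cball 0 r) L" "\<And>u. u \<in> cball 0 r \<Longrightarrow> f u = exp (L u)"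
    using continuous_logarithm_on_cball[OF f] by blast
  have on_circle: "circlepath 0 r t \<in> cball 0 r" for t
    using r by (simp add: circlepath norm_mult)
  have path: "path (L \<circ> circlepath 0 r)"
    using r by (intro path_continuous_image path_circlepath continuous_on_subset[OF L(1)]) auto
  have "winding_number (\<lambda>t. f (circlepath 0 r t)) 0 = winding_number (exp \<circ> (L \<circ> circlepath 0 r)) 0"
    by (rule winding_number_cong) (simp add: L(2)[OF on_circle])
  then show ?thesis
    by (simp add: winding_number_compose_exp[OF path] pathstart_compose pathfinish_compose)
qed

lemma winding_number_circlepath_times_image_eq_1:
  assumes f: "continuous_on (cball 0 r) f" "\<And>u. u \<in> cball 0 r \<Longrightarrow> f u \<noteq> 0" and r: "r > 0"
  shows "winding_number (\<lambda>t. circlepath 0 r t * f (circlepath 0 r t)) 0 = 1"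
proof -
  let ?c = "circlepath 0 r"
  have "norm (?c t) = r" for t
    using r by (simp add: circlepath norm_mult)
  then have avoids: "?c t \<noteq> 0" "f (?c t) \<noteq> 0" for t
    using r f(2)[of "?c t"] by (metis norm_zero less_irrefl, simp)
  have "winding_number (\<lambda>t. ?c t * f (?c t)) 0 =
      winding_number ?c 0 + winding_number (\<lambda>t. f (?c t)) 0"
  proof (rule winding_number_mult)
    show "path (\<lambda>t. f (?c t))"
      using path_continuous_image[OF path_circlepath, of 0 r f]
        continuous_on_subset[OF f(1) sphere_cball] r
      by (simp add: o_def)
    show "0 \<notin> path_image ?c" "0 \<notin> path_image (\<lambda>t. f (?c t))"
      using avoids unfolding path_image_def by (metis imageE)+
  qed simp
  then show ?thesis
    using winding_number_circlepath_image_eq_0[OF f r] winding_number_circlepath_centre[OF r]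
    by simp
qed

context three_points
begin

lemma cross_ratio_chart_at_diff:
  assumes "chart_at a u \<noteq> a3" "b \<noteq> a3"
  shows "cross_ratio (chart_at a u) - cross_ratio b =
    - ratio_scale * lin_form a1 a3 / lin_form a3 b * (chart_form b a u / chart_form a3 a u)"
  unfolding cross_ratio_diff[OF assms]
  by (simp add: lin_form_swap[of "chart_at a u" b] flip: lin_form_chart_quotient)

lemma winding_number_cross_ratio_circle_at:
  assumes r: "r > 0" and disc: "disc_at a r \<inter> D = {a}" and b: "b \<in> {a1, a2}" and a: "a \<noteq> a3"
  shows "winding_number (cross_ratio \<circ> circle_at a r) (cross_ratio b) = (if a = b then 1 else 0)"
proof -
  let ?c = "circlepath 0 r"
  define k where "k = - ratio_scale * lin_form a1 a3 / lin_form a3 b"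
  have k: "k \<noteq> 0" using b distinct ratio_scale_nonzero by (auto simp: k_def lin_form_eq_0_iff)
  have on_circle: "?c t \<in> cball 0 r" for t
    using r by (simp add: circlepath norm_mult)
  have form_nz: "chart_form d a u \<noteq> 0" if "d \<in> D" "d \<noteq> a" "u \<in> cball 0 r" for d u
  proof
    assume "chart_form d a u = 0"
    then have "d \<in> disc_at a r"
      using that(3) unfolding chart_form_eq_0_iff disc_at_eq_chart_at by blast
    then show False using disc that by blast
  qed
  have a3: "chart_form a3 a u \<noteq> 0" if "u \<in> cball 0 r" for u
    using form_nz[OF _ _ that] a by simp
  have diff: "cross_ratio (circle_at a r t) - cross_ratio b
      = k * (chart_form b a (?c t) / chart_form a3 a (?c t))" for t
    using cross_ratio_chart_at_diff[of a "?c t" b] a3[OF on_circle] b distinct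
    by (auto simp: k_def circle_at_eq_chart_at chart_form_eq_0_iff)
  have wn: "winding_number (cross_ratio \<circ> circle_at a r) (cross_ratio b) =
      winding_number (\<lambda>t. k * (chart_form b a (?c t) / chart_form a3 a (?c t))) 0"
    by (subst winding_number_offset) (simp add: diff)
  show ?thesis
  proof (cases "a = b")
    case False
    have "winding_number (\<lambda>t. k * (chart_form b a (?c t) / chart_form a3 a (?c t))) 0 = 0"
      by (rule winding_number_circlepath_image_eq_0[OF _ _ r])
        (use k a3 form_nz[of b] b False in
          \<open>auto intro!: continuous_intros continuous_on_chart_form\<close>)
    then show ?thesis using wn False by simp
  next
    case True
    define e where "e u = (if a = CInf then - k else k) / chart_form a3 a u" for u
    have "k * (chart_form b a (?c t) / chart_form a3 a (?c t)) = ?c t * e (?c t)" for t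
      using True by (simp add: e_def chart_form_self)
    moreover have "winding_number (\<lambda>t. ?c t * e (?c t)) 0 = 1"
      by (rule winding_number_circlepath_times_image_eq_1[OF _ _ r])
        (use k a3 in \<open>auto simp: e_def[abs_def] intro!: continuous_intros continuous_on_chart_form\<close>)
    ultimately show ?thesis using wn True by simp
  qed
qed

lemma winding_number_cross_ratio_loop_around:
  assumes loop: "loop_around D p a g" and a: "a \<in> {a1, a2}" and b: "b \<in> {a1, a2}"
  shows "winding_number (cross_ratio \<circ> g) (cross_ratio b) = (if a = b then 1 else 0)"
proof -
  obtain r q where r: "r > 0" "disc_at a r \<inter> D = {a}"
    and q: "path q" "path_image q \<subseteq> - D" "pathfinish q = pathstart (circle_at a r)"
    and hom: "homotopic_paths (- D) g (q +++ circle_at a r +++ reversepath q)"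
    using loop unfolding loop_around_def by blast
  note circle = circle_at_path[OF r]
  have b01: "cross_ratio b \<in> {0, 1}" using b cross_ratio_a1 cross_ratio_a2 by auto
  have "homotopic_paths (- {cross_ratio b}) (cross_ratio \<circ> g)
      (cross_ratio \<circ> (q +++ circle_at a r +++ reversepath q))"
    using hom cross_ratio_continuous cross_ratio_in b01
    by (intro homotopic_paths_continuous_image[where h = cross_ratio and S = "- D"]) auto
  then have "winding_number (cross_ratio \<circ> g) (cross_ratio b) =
      winding_number (cross_ratio \<circ> (q +++ circle_at a r +++ reversepath q)) (cross_ratio b)"
    by (rule winding_number_homotopic_paths)
  also have "cross_ratio \<circ> (q +++ circle_at a r +++ reversepath q) =
      (cross_ratio \<circ> q) +++ (cross_ratio \<circ> circle_at a r) +++ reversepath (cross_ratio \<circ> q)"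
    by (simp add: path_compose_join path_compose_reversepath)
  also have "winding_number \<dots> (cross_ratio b)
      = winding_number (cross_ratio \<circ> circle_at a r) (cross_ratio b)"
  proof -
    have "cross_ratio b \<notin> path_image (cross_ratio \<circ> q)"
      "cross_ratio b \<notin> path_image (cross_ratio \<circ> circle_at a r)"
      using cross_ratio_compose_path(2)[OF q(1,2)] cross_ratio_compose_path(2)[OF circle(1,2)] b01
      by auto
    then show ?thesis
      using cross_ratio_compose_path(1)[OF q(1,2)] cross_ratio_compose_path(1)[OF circle(1,2)] q(3)
        circle(3)
      by (simp add: winding_number_join winding_number_reversepath path_image_join
          not_in_path_image_join pathstart_compose pathfinish_compose)
  qed
  also have "\<dots> = (if a = b then 1 else 0)"
    using r b a distinct by (intro winding_number_cross_ratio_circle_at) auto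
  finally show ?thesis .
qed

end

section \<open>Fuchsian equations with logarithmic coefficients\<close>

lemma pole_order_leI:
  assumes "g analytic_on {c}" "\<And>z. z \<noteq> c \<Longrightarrow> f z = g z / (z - c) ^ k"
  shows "pole_order_le k f c"
  unfolding pole_order_le_def using assms
  by (intro exI[of _ g]) (simp add: eventually_at_filter)

lemma pole_order_le_cong:
  assumes "pole_order_le k g c" "\<forall>\<^sub>F z in at c. f z = g z"
  shows "pole_order_le k f c"
proof -
  obtain h where h: "h analytic_on {c}" "\<forall>\<^sub>F z in at c. g z = h z / (z - c) ^ k"
    using assms(1) unfolding pole_order_le_def by blast
  from assms(2) h(2) have "\<forall>\<^sub>F z in at c. f z = h z / (z - c) ^ k"
    by eventually_elim simp
  with h(1) show ?thesis unfolding pole_order_le_def by blast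
qed

lemma pole_order_le_analytic: "f analytic_on {c} \<Longrightarrow> pole_order_le 0 f c"
  by (rule pole_order_leI[of f]) auto

lemma pole_order_le_mult:
  assumes "pole_order_le j f c" "pole_order_le k g c"
  shows "pole_order_le (j + k) (\<lambda>z. f z * g z) c"
proof -
  obtain f' g' where "f' analytic_on {c}" "\<forall>\<^sub>F z in at c. f z = f' z / (z - c) ^ j"
    and "g' analytic_on {c}" "\<forall>\<^sub>F z in at c. g z = g' z / (z - c) ^ k"
    using assms unfolding pole_order_le_def by blast
  moreover from this(2,4) have "\<forall>\<^sub>F z in at c. f z * g z = f' z * g' z / (z - c) ^ (j + k)"
    by eventually_elim (simp add: power_add)
  ultimately show ?thesis
    unfolding pole_order_le_def by (intro exI[of _ "\<lambda>z. f' z * g' z"]) (auto intro: analytic_intros)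
qed

lemma pole_order_le_cmult: "pole_order_le k f c \<Longrightarrow> pole_order_le k (\<lambda>z. a * f z) c"
  using pole_order_le_mult[OF pole_order_le_analytic[of "\<lambda>_. a"]] by simp

lemma pole_order_le_add:
  assumes "pole_order_le k f c" "pole_order_le k g c"
  shows "pole_order_le k (\<lambda>z. f z + g z) c"
proof -
  obtain f' g' where "f' analytic_on {c}" "\<forall>\<^sub>F z in at c. f z = f' z / (z - c) ^ k"
    and "g' analytic_on {c}" "\<forall>\<^sub>F z in at c. g z = g' z / (z - c) ^ k"
    using assms unfolding pole_order_le_def by blast
  moreover from this(2,4) have "\<forall>\<^sub>F z in at c. f z + g z = (f' z + g' z) / (z - c) ^ k"
    by eventually_elim (simp add: add_divide_distrib)
  ultimately show ?thesis
    unfolding pole_order_le_def by (intro exI[of _ "\<lambda>z. f' z + g' z"]) (auto intro: analytic_intros)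
qed

lemma pole_order_le_sum:
  assumes "finite I" "\<And>i. i \<in> I \<Longrightarrow> pole_order_le k (f i) c"
  shows "pole_order_le k (\<lambda>z. \<Sum>i\<in>I. f i z) c"
  using assms
proof (induction I rule: finite_induct)
  case empty
  then show ?case by (intro pole_order_leI[of "\<lambda>_. 0"]) auto
qed (simp add: pole_order_le_add)

text \<open>This is \<open>1 / (z - a)\<close>, read as \<open>0\<close> if \<open>a\<close> is the point at infinity.\<close>

definition simple_pole :: "cp1 \<Rightarrow> complex \<Rightarrow> complex" where
  "simple_pole a z = hden a / (hden a * z - hnum a)"

definition log_form :: "cp1 set \<Rightarrow> (cp1 \<Rightarrow> complex) \<Rightarrow> complex \<Rightarrow> complex" where
  "log_form D c z = (\<Sum>a\<in>D. c a * simple_pole a z)"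

definition log_form_deriv :: "cp1 set \<Rightarrow> (cp1 \<Rightarrow> complex) \<Rightarrow> complex \<Rightarrow> complex" where
  "log_form_deriv D c z = - (\<Sum>a\<in>D. c a * (simple_pole a z)\<^sup>2)"

text \<open>The equation satisfied by \<open>u\<close> and \<open>u \<phi>\<close> when \<open>log_form D A\<close> and \<open>log_form D B\<close> are the
  logarithmic derivatives of \<open>u\<close> and of \<open>\<phi>'\<close>.\<close>

definition coeff1 :: "cp1 set \<Rightarrow> (cp1 \<Rightarrow> complex) \<Rightarrow> (cp1 \<Rightarrow> complex) \<Rightarrow> complex \<Rightarrow> complex" where
  "coeff1 D A B z = - (2 * log_form D A z + log_form D B z)"

definition coeff2 :: "cp1 set \<Rightarrow> (cp1 \<Rightarrow> complex) \<Rightarrow> (cp1 \<Rightarrow> complex) \<Rightarrow> complex \<Rightarrow> complex" where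
  "coeff2 D A B z = log_form D A z * (log_form D A z + log_form D B z) - log_form_deriv D A z"

lemma denominator_nonzero: "CFin z \<noteq> a \<Longrightarrow> hden a * z - hnum a \<noteq> 0"
  using lin_form_eq_0_iff[of a "CFin z"] by (simp add: lin_form_CFin)

lemma simple_pole_has_field_derivative:
  assumes "CFin z \<noteq> a"
  shows "(simple_pole a has_field_derivative - (simple_pole a z)\<^sup>2) (at z)"
  unfolding simple_pole_def[abs_def] using denominator_nonzero[OF assms]
  by (auto intro!: derivative_eq_intros simp: power2_eq_square)

lemma log_form_has_field_derivative:
  assumes "CFin z \<notin> D"
  shows "(log_form D c has_field_derivative log_form_deriv D c z) (at z)"
proof -
  have "((\<lambda>z. \<Sum>a\<in>D. c a * simple_pole a z) has_field_derivative
      (\<Sum>a\<in>D. c a * - (simple_pole a z)\<^sup>2)) (at z)"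
    using assms by (intro DERIV_sum DERIV_cmult simple_pole_has_field_derivative) auto
  then show ?thesis
    by (simp add: log_form_def[abs_def] log_form_deriv_def sum_negf)
qed

lemma log_form_analytic:
  assumes "CFin z \<notin> D"
  shows "log_form D c analytic_on {z}" "log_form_deriv D c analytic_on {z}"
proof -
  have "simple_pole a analytic_on {z}" if "a \<in> D" for a
  proof -
    have "CFin z \<noteq> a" using assms that by blast
    then show ?thesis
      unfolding simple_pole_def[abs_def] using denominator_nonzero by (auto intro!: analytic_intros)
  qed
  then show "log_form D c analytic_on {z}" "log_form_deriv D c analytic_on {z}"
    unfolding log_form_def[abs_def] log_form_deriv_def[abs_def] by (auto intro!: analytic_intros)
qed

lemma ordinary_point_CFin:
  assumes "CFin z \<notin> D"
  shows "ordinary_point (coeff1 D A B) (coeff2 D A B) (CFin z)"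
  using log_form_analytic[OF assms]
  by (auto simp: coeff1_def[abs_def] coeff2_def[abs_def] intro!: analytic_intros)

lemma simple_pole_pole_order_le: "pole_order_le 1 (simple_pole a) c"
proof (cases "a = CFin c")
  case True
  then show ?thesis
    by (intro pole_order_leI[of "\<lambda>_. 1"]) (auto simp: simple_pole_def)
next
  case False
  then have "hden a * c - hnum a \<noteq> 0" by (intro denominator_nonzero) auto
  then have "(\<lambda>z. (z - c) * simple_pole a z) analytic_on {c}"
    unfolding simple_pole_def by (auto intro!: analytic_intros)
  then show ?thesis by (rule pole_order_leI) simp
qed

lemma log_form_pole_order_le:
  assumes "finite D"
  shows "pole_order_le 1 (log_form D A) c" "pole_order_le 2 (log_form_deriv D A) c"
proof -
  have "pole_order_le 2 (\<lambda>z. (simple_pole a z)\<^sup>2) c" for a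
    using pole_order_le_mult[OF simple_pole_pole_order_le[of a c] simple_pole_pole_order_le[of a c]]
    by (simp add: power2_eq_square numeral_2_eq_2)
  then show "pole_order_le 2 (log_form_deriv D A) c"
    unfolding log_form_deriv_def[abs_def] sum_negf[symmetric] mult_minus_left[symmetric]
    using assms by (intro pole_order_le_sum pole_order_le_cmult)
  show "pole_order_le 1 (log_form D A) c"
    unfolding log_form_def[abs_def]
    using assms by (intro pole_order_le_sum pole_order_le_cmult simple_pole_pole_order_le)
qed

lemma fuchsian_point_CFin:
  assumes "finite D"
  shows "fuchsian_point (coeff1 D A B) (coeff2 D A B) (CFin c)"
proof -
  note pole = log_form_pole_order_le[OF assms, of _ c]
  have "pole_order_le 1 (\<lambda>z. (- 2) * log_form D A z + (- 1) * log_form D B z) c"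
    by (intro pole_order_le_add pole_order_le_cmult pole)
  moreover have "pole_order_le 2
      (\<lambda>z. log_form D A z * (log_form D A z + log_form D B z) + (- 1) * log_form_deriv D A z) c"
    using pole_order_le_mult[OF pole(1)[of A] pole_order_le_add[OF pole(1)[of A] pole(1)[of B]]]
    by (intro pole_order_le_add pole_order_le_cmult pole) (simp add: numeral_2_eq_2)
  ultimately show ?thesis by (simp add: coeff1_def[abs_def] coeff2_def[abs_def])
qed

definition simple_pole_inf :: "cp1 \<Rightarrow> complex \<Rightarrow> complex" where
  "simple_pole_inf a w = hden a / (hden a - hnum a * w)"

definition log_form_inf :: "cp1 set \<Rightarrow> (cp1 \<Rightarrow> complex) \<Rightarrow> complex \<Rightarrow> complex" where
  "log_form_inf D c w = (\<Sum>a\<in>D. c a * simple_pole_inf a w)"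

definition log_form_deriv_inf :: "cp1 set \<Rightarrow> (cp1 \<Rightarrow> complex) \<Rightarrow> complex \<Rightarrow> complex" where
  "log_form_deriv_inf D c w = - (\<Sum>a\<in>D. c a * (simple_pole_inf a w)\<^sup>2)"

lemma log_form_inverse:
  assumes "w \<noteq> 0"
  shows "log_form D c (1 / w) = w * log_form_inf D c w"
    "log_form_deriv D c (1 / w) = w\<^sup>2 * log_form_deriv_inf D c w"
proof -
  have "simple_pole a (1 / w) = w * simple_pole_inf a w" for a
  proof -
    have "hden a * (1 / w) - hnum a = (hden a - hnum a * w) / w"
      using assms by (simp add: field_simps)
    then show ?thesis by (simp add: simple_pole_def simple_pole_inf_def)
  qed
  then show "log_form D c (1 / w) = w * log_form_inf D c w"
    "log_form_deriv D c (1 / w) = w\<^sup>2 * log_form_deriv_inf D c w"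
    by (simp_all add: log_form_def log_form_inf_def log_form_deriv_def log_form_deriv_inf_def
        sum_distrib_left power_mult_distrib mult_ac)
qed

lemma coeff_inf_eq:
  assumes "w \<noteq> 0"
  shows "coeff1_inf (coeff1 D A B) w = (2 + 2 * log_form_inf D A w + log_form_inf D B w) / w"
    "coeff2_inf (coeff2 D A B) w =
      (log_form_inf D A w * (log_form_inf D A w + log_form_inf D B w)
        - log_form_deriv_inf D A w) / w\<^sup>2"
proof -
  show "coeff1_inf (coeff1 D A B) w = (2 + 2 * log_form_inf D A w + log_form_inf D B w) / w"
    using assms
    by (simp add: coeff1_inf_def coeff1_def log_form_inverse field_simps power2_eq_square)
  define P where
    "P = log_form_inf D A w * (log_form_inf D A w + log_form_inf D B w) - log_form_deriv_inf D A w"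
  have "coeff2 D A B (1 / w) = w\<^sup>2 * P"
    using assms by (simp add: P_def coeff2_def log_form_inverse algebra_simps power2_eq_square)
  moreover have "w ^ 4 = w\<^sup>2 * w\<^sup>2" by (simp flip: power_add)
  ultimately have "coeff2_inf (coeff2 D A B) w = P / w\<^sup>2"
    using assms nonzero_mult_divide_mult_cancel_left[of "w\<^sup>2" P "w\<^sup>2"]
    by (simp only: coeff2_inf_def) simp
  then show "coeff2_inf (coeff2 D A B) w =
      (log_form_inf D A w * (log_form_inf D A w + log_form_inf D B w)
        - log_form_deriv_inf D A w) / w\<^sup>2"
    by (simp only: P_def)
qed

lemma fuchsian_point_CInf: "fuchsian_point (coeff1 D A B) (coeff2 D A B) CInf"
proof -
  have "simple_pole_inf a analytic_on {0}" for a
    by (cases a) (auto simp: simple_pole_inf_def[abs_def] intro!: analytic_intros)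
  then have an: "log_form_inf D c analytic_on {0}" "log_form_deriv_inf D c analytic_on {0}" for c
    by (auto simp: log_form_inf_def[abs_def] log_form_deriv_inf_def[abs_def]
      intro!: analytic_intros)
  have "pole_order_le 1 (coeff1_inf (coeff1 D A B)) 0"
    by (rule pole_order_leI[of "\<lambda>w. 2 + 2 * log_form_inf D A w + log_form_inf D B w"])
      (auto simp: coeff_inf_eq intro!: analytic_intros an)
  moreover have "pole_order_le 2 (coeff2_inf (coeff2 D A B)) 0"
    by (rule pole_order_leI[of "\<lambda>w. log_form_inf D A w * (log_form_inf D A w + log_form_inf D B w)
          - log_form_deriv_inf D A w"])
      (auto simp: coeff_inf_eq intro!: analytic_intros an)
  ultimately show ?thesis by simp
qed

lemma log_form_inf_expansion:
  assumes D: "finite D" "CInf \<notin> D"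
  obtains T Q where "T analytic_on {0}" "Q analytic_on {0}"
    "\<forall>\<^sub>F w in at 0. log_form_inf D c w = (\<Sum>a\<in>D. c a) + w * T w \<and>
      log_form_deriv_inf D c w = - ((\<Sum>a\<in>D. c a) + 2 * w * T w + w\<^sup>2 * Q w)"
proof -
  define q where "q a w = hnum a / (1 - hnum a * w)" for a w
  define T where "T w = (\<Sum>a\<in>D. c a * q a w)" for w
  define Q where "Q w = (\<Sum>a\<in>D. c a * (q a w)\<^sup>2)" for w
  have q: "q a analytic_on {0}" for a
    unfolding q_def[abs_def] by (auto intro!: analytic_intros)
  have "\<forall>\<^sub>F w in at 0. 1 - hnum a * w \<noteq> 0" for a
  proof -
    have "((\<lambda>w. 1 - hnum a * w) \<longlongrightarrow> 1 - hnum a * 0) (at 0)" by (intro tendsto_intros)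
    then show ?thesis by (rule tendsto_imp_eventually_ne) simp
  qed
  then have "\<forall>\<^sub>F w in at 0. \<forall>a\<in>D. 1 - hnum a * w \<noteq> 0"
    using D(1) by (simp add: eventually_ball_finite)
  then have "\<forall>\<^sub>F w in at 0. log_form_inf D c w = (\<Sum>a\<in>D. c a) + w * T w \<and>
      log_form_deriv_inf D c w = - ((\<Sum>a\<in>D. c a) + 2 * w * T w + w\<^sup>2 * Q w)"
  proof eventually_elim
    case (elim w)
    have "simple_pole_inf a w = 1 + w * q a w" if "a \<in> D" for a
      using elim that D(2) by (cases a) (auto simp: simple_pole_inf_def q_def field_simps)
    then have "log_form_inf D c w = (\<Sum>a\<in>D. c a * (1 + w * q a w))"
      "log_form_deriv_inf D c w = - (\<Sum>a\<in>D. c a * (1 + w * q a w)\<^sup>2)"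
      by (simp_all add: log_form_inf_def log_form_deriv_inf_def)
    then show ?case
      by (simp add: T_def Q_def sum.distrib sum_distrib_left algebra_simps power2_eq_square)
  qed
  moreover have "T analytic_on {0}" "Q analytic_on {0}"
    unfolding T_def[abs_def] Q_def[abs_def] by (intro analytic_intros q)+
  ultimately show thesis by (intro that)
qed

text \<open>These are the conditions for \<open>u\<close> and \<open>d\<phi>\<close> to be regular at infinity: \<open>u\<close> has order \<open>\<Sum>A\<close> in \<open>z\<close>,
  and \<open>\<phi>' = d\<phi> / dz\<close> has order \<open>- 2\<close>.\<close>

lemma ordinary_point_CInf:
  assumes D: "finite D" "CInf \<notin> D" and AB: "(\<Sum>a\<in>D. A a) = 0" "(\<Sum>a\<in>D. B a) = - 2"
  shows "ordinary_point (coeff1 D A B) (coeff2 D A B) CInf"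
proof -
  obtain T Q where T: "T analytic_on {0}" "Q analytic_on {0}"
    and A: "\<forall>\<^sub>F w in at 0. log_form_inf D A w = 0 + w * T w \<and>
      log_form_deriv_inf D A w = - (0 + 2 * w * T w + w\<^sup>2 * Q w)"
    using log_form_inf_expansion[OF D, of A] unfolding AB by blast
  obtain E where E: "E analytic_on {0}" and B: "\<forall>\<^sub>F w in at 0. log_form_inf D B w = - 2 + w * E w"
    using log_form_inf_expansion[OF D, of B] unfolding AB by (auto simp: eventually_conj_iff)
  have ev: "\<forall>\<^sub>F w in at 0. w \<noteq> (0::complex)" by (simp add: eventually_at_filter)
  have "\<forall>\<^sub>F w in at 0. coeff1_inf (coeff1 D A B) w = 2 * T w + E w"
    using A B ev
  proof eventually_elim
    case (elim w)
    show ?case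
      unfolding coeff_inf_eq(1)[OF elim(3)] conjunct1[OF elim(1)] elim(2)
      using elim(3) by (simp add: field_simps)
  qed
  moreover have "\<forall>\<^sub>F w in at 0. coeff2_inf (coeff2 D A B) w = Q w + T w * (T w + E w)"
    using A B ev
  proof eventually_elim
    case (elim w)
    show ?case
      unfolding coeff_inf_eq(2)[OF elim(3)] conjunct1[OF elim(1)] conjunct2[OF elim(1)] elim(2)
      using elim(3) by (simp add: field_simps power2_eq_square)
  qed
  ultimately show ?thesis
    using T E unfolding ordinary_point.simps
    by (intro conjI pole_order_le_cong[OF pole_order_le_analytic]) (auto intro!: analytic_intros)
qed

theorem riemann_equation_log_form:
  assumes "card D = 3" "(\<Sum>a\<in>D. A a) = 0" "(\<Sum>a\<in>D. B a) = - 2"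
  shows "riemann_equation D (coeff1 D A B) (coeff2 D A B)"
proof -
  have "finite D" using assms(1) by (simp add: card_ge_0_finite)
  then have "ordinary_point (coeff1 D A B) (coeff2 D A B) x" if "x \<notin> D" for x
    using that assms ordinary_point_CFin ordinary_point_CInf by (cases x) auto
  moreover have "fuchsian_point (coeff1 D A B) (coeff2 D A B) x" for x
    using \<open>finite D\<close> fuchsian_point_CFin fuchsian_point_CInf by (cases x) auto
  ultimately show ?thesis using assms(1) unfolding riemann_equation_def by blast
qed

section \<open>Reduction of order\<close>

lemma DERIV_zero_constant_on_connected:
  fixes h :: "complex \<Rightarrow> complex"
  assumes "open W" "connected W" "\<And>z. z \<in> W \<Longrightarrow> (h has_field_derivative 0) (at z)"
  obtains k where "\<forall>z\<in>W. h z = k"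
proof -
  have "h constant_on W"
    using assms
    by (intro DERIV_zero_connected_constant_on[of W "{}"])
      (auto intro!: continuous_at_imp_continuous_on DERIV_isCont)
  then show thesis using that unfolding constant_on_def by blast
qed

locale reducible_ode =
  fixes W :: "complex set" and \<theta> \<theta>' \<eta> u \<phi> w :: "complex \<Rightarrow> complex"
  assumes open_W: "open W"
    and \<theta>_deriv: "z \<in> W \<Longrightarrow> (\<theta> has_field_derivative \<theta>' z) (at z)"
    and u_deriv: "z \<in> W \<Longrightarrow> (u has_field_derivative \<theta> z * u z) (at z)"
    and \<phi>_deriv: "z \<in> W \<Longrightarrow> (\<phi> has_field_derivative w z) (at z)"
    and w_deriv: "z \<in> W \<Longrightarrow> (w has_field_derivative \<eta> z * w z) (at z)"
    and nonzero: "z \<in> W \<Longrightarrow> u z \<noteq> 0" "z \<in> W \<Longrightarrow> w z \<noteq> 0"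
begin

definition solves :: "(complex \<Rightarrow> complex) \<Rightarrow> bool" where
  "solves f \<longleftrightarrow> (\<forall>z\<in>W. deriv (deriv f) z + - (2 * \<theta> z + \<eta> z) * deriv f z
     + (\<theta> z * (\<theta> z + \<eta> z) - \<theta>' z) * f z = 0)"

lemma solves_linear_combination: "solves (\<lambda>z. u z * (c0 + c1 * \<phi> z))"
  unfolding solves_def
proof
  let ?f = "\<lambda>z. u z * (c0 + c1 * \<phi> z)"
  have f1: "(?f has_field_derivative \<theta> z * ?f z + c1 * (u z * w z)) (at z)" if "z \<in> W" for z
    by (rule derivative_eq_intros u_deriv[OF that] \<phi>_deriv[OF that] refl)+ (simp add: algebra_simps)
  fix z assume z: "z \<in> W"
  have "((\<lambda>z. \<theta> z * ?f z + c1 * (u z * w z)) has_field_derivative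
      \<theta>' z * ?f z + \<theta> z * (\<theta> z * ?f z + c1 * (u z * w z))
      + c1 * ((\<theta> z + \<eta> z) * (u z * w z))) (at z)"
    by (rule derivative_eq_intros \<theta>_deriv[OF z] f1[OF z] u_deriv[OF z] w_deriv[OF z] refl)+
      (simp add: algebra_simps)
  then have "(deriv ?f has_field_derivative
      \<theta>' z * ?f z + \<theta> z * (\<theta> z * ?f z + c1 * (u z * w z))
      + c1 * ((\<theta> z + \<eta> z) * (u z * w z))) (at z)"
    by (rule has_field_derivative_transform_within_open[OF _ open_W z])
      (simp add: DERIV_imp_deriv[OF f1])
  then show "deriv (deriv ?f) z + - (2 * \<theta> z + \<eta> z) * deriv ?f z
      + (\<theta> z * (\<theta> z + \<eta> z) - \<theta>' z) * ?f z = 0"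
    unfolding DERIV_imp_deriv[OF f1[OF z]] by (simp add: DERIV_imp_deriv algebra_simps)
qed

lemma solves_imp_first_order:
  assumes f: "f holomorphic_on W" and ode: "solves f" and z: "z \<in> W"
  defines "g \<equiv> \<lambda>z. deriv f z - \<theta> z * f z"
  shows "(g has_field_derivative (\<theta> z + \<eta> z) * g z) (at z)"
proof -
  have f': "(f has_field_derivative deriv f z) (at z)"
    "(deriv f has_field_derivative deriv (deriv f) z) (at z)"
    using f open_W z by (auto intro!: holomorphic_derivI holomorphic_deriv)
  have "deriv (deriv f) z - (\<theta> z * deriv f z + \<theta>' z * f z) = (\<theta> z + \<eta> z) * g z
      + (deriv (deriv f) z + - (2 * \<theta> z + \<eta> z) * deriv f z + (\<theta> z * (\<theta> z + \<eta> z) - \<theta>' z) * f z)"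
    by (simp add: g_def algebra_simps)
  also have "\<dots> = (\<theta> z + \<eta> z) * g z"
    unfolding bspec[OF ode[unfolded solves_def] z] by simp
  finally show ?thesis
    using DERIV_diff[OF f'(2) DERIV_mult'[OF \<theta>_deriv[OF z] f'(1)]] by (simp only: g_def)
qed

lemma solves_imp_linear_combination:
  assumes W: "connected W" and f: "f holomorphic_on W" and ode: "solves f"
  obtains c0 c1 where "\<forall>z\<in>W. f z = u z * (c0 + c1 * \<phi> z)"
proof -
  define g where "g z = deriv f z - \<theta> z * f z" for z
  have g: "(g has_field_derivative (\<theta> z + \<eta> z) * g z) (at z)" if "z \<in> W" for z
    using solves_imp_first_order[OF f ode that] by (simp only: g_def[abs_def])
  have "((\<lambda>z. g z / (u z * w z)) has_field_derivative 0) (at z)" if z: "z \<in> W" for z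
  proof -
    have "((\<lambda>z. u z * w z) has_field_derivative (\<theta> z + \<eta> z) * (u z * w z)) (at z)"
      by (rule derivative_eq_intros u_deriv[OF z] w_deriv[OF z] refl)+ (simp add: algebra_simps)
    from DERIV_divide[OF g[OF z] this] nonzero[OF z] show ?thesis by (simp add: mult_ac)
  qed
  then obtain c1 where c1: "\<forall>z\<in>W. g z / (u z * w z) = c1"
    by (rule DERIV_zero_constant_on_connected[OF open_W W])
  have "((\<lambda>z. f z / u z - c1 * \<phi> z) has_field_derivative 0) (at z)" if z: "z \<in> W" for z
  proof -
    have "deriv f z - \<theta> z * f z = c1 * (u z * w z)"
      using c1 nonzero[OF z] z by (auto simp: g_def field_simps)
    then have zero: "(deriv f z * u z - f z * (\<theta> z * u z)) / (u z * u z) - c1 * w z = 0"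
      using nonzero[OF z] by (simp add: field_simps)
    have "(f has_field_derivative deriv f z) (at z)"
      using f open_W z by (rule holomorphic_derivI)
    then show ?thesis
      unfolding zero[symmetric]
      by (intro DERIV_diff DERIV_divide DERIV_cmult u_deriv \<phi>_deriv nonzero(1) z)
  qed
  then obtain c0 where "\<forall>z\<in>W. f z / u z - c1 * \<phi> z = c0"
    by (rule DERIV_zero_constant_on_connected[OF open_W W])
  then have "\<forall>z\<in>W. f z = u z * (c0 + c1 * \<phi> z)"
    using nonzero(1) by (auto simp: field_simps)
  then show thesis by (rule that)
qed

end

section \<open>Change of basis\<close>

lemma deriv_linear_combination:
  assumes W: "open W" "z \<in> W" and "f holomorphic_on W" "g holomorphic_on W"
  shows "deriv (\<lambda>z. k * f z + l * g z) z = k * deriv f z + l * deriv g z"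
    and "deriv (deriv (\<lambda>z. k * f z + l * g z)) z = k * deriv (deriv f) z + l * deriv (deriv g) z"
proof -
  have f: "(f has_field_derivative deriv f z) (at z)"
    "(deriv f has_field_derivative deriv (deriv f) z) (at z)"
    and g: "(g has_field_derivative deriv g z) (at z)"
      "(deriv g has_field_derivative deriv (deriv g) z) (at z)"
    if "z \<in> W" for z
    using that assms by (auto intro!: holomorphic_derivI holomorphic_deriv)
  have first: "deriv (\<lambda>z. k * f z + l * g z) z = k * deriv f z + l * deriv g z" if "z \<in> W" for z
    by (intro DERIV_imp_deriv DERIV_add DERIV_cmult f(1) g(1) that)
  then show "deriv (\<lambda>z. k * f z + l * g z) z = k * deriv f z + l * deriv g z"
    using W(2) .
  have "((\<lambda>z. k * deriv f z + l * deriv g z) has_field_derivative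
      k * deriv (deriv f) z + l * deriv (deriv g) z) (at z)"
    by (intro DERIV_add DERIV_cmult f(2) g(2) W(2))
  then have "(deriv (\<lambda>z. k * f z + l * g z) has_field_derivative
      k * deriv (deriv f) z + l * deriv (deriv g) z) (at z)"
    by (rule has_field_derivative_transform_within_open[OF _ W]) (simp add: first)
  then show "deriv (deriv (\<lambda>z. k * f z + l * g z)) z =
      k * deriv (deriv f) z + l * deriv (deriv g) z"
    by (rule DERIV_imp_deriv)
qed

lemma local_solution_linear_combination:
  assumes "local_solution b1 b2 p y" "local_solution b1 b2 p y'"
  shows "local_solution b1 b2 p (\<lambda>x. k * y x + k' * y' x)"
proof -
  obtain U where U: "open U" "p \<in> U" "cp1_holomorphic_on y U"
    and ode: "\<And>z. CFin z \<in> U \<Longrightarrow> deriv (deriv (\<lambda>z. y (CFin z))) z + b1 z * deriv (\<lambda>z. y (CFin z)) z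
        + b2 z * y (CFin z) = 0"
    using assms(1) unfolding local_solution_def Let_def by blast
  obtain V where V: "open V" "p \<in> V" "cp1_holomorphic_on y' V"
    and ode': "\<And>z. CFin z \<in> V \<Longrightarrow> deriv (deriv (\<lambda>z. y' (CFin z))) z + b1 z * deriv (\<lambda>z. y' (CFin z)) z
        + b2 z * y' (CFin z) = 0"
    using assms(2) unfolding local_solution_def Let_def by blast
  define f f' W where "f z = y (CFin z)" and "f' z = y' (CFin z)" and "W = CFin -` (U \<inter> V)" for z
  have W: "open W" using U(1) V(1) by (simp add: W_def vimage_Int open_Int open_cp1_def)
  have hol: "cp1_holomorphic_on y (U \<inter> V)" "cp1_holomorphic_on y' (U \<inter> V)"
    using U(3) V(3) by (auto elim: cp1_holomorphic_on_subset)
  have "f holomorphic_on W" "f' holomorphic_on W"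
    using hol by (simp_all add: cp1_holomorphic_on_def f_def[abs_def] f'_def[abs_def] W_def)
  note deriv = deriv_linear_combination[OF W _ this]
  have "deriv (deriv (\<lambda>z. k * f z + k' * f' z)) z + b1 z * deriv (\<lambda>z. k * f z + k' * f' z) z
      + b2 z * (k * f z + k' * f' z) = 0" if z: "z \<in> W" for z
  proof -
    have "deriv (deriv (\<lambda>z. k * f z + k' * f' z)) z + b1 z * deriv (\<lambda>z. k * f z + k' * f' z) z
        + b2 z * (k * f z + k' * f' z) = k * (deriv (deriv f) z + b1 z * deriv f z + b2 z * f z)
        + k' * (deriv (deriv f') z + b1 z * deriv f' z + b2 z * f' z)"
      unfolding deriv[OF z] by (simp add: algebra_simps)
    then show ?thesis
      using ode[of z] ode'[of z] z by (simp add: W_def f_def[abs_def] f'_def[abs_def])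
  qed
  moreover have "cp1_holomorphic_on (\<lambda>x. k * y x + k' * y' x) (U \<inter> V)"
    using hol unfolding cp1_holomorphic_on_def by (auto intro!: holomorphic_intros)
  ultimately show ?thesis
    using U V unfolding local_solution_def Let_def
    by (intro exI[of _ "U \<inter> V"]) (simp add: W_def f_def f'_def open_Int)
qed

lemma vector_matrix_mult_2:
  fixes y :: "complex^2" and R :: "complex^2^2"
  shows "(y v* R) $ j = R $ 1 $ j * y $ 1 + R $ 2 $ j * y $ 2"
  by (simp add: vector_matrix_mult_def sum_2 mult.commute)

lemma sum_vector_matrix_mult:
  fixes y :: "complex^2" and R :: "complex^2^2"
  shows "(\<Sum>j\<in>UNIV. c $ j * (y v* R) $ j) = (\<Sum>j\<in>UNIV. (R *v c) $ j * y $ j)"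
  by (simp add: vector_matrix_mult_2 matrix_vector_mult_def sum_2 algebra_simps)

lemma solution_basis_vector_matrix_mult:
  assumes Y: "solution_basis b1 b2 p Y" and R: "invertible R"
  shows "solution_basis b1 b2 p (\<lambda>x. Y x v* R)"
  unfolding solution_basis_def
proof (intro conjI allI impI)
  obtain R' where R': "R ** R' = mat 1" "R' ** R = mat 1" using R unfolding invertible_def by blast
  show "local_solution b1 b2 p (\<lambda>x. (Y x v* R) $ j)" for j
    using Y unfolding solution_basis_def vector_matrix_mult_2
    by (intro local_solution_linear_combination) blast+
  show "c = 0" if "\<forall>\<^sub>F x in nhds p. (\<Sum>j\<in>UNIV. c $ j * (Y x v* R) $ j) = 0" for c
  proof -
    have "R *v c = 0"
      using Y that unfolding solution_basis_def sum_vector_matrix_mult by blast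
    then have "R' *v (R *v c) = 0" by simp
    then show ?thesis by (simp add: matrix_vector_mul_assoc R')
  qed
  fix y assume "local_solution b1 b2 p y"
  then obtain c where "\<forall>\<^sub>F x in nhds p. y x = (\<Sum>j\<in>UNIV. c $ j * Y x $ j)"
    using Y unfolding solution_basis_def by blast
  moreover have "c = R *v (R' *v c)" by (simp add: matrix_vector_mul_assoc R')
  ultimately show "\<exists>c. \<forall>\<^sub>F x in nhds p. y x = (\<Sum>j\<in>UNIV. c $ j * (Y x v* R) $ j)"
    unfolding sum_vector_matrix_mult by metis
qed

lemma continuation_along_vector_matrix_mult:
  assumes "continuation_along g Y Y'"
  shows "continuation_along g (\<lambda>x. Y x v* R) (\<lambda>x. Y' x v* R)"
proof -
  from assms obtain F :: "real \<Rightarrow> cp1 \<Rightarrow> complex^2"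
    where start: "\<forall>\<^sub>F x in nhds (pathstart g). F 0 x = Y x"
      and finish: "\<forall>\<^sub>F x in nhds (pathfinish g). F 1 x = Y' x"
      and germ: "\<forall>t\<in>{0..1}. \<exists>U. open U \<and> g t \<in> U \<and> (\<forall>j. cp1_holomorphic_on (\<lambda>x. F t x $ j) U) \<and>
        (\<exists>e>0. \<forall>s\<in>{0..1}. \<bar>s - t\<bar> < e \<longrightarrow> g s \<in> U \<and> (\<forall>\<^sub>F x in nhds (g s). F s x = F t x))"
    unfolding continuation_along_def by (elim exE conjE) (rule that)
  show ?thesis
    unfolding continuation_along_def
  proof (intro exI[of _ "\<lambda>t x. F t x v* R"] conjI ballI)
    show "\<forall>\<^sub>F x in nhds (pathstart g). F 0 x v* R = Y x v* R"
      using start by eventually_elim simp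
    show "\<forall>\<^sub>F x in nhds (pathfinish g). F 1 x v* R = Y' x v* R"
      using finish by eventually_elim simp
    fix t :: real assume "t \<in> {0..1}"
    from bspec[OF germ this] obtain U e where U: "open U" "g t \<in> U"
      "\<forall>j. cp1_holomorphic_on (\<lambda>x. F t x $ j) U"
      and e: "e > 0" "\<forall>s\<in>{0..1}. \<bar>s - t\<bar> < e \<longrightarrow> g s \<in> U \<and> (\<forall>\<^sub>F x in nhds (g s). F s x = F t x)"
      by (elim exE conjE) (rule that)
    have "cp1_holomorphic_on (\<lambda>x. (F t x v* R) $ j) U" for j
      using spec[OF U(3)] unfolding vector_matrix_mult_2 cp1_holomorphic_on_def
      by (auto intro!: holomorphic_intros)
    moreover have "g s \<in> U \<and> (\<forall>\<^sub>F x in nhds (g s). F s x v* R = F t x v* R)"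
      if s: "s \<in> {0..1}" "\<bar>s - t\<bar> < e" for s
    proof -
      have "g s \<in> U" and "\<forall>\<^sub>F x in nhds (g s). F s x = F t x" using e(2) s by auto
      then show ?thesis by (auto elim: eventually_mono)
    qed
    ultimately show "\<exists>U. open U \<and> g t \<in> U \<and> (\<forall>j. cp1_holomorphic_on (\<lambda>x. (F t x v* R) $ j) U) \<and>
        (\<exists>e>0. \<forall>s\<in>{0..1}. \<bar>s - t\<bar> < e \<longrightarrow> g s \<in> U \<and> (\<forall>\<^sub>F x in nhds (g s). F s x v* R = F t x v* R))"
      using U(1,2) e(1) by blast
  qed
qed

theorem realizes_conjugate:
  assumes \<sigma>: "realizes D p b1 b2 \<sigma>" and R: "invertible R"
    and conj: "\<And>g. g \<in> loops (- D) p \<Longrightarrow> R ** \<rho> (loop_class (- D) g) = \<sigma> (loop_class (- D) g) ** R"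
  shows "realizes D p b1 b2 \<rho>"
proof -
  obtain Y where Y: "solution_basis b1 b2 p Y"
    and mono: "\<And>g. g \<in> loops (- D) p \<Longrightarrow> monodromy_matrix Y g (\<sigma> (loop_class (- D) g))"
    using \<sigma> unfolding realizes_def by blast
  have "monodromy_matrix (\<lambda>x. Y x v* R) g (\<rho> (loop_class (- D) g))" if g: "g \<in> loops (- D) p" for g
  proof -
    let ?c = "loop_class (- D) g"
    obtain Y' where Y': "continuation_along g Y Y'"
      "\<forall>\<^sub>F x in nhds (pathfinish g). Y x = Y' x v* \<sigma> ?c"
      using mono[OF g] unfolding monodromy_matrix_def by blast
    from Y'(2) have "\<forall>\<^sub>F x in nhds (pathfinish g). Y x v* R = (Y' x v* R) v* \<rho> ?c"
      by eventually_elim (simp add: vector_matrix_mul_assoc conj[OF g])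
    then show ?thesis
      using continuation_along_vector_matrix_mult[OF Y'(1)] unfolding monodromy_matrix_def by blast
  qed
  then show ?thesis
    using solution_basis_vector_matrix_mult[OF Y R] unfolding realizes_def by blast
qed

section \<open>Solutions and their continuation\<close>

locale riemann_data = three_points a1 a2 a3 + branched_primitive \<beta>0 \<beta>1
  for a1 a2 a3 :: cp1 and \<beta>0 \<beta>1 :: complex +
  fixes \<alpha>0 \<alpha>1 :: complex
begin

definition amplitude_residue :: "cp1 \<Rightarrow> complex" where
  "amplitude_residue a = (if a = a1 then \<alpha>0 else if a = a2 then \<alpha>1 else - \<alpha>0 - \<alpha>1)"

definition prim_residue :: "cp1 \<Rightarrow> complex" where
  "prim_residue a = (if a = a1 then \<beta>0 else if a = a2 then \<beta>1 else - 2 - \<beta>0 - \<beta>1)"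

abbreviation \<theta> :: "complex \<Rightarrow> complex" where
  "\<theta> \<equiv> log_form D amplitude_residue"

abbreviation \<eta> :: "complex \<Rightarrow> complex" where
  "\<eta> \<equiv> log_form D prim_residue"

abbreviation b1 :: "complex \<Rightarrow> complex" where
  "b1 \<equiv> coeff1 D amplitude_residue prim_residue"

abbreviation b2 :: "complex \<Rightarrow> complex" where
  "b2 \<equiv> coeff2 D amplitude_residue prim_residue"

lemma riemann_equation_b1_b2: "riemann_equation D b1 b2"
  using distinct by (intro riemann_equation_log_form)
    (auto simp: amplitude_residue_def prim_residue_def)

definition cross_ratio_deriv :: "complex \<Rightarrow> complex" where
  "cross_ratio_deriv z = cross_ratio (CFin z) * (simple_pole a1 z - simple_pole a3 z)"

lemma quotient_has_field_derivative:
  assumes "CFin z \<noteq> a" "CFin z \<noteq> b"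
  shows "((\<lambda>z. k * (hden a * z - hnum a) / (hden b * z - hnum b)) has_field_derivative
    k * (hden a * z - hnum a) / (hden b * z - hnum b) * (simple_pole a z - simple_pole b z)) (at z)"
proof -
  define p q where "p = hden a * z - hnum a" and "q = hden b * z - hnum b"
  have nz: "p \<noteq> 0" "q \<noteq> 0"
    using assms denominator_nonzero unfolding p_def q_def by auto
  have "((\<lambda>z. k * (hden a * z - hnum a)) has_field_derivative k * hden a) (at z)"
    "((\<lambda>z. hden b * z - hnum b) has_field_derivative hden b) (at z)"
    by (auto intro!: derivative_eq_intros)
  from DERIV_divide[OF this nz(2)[unfolded q_def]]
  have "((\<lambda>z. k * (hden a * z - hnum a) / (hden b * z - hnum b)) has_field_derivative
      (k * hden a * q - k * p * hden b) / (q * q)) (at z)"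
    by (simp only: p_def q_def)
  moreover have "(k * hden a * q - k * p * hden b) / (q * q)
      = k * p / q * (hden a / p - hden b / q)"
    using nz by (simp add: field_simps)
  ultimately show ?thesis by (simp only: p_def q_def simple_pole_def)
qed

lemma cross_ratio_has_field_derivative:
  assumes "CFin z \<notin> D"
  shows "((\<lambda>z. cross_ratio (CFin z)) has_field_derivative cross_ratio_deriv z) (at z)"
  using assms quotient_has_field_derivative[of z a1 a3 ratio_scale]
  by (simp add: cross_ratio_CFin cross_ratio_deriv_def)

lemma cross_ratio_deriv_eq:
  assumes z: "CFin z \<notin> D"
  shows "cross_ratio_deriv z = (cross_ratio (CFin z) - 1) * (simple_pole a2 z - simple_pole a3 z)"
proof -
  define k where "k = - ratio_scale * lin_form a1 a3 / lin_form a3 a2"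
  have eq: "cross_ratio (CFin z) - 1 = k * (hden a2 * z - hnum a2) / (hden a3 * z - hnum a3)"
    if "CFin z \<noteq> a3" for z
  proof -
    have "cross_ratio (CFin z) - 1 = k * lin_form a2 (CFin z) / lin_form a3 (CFin z)"
      using cross_ratio_diff[OF that, of a2] distinct
      by (simp add: cross_ratio_a2 k_def lin_form_swap[of "CFin z" a2])
    then show ?thesis by (simp only: lin_form_CFin)
  qed
  have "((\<lambda>z. cross_ratio (CFin z) - 1) has_field_derivative
      (cross_ratio (CFin z) - 1) * (simple_pole a2 z - simple_pole a3 z)) (at z)"
  proof (rule has_field_derivative_transform_within_open)
    show "((\<lambda>z. k * (hden a2 * z - hnum a2) / (hden a3 * z - hnum a3)) has_field_derivative
        (cross_ratio (CFin z) - 1) * (simple_pole a2 z - simple_pole a3 z)) (at z)"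
      using z quotient_has_field_derivative[of z a2 a3 k] eq[of z] by simp
    show "open (CFin -` (- D))" "z \<in> CFin -` (- D)"
      using open_Compl_D z by (auto simp: open_cp1_def)
  qed (simp add: eq)
  moreover have "((\<lambda>z. cross_ratio (CFin z) - 1) has_field_derivative cross_ratio_deriv z) (at z)"
    using cross_ratio_has_field_derivative[OF z] by (auto intro!: derivative_eq_intros)
  ultimately show ?thesis by (rule DERIV_unique[rotated])
qed

lemma cross_ratio_deriv_has_field_derivative:
  assumes z: "CFin z \<notin> D"
  shows "(cross_ratio_deriv has_field_derivative
    - 2 * simple_pole a3 z * cross_ratio_deriv z) (at z)"
proof -
  have "((\<lambda>z. cross_ratio (CFin z) * (simple_pole a1 z - simple_pole a3 z)) has_field_derivative
      cross_ratio (CFin z) * (- (simple_pole a1 z)\<^sup>2 - - (simple_pole a3 z)\<^sup>2)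
      + cross_ratio_deriv z * (simple_pole a1 z - simple_pole a3 z)) (at z)"
    using z
    by (intro DERIV_mult' DERIV_diff cross_ratio_has_field_derivative simple_pole_has_field_derivative)
      auto
  moreover have "cross_ratio (CFin z) * (- (simple_pole a1 z)\<^sup>2 - - (simple_pole a3 z)\<^sup>2)
      + cross_ratio_deriv z * (simple_pole a1 z - simple_pole a3 z) =
      - 2 * simple_pole a3 z * cross_ratio_deriv z"
    by (simp add: cross_ratio_deriv_def algebra_simps power2_eq_square)
  ultimately show ?thesis by (simp add: cross_ratio_deriv_def[abs_def])
qed

lemma cross_ratio_deriv_nonzero:
  assumes z: "CFin z \<notin> D"
  shows "cross_ratio_deriv z \<noteq> 0"
proof -
  have nz: "hden a1 * z - hnum a1 \<noteq> 0" "hden a3 * z - hnum a3 \<noteq> 0"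
    using z denominator_nonzero by auto
  have "simple_pole a1 z - simple_pole a3 z =
      - lin_form a1 a3 / ((hden a1 * z - hnum a1) * (hden a3 * z - hnum a3))"
    using nz by (simp add: simple_pole_def lin_form_def field_simps)
  moreover have "cross_ratio (CFin z) \<noteq> 0" using cross_ratio_in[of "CFin z"] z by auto
  ultimately show ?thesis
    using nz distinct by (simp add: cross_ratio_deriv_def lin_form_eq_0_iff)
qed

definition amplitude :: "branch_value \<Rightarrow> complex" where
  "amplitude v = exp (\<alpha>0 * log0 v + \<alpha>1 * log1 v)"

definition pullback :: "complex set \<Rightarrow> cp1 set" where
  "pullback U = - D \<inter> cross_ratio -` U"

lemma open_pullback: "open U \<Longrightarrow> open (pullback U)"
  using cross_ratio_continuous open_Compl_D unfolding pullback_def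
  by (intro continuous_open_preimage)

lemma eventually_nhds_pullback:
  assumes "x \<in> - D" "\<forall>\<^sub>F t in nhds (cross_ratio x). P t"
  shows "\<forall>\<^sub>F y in nhds x. P (cross_ratio y)"
proof -
  obtain V where "open V" "cross_ratio x \<in> V" "\<And>t. t \<in> V \<Longrightarrow> P t"
    using assms(2) unfolding eventually_nhds by blast
  then show ?thesis
    using assms(1) open_pullback[of V] unfolding eventually_nhds
    by (intro exI[of _ "pullback V"]) (auto simp: pullback_def)
qed

lemma reducible_ode_branch:
  assumes b: "branch U \<Psi>" and W: "open W" "W \<subseteq> CFin -` pullback U"
  shows "reducible_ode W \<theta> (log_form_deriv D amplitude_residue) \<eta>
    (\<lambda>z. amplitude (\<Psi> (cross_ratio (CFin z)))) (\<lambda>z. prim (\<Psi> (cross_ratio (CFin z))))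
    (\<lambda>z. integrand (\<Psi> (cross_ratio (CFin z))) * cross_ratio_deriv z)"
proof
  fix z assume "z \<in> W"
  then have z: "CFin z \<notin> D" "cross_ratio (CFin z) \<in> U" using W(2) by (auto simp: pullback_def)
  then have t: "cross_ratio (CFin z) \<noteq> 0" "cross_ratio (CFin z) - 1 \<noteq> 0"
    using cross_ratio_in[of "CFin z"] by auto
  note chain = DERIV_chain2[OF _ cross_ratio_has_field_derivative[OF z(1)]]
  have L0: "((\<lambda>z. log0 (\<Psi> (cross_ratio (CFin z)))) has_field_derivative
      simple_pole a1 z - simple_pole a3 z) (at z)"
    using chain[OF branchD(4)[OF b z(2)]] t(1) by (simp add: cross_ratio_deriv_def)
  have L1: "((\<lambda>z. log1 (\<Psi> (cross_ratio (CFin z)))) has_field_derivative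
      simple_pole a2 z - simple_pole a3 z) (at z)"
    using chain[OF branchD(5)[OF b z(2)]] t(2) by (simp add: cross_ratio_deriv_eq[OF z(1)])
  show "(\<theta> has_field_derivative log_form_deriv D amplitude_residue z) (at z)"
    using z(1) by (rule log_form_has_field_derivative)
  show "((\<lambda>z. amplitude (\<Psi> (cross_ratio (CFin z)))) has_field_derivative
      \<theta> z * amplitude (\<Psi> (cross_ratio (CFin z)))) (at z)"
    unfolding amplitude_def using distinct
    by (auto intro!: derivative_eq_intros L0 L1 simp: log_form_def amplitude_residue_def
      algebra_simps)
  show "((\<lambda>z. prim (\<Psi> (cross_ratio (CFin z)))) has_field_derivative
      integrand (\<Psi> (cross_ratio (CFin z))) * cross_ratio_deriv z) (at z)"
    using chain[OF branchD(6)[OF b z(2)]] .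
  show "((\<lambda>z. integrand (\<Psi> (cross_ratio (CFin z))) * cross_ratio_deriv z)
      has_field_derivative \<eta> z *
        (integrand (\<Psi> (cross_ratio (CFin z))) * cross_ratio_deriv z)) (at z)"
    using distinct
    by (auto intro!: derivative_eq_intros L0 L1 cross_ratio_deriv_has_field_derivative[OF z(1)]
        simp: log_form_def prim_residue_def algebra_simps)
  show "amplitude (\<Psi> (cross_ratio (CFin z))) \<noteq> 0" by (simp add: amplitude_def)
  show "integrand (\<Psi> (cross_ratio (CFin z))) * cross_ratio_deriv z \<noteq> 0"
    using cross_ratio_deriv_nonzero[OF z(1)] by simp
qed (fact W(1))

definition solution :: "branch_value \<Rightarrow> complex \<Rightarrow> complex \<Rightarrow> complex" where
  "solution v c0 c1 = amplitude v * (c0 + c1 * prim v)"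

lemma solution_holomorphic:
  assumes "branch U \<Psi>"
  shows "cp1_holomorphic_on (\<lambda>x. solution (\<Psi> (cross_ratio x)) c0 c1) (pullback U)"
proof (rule cp1_holomorphic_on_compose[of cross_ratio _ "\<lambda>t. solution (\<Psi> t) c0 c1" U])
  show "cp1_holomorphic_on cross_ratio (pullback U)"
    using cross_ratio_holomorphic cp1_holomorphic_on_subset by (auto simp: pullback_def)
  show "(\<lambda>t. solution (\<Psi> t) c0 c1) holomorphic_on U"
    unfolding solution_def amplitude_def by (intro holomorphic_intros branch_holomorphic[OF assms])
qed (auto simp: pullback_def)

lemma local_solution_branch:
  assumes b: "branch U \<Psi>" and p: "p \<in> pullback U"
  shows "local_solution b1 b2 p (\<lambda>x. solution (\<Psi> (cross_ratio x)) c0 c1)"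
proof -
  have U: "open (pullback U)" using open_pullback branchD(1)[OF b] .
  then have "open (CFin -` pullback U)" by (simp add: open_cp1_def)
  from reducible_ode.solves_linear_combination[OF reducible_ode_branch[OF b this order_refl],
    of c0 c1]
  show ?thesis
    unfolding reducible_ode.solves_def[
      OF reducible_ode_branch[OF b \<open>open (CFin -` pullback U)\<close> order_refl]]
      local_solution_def Let_def
    using U p solution_holomorphic[OF b]
    by (intro exI[of _ "pullback U"]) (simp add: coeff1_def coeff2_def solution_def)
qed

lemma local_solution_imp_branch:
  assumes b: "branch U \<Psi>" and p: "p \<in> pullback U" and y: "local_solution b1 b2 p y"
  obtains c0 c1 where "\<forall>\<^sub>F x in nhds p. y x = solution (\<Psi> (cross_ratio x)) c0 c1"
proof -
  obtain V where V: "open V" "p \<in> V" "cp1_holomorphic_on y V"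
    and ode: "\<And>z. CFin z \<in> V \<Longrightarrow> deriv (deriv (\<lambda>z. y (CFin z))) z + b1 z * deriv (\<lambda>z. y (CFin z)) z
        + b2 z * y (CFin z) = 0"
    using y unfolding local_solution_def Let_def by blast
  obtain N where N: "open N" "p \<in> N" "N \<subseteq> V \<inter> pullback U" "connected (CFin -` N)"
    using cp1_connected_neighbourhood[of "V \<inter> pullback U" p] V p open_pullback[OF branchD(1)[OF b]]
    by auto
  have hol: "cp1_holomorphic_on y N" "cp1_holomorphic_on (\<lambda>x. solution (\<Psi> (cross_ratio x)) c0 c1) N"
    for c0 c1
    using cp1_holomorphic_on_subset[OF V(3)]
      cp1_holomorphic_on_subset[OF solution_holomorphic[OF b]] N(3) by auto
  have "open (CFin -` N)" "CFin -` N \<subseteq> CFin -` pullback U"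
    using N(1,3) by (auto simp: open_cp1_def)
  note red = reducible_ode_branch[OF b this]
  have "reducible_ode.solves (CFin -` N) \<theta> (log_form_deriv D amplitude_residue) \<eta> (\<lambda>z. y (CFin z))"
    unfolding reducible_ode.solves_def[OF red] using ode N(3) by (auto simp: coeff1_def coeff2_def)
  moreover have "(\<lambda>z. y (CFin z)) holomorphic_on CFin -` N"
    using hol(1) by (simp add: cp1_holomorphic_on_def)
  ultimately obtain c0 c1 where "\<forall>z\<in>CFin -` N. y (CFin z) =
      amplitude (\<Psi> (cross_ratio (CFin z))) * (c0 + c1 * prim (\<Psi> (cross_ratio (CFin z))))"
    using reducible_ode.solves_imp_linear_combination[OF red N(4)] by blast
  then have "y x = solution (\<Psi> (cross_ratio x)) c0 c1" if "x \<in> N" for x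
    using cp1_holomorphic_on_eqI[OF hol N(1) _ that, of c0 c1] by (simp add: solution_def)
  then show thesis
    using N(1,2) by (intro that[of c0 c1]) (auto simp: eventually_nhds)
qed

definition solution_row :: "branch_value \<Rightarrow> complex^2" where
  "solution_row v = (\<chi> j. if j = 1 then solution v 1 0 else solution v 0 1)"

lemma sum_solution_row: "(\<Sum>j\<in>UNIV. c $ j * solution_row v $ j) = solution v (c $ 1) (c $ 2)"
  by (simp add: solution_row_def solution_def sum_2 algebra_simps)

lemma solution_basis_branch:
  assumes b: "branch U \<Psi>" and p: "p \<in> pullback U"
  shows "solution_basis b1 b2 p (\<lambda>x. solution_row (\<Psi> (cross_ratio x)))"
  unfolding solution_basis_def sum_solution_row
proof (intro conjI allI impI)
  show "local_solution b1 b2 p (\<lambda>x. solution_row (\<Psi> (cross_ratio x)) $ j)" for j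
    using local_solution_branch[OF b p, of 1 0] local_solution_branch[OF b p, of 0 1]
    by (cases "j = 1") (simp_all add: solution_row_def)
next
  fix c :: "complex^2"
  assume "\<forall>\<^sub>F x in nhds p. solution (\<Psi> (cross_ratio x)) (c $ 1) (c $ 2) = 0"
  then obtain N where N: "open N" "p \<in> N"
    "\<And>x. x \<in> N \<Longrightarrow> solution (\<Psi> (cross_ratio x)) (c $ 1) (c $ 2) = 0"
    unfolding eventually_nhds by blast
  let ?t = "cross_ratio p" and ?V = "cross_ratio_inv -` N \<inter> U"
  have V: "open ?V"
    using continuous_on_cross_ratio_inv N(1) branchD(1)[OF b] by (auto intro: open_vimage)
  have t: "?t \<in> ?V" using p N(2) cross_ratio_inv_cross_ratio[of p] by (auto simp: pullback_def)
  have z: "c $ 1 + c $ 2 * prim (\<Psi> t) = 0" if "t \<in> ?V" for t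
    using N(3)[of "cross_ratio_inv t"] that
    by (simp add: cross_ratio_cross_ratio_inv solution_def amplitude_def)
  let ?e = "integrand (\<Psi> ?t)"
  have "((\<lambda>t. c $ 1 + c $ 2 * prim (\<Psi> t)) has_field_derivative c $ 2 * ?e) (at ?t)"
    using branchD(6)[OF b, of ?t] t by (auto intro!: derivative_eq_intros)
  moreover have "((\<lambda>t. c $ 1 + c $ 2 * prim (\<Psi> t)) has_field_derivative 0) (at ?t)"
    by (rule has_field_derivative_transform_within_open[OF DERIV_const[of 0] V t]) (simp add: z)
  ultimately have "c $ 2 * ?e = 0" by (rule DERIV_unique)
  then have "c $ 2 = 0" by simp
  moreover from this have "c $ 1 = 0" using z[OF t] by simp
  ultimately show "c = 0" by (simp add: vec_eq_iff forall_2)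
next
  fix y assume "local_solution b1 b2 p y"
  from local_solution_imp_branch[OF b p this] obtain c0 c1
    where "\<forall>\<^sub>F x in nhds p. y x = solution (\<Psi> (cross_ratio x)) c0 c1" .
  then show "\<exists>c::complex^2. \<forall>\<^sub>F x in nhds p. y x = solution (\<Psi> (cross_ratio x)) (c $ 1) (c $ 2)"
    by (intro exI[of _ "\<chi> j. if j = 1 then c0 else c1"]) simp
qed

end

section \<open>Two-dimensional representations\<close>

lemma group_GL: "group (GL :: ('a::field^'n^'n) monoid)"
proof (rule groupI)
  fix x :: "'a^'n^'n" assume "x \<in> carrier GL"
  then obtain y where "x ** y = mat 1" "y ** x = mat 1" by (auto simp: GL_def invertible_def)
  then show "\<exists>y\<in>carrier GL. y \<otimes>\<^bsub>GL\<^esub> x = \<one>\<^bsub>GL\<^esub>"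
    by (intro bexI[of _ y]) (auto simp: GL_def invertible_def)
next
  show "\<one>\<^bsub>GL\<^esub> \<in> carrier GL" by (auto simp: GL_def invertible_def)
qed (auto simp: GL_def invertible_mult matrix_mul_assoc)

locale linear_representation = group G
  for G :: "('g, 'b) monoid_scheme" (structure) +
  fixes \<rho> :: "'g \<Rightarrow> 'a::field^'n^'n"
  assumes hom: "\<rho> \<in> hom G GL"
begin

lemma mult: "x \<in> carrier G \<Longrightarrow> y \<in> carrier G \<Longrightarrow> \<rho> (x \<otimes> y) = \<rho> x ** \<rho> y"
  using hom_mult[OF hom] by (simp add: GL_def)

lemma one: "\<rho> \<one> = mat 1"
  using hom_one[OF hom is_group group_GL] by (simp add: GL_def)

lemma right_inverse: "x \<in> carrier G \<Longrightarrow> \<rho> x ** \<rho> (inv x) = mat 1"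
  and left_inverse: "x \<in> carrier G \<Longrightarrow> \<rho> (inv x) ** \<rho> x = mat 1"
  using mult[of x "inv x"] mult[of "inv x" x] one by simp_all

end

definition preserves_line :: "'a::field^'n^'n \<Rightarrow> 'a^'n \<Rightarrow> bool" where
  "preserves_line A v \<longleftrightarrow> (\<exists>k. A *v v = k *s v)"

lemma preserves_line_mult: "preserves_line A v \<Longrightarrow> preserves_line B v \<Longrightarrow> preserves_line (A ** B) v"
  unfolding preserves_line_def
  by (metis matrix_vector_mul_assoc vector_scalar_commute vector_smult_assoc)

lemma preserves_line_left_inverse:
  assumes "preserves_line A v" "B ** A = mat 1"
  shows "preserves_line B v"
proof -
  obtain k where "A *v v = k *s v" using assms(1) unfolding preserves_line_def by blast
  then have v: "v = k *s (B *v v)"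
    using assms(2) by (metis matrix_vector_mul_assoc matrix_vector_mul_lid vector_scalar_commute)
  then have "B *v v = inverse k *s v" if "k \<noteq> 0"
    using that by (metis left_inverse vector_smult_assoc vector_smult_lid)
  moreover have "v = 0" if "k = 0" using v that by simp
  ultimately show ?thesis unfolding preserves_line_def by (cases "k = 0") auto
qed

lemma preserves_line_conjugate:
  assumes "S ** T = mat 1" "T ** S = mat 1"
  shows "preserves_line (T ** A ** S) v \<longleftrightarrow> preserves_line A (S *v v)"
proof -
  have "(T ** A ** S) *v v = k *s v \<longleftrightarrow> A *v (S *v v) = k *s (S *v v)" for k
  proof
    assume "(T ** A ** S) *v v = k *s v"
    then have "S *v (T *v (A *v (S *v v))) = S *v (k *s v)"
      by (simp add: matrix_vector_mul_assoc matrix_mul_assoc)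
    moreover have "S *v (T *v u) = u" for u by (simp add: matrix_vector_mul_assoc assms)
    ultimately show "A *v (S *v v) = k *s (S *v v)" by (simp add: vector_scalar_commute)
  next
    assume "A *v (S *v v) = k *s (S *v v)"
    then have "T *v (A *v (S *v v)) = k *s (T *v (S *v v))" by (simp add: vector_scalar_commute)
    moreover have "T *v (S *v v) = v" by (simp add: matrix_vector_mul_assoc assms)
    moreover have "T *v (A *v (S *v v)) = (T ** A ** S) *v v"
      by (simp add: matrix_vector_mul_assoc matrix_mul_assoc)
    ultimately show "(T ** A ** S) *v v = k *s v" by simp
  qed
  then show ?thesis by (simp add: preserves_line_def)
qed

lemma preserves_line_upper_triangular:
  assumes "upper_triangular A"
  shows "preserves_line A (vector [1, 0])"
    and "preserves_line A (vector [- s, 1]) \<longleftrightarrow> A $ 1 $ 2 = s * (A $ 1 $ 1 - A $ 2 $ 2)"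
  using assms unfolding preserves_line_def upper_triangular_def
  by (auto simp: vec_eq_iff forall_2 matrix_vector_mult_def sum_2 algebra_simps)

context linear_representation
begin

lemma preserves_line_generate:
  assumes X: "X \<subseteq> carrier G" and "\<And>x. x \<in> X \<Longrightarrow> preserves_line (\<rho> x) v" and y: "y \<in> generate G X"
  shows "preserves_line (\<rho> y) v"
proof -
  let ?H = "{x \<in> carrier G. preserves_line (\<rho> x) v}"
  have "subgroup ?H G"
  proof (rule subgroupI)
    have "preserves_line (\<rho> \<one>) v"
      unfolding preserves_line_def one by (intro exI[of _ 1]) simp
    then show "?H \<noteq> {}" by blast
    show "inv x \<in> ?H" if "x \<in> ?H" for x
      using that preserves_line_left_inverse[OF _ left_inverse] by auto
    show "x \<otimes> y \<in> ?H" if "x \<in> ?H" "y \<in> ?H" for x y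
      using that preserves_line_mult by (auto simp: mult)
  qed simp
  moreover have "X \<subseteq> ?H" using assms(1,2) by blast
  ultimately show ?thesis using generate_subgroup_incl y by blast
qed

lemma intertwine_generate:
  assumes \<tau>: "linear_representation G \<tau>" and X: "X \<subseteq> carrier G"
    and gen: "\<And>x. x \<in> X \<Longrightarrow> R ** \<rho> x = \<tau> x ** R" and y: "y \<in> generate G X"
  shows "R ** \<rho> y = \<tau> y ** R"
proof -
  interpret \<tau>: linear_representation G \<tau> by (fact \<tau>)
  let ?H = "{x \<in> carrier G. R ** \<rho> x = \<tau> x ** R}"
  have "subgroup ?H G"
  proof (rule subgroupI)
    show "?H \<noteq> {}" using one \<tau>.one by auto
    fix x assume "x \<in> ?H"
    then have x: "x \<in> carrier G" and "R ** \<rho> x = \<tau> x ** R" by simp_all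
    then have "\<tau> (inv x) ** (R ** \<rho> x) ** \<rho> (inv x) = \<tau> (inv x) ** (\<tau> x ** R) ** \<rho> (inv x)" by simp
    moreover have "\<tau> (inv x) ** (R ** \<rho> x) ** \<rho> (inv x) = \<tau> (inv x) ** R"
      by (simp add: right_inverse[OF x] flip: matrix_mul_assoc)
    moreover have "\<tau> (inv x) ** (\<tau> x ** R) ** \<rho> (inv x) = R ** \<rho> (inv x)"
      by (simp add: \<tau>.left_inverse[OF x] matrix_mul_assoc)
    ultimately show "inv x \<in> ?H" using x by simp
  next
    fix x y assume xy: "x \<in> ?H" "y \<in> ?H"
    then have "R ** \<rho> x ** \<rho> y = \<tau> x ** (\<tau> y ** R)" by (simp flip: matrix_mul_assoc)
    then show "x \<otimes> y \<in> ?H" using xy by (simp add: mult \<tau>.mult matrix_mul_assoc)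
  qed simp
  moreover have "X \<subseteq> ?H" using X gen by blast
  ultimately show ?thesis using generate_subgroup_incl y by blast
qed

end

lemma span_singleton_preserved:
  assumes "preserves_line A u" "v \<in> vec.span {u}"
  shows "A *v v \<in> vec.span {u}"
proof -
  obtain k c where "A *v u = k *s u" "v = c *s u"
    using assms unfolding preserves_line_def vec.span_singleton by blast
  then have "A *v v = (c * k) *s u" by (simp add: vector_scalar_commute)
  then show ?thesis by (auto simp: vec.span_singleton)
qed

lemma indecomposable_no_common_eigenbasis:
  fixes P :: "complex^2^2"
  assumes ind: "indecomposable G \<rho>" and P: "invertible P"
  obtains x j where "x \<in> carrier G" "\<not> preserves_line (\<rho> x) (column j P)"
proof -
  let ?L = "\<lambda>j. vec.span {column j P}"
  obtain Q where Q: "P ** Q = mat 1" "Q ** P = mat 1" using P unfolding invertible_def by blast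
  have P_vec: "P *v v = v $ 1 *s column 1 P + v $ 2 *s column 2 P" for v :: "complex^2"
    by (simp add: matrix_mult_sum sum_2)
  have P_eq_0: "v = 0" if "P *v v = 0" for v :: "complex^2"
    using that Q(2)
    by (metis matrix_vector_mul_assoc matrix_vector_mul_lid matrix_vector_mult_0_right)
  have "column 1 P \<noteq> 0" "column 2 P \<noteq> 0"
    using P_vec[of "vector [1, 0]"] P_vec[of "vector [0, 1]"]
      P_eq_0[of "vector [1, 0]"] P_eq_0[of "vector [0, 1]"]
    by (auto simp: vec_eq_iff forall_2)
  then have "vec.dim (?L 1) = 1" "vec.dim (?L 2) = 1"
    by (simp_all add: vec.dim_span)
  moreover have "?L 1 \<inter> ?L 2 = {0}"
  proof (intro subset_antisym subsetI)
    fix x assume "x \<in> ?L 1 \<inter> ?L 2"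
    then obtain k l where x: "x = k *s column 1 P" "x = l *s column 2 P"
      unfolding vec.span_singleton by blast
    then have "P *v vector [k, - l] = 0" unfolding P_vec by simp
    then have "k = 0" using P_eq_0 by (metis vector_2(1) zero_index)
    then show "x \<in> {0}" using x(1) by simp
  qed (simp add: vec.span_zero)
  moreover have "{v + w | v w. v \<in> ?L 1 \<and> w \<in> ?L 2} = UNIV"
  proof -
    have "x = (Q *v x) $ 1 *s column 1 P + (Q *v x) $ 2 *s column 2 P" for x
      unfolding P_vec[symmetric] by (simp add: matrix_vector_mul_assoc Q)
    then show ?thesis unfolding vec.span_singleton by blast
  qed
  ultimately have "\<not> (invariant_subspace G \<rho> (?L 1) \<and> invariant_subspace G \<rho> (?L 2))"
    using ind unfolding indecomposable_def by blast
  moreover have "invariant_subspace G \<rho> (?L j)" if "\<forall>x\<in>carrier G. preserves_line (\<rho> x) (column j P)"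
    for j
    using that span_singleton_preserved unfolding invariant_subspace_def
    by (blast intro: vec.subspace_span)
  ultimately show thesis using that by blast
qed

lemma matrix_inv_mult:
  assumes "invertible S"
  shows "S ** matrix_inv S = mat 1" "matrix_inv S ** S = mat 1"
  using someI_ex[OF assms[unfolded invertible_def]] unfolding matrix_inv_def by simp_all

definition shear :: "complex \<Rightarrow> complex \<Rightarrow> complex^2^2" where
  "shear s k = vector [vector [1, s], vector [0, k]]"

lemma invertible_shear: "k \<noteq> 0 \<Longrightarrow> invertible (shear s k)"
  by (simp add: invertible_det_nz det_2 shear_def)

lemma shear_intertwines:
  assumes "upper_triangular A" "upper_triangular B" "A $ 1 $ 1 = B $ 1 $ 1" "A $ 2 $ 2 = B $ 2 $ 2"
    and "A $ 1 $ 2 = k * B $ 1 $ 2 + s * (B $ 1 $ 1 - B $ 2 $ 2)"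
  shows "shear s k ** A = B ** shear s k"
  using assms
  by (simp add: vec_eq_iff forall_2 matrix_matrix_mult_def sum_2 shear_def upper_triangular_def
      algebra_simps)

lemma column_matrix_mult_shear:
  "column 1 (S ** shear s k) = S *v vector [1, 0]" "column 2 (S ** shear s k) = S *v vector [s, k]"
  by (simp_all add: column_def vec_eq_iff matrix_matrix_mult_def matrix_vector_mult_def sum_2
      shear_def)

lemma upper_triangular_mult:
  assumes "upper_triangular A" "upper_triangular B"
  shows "upper_triangular (A ** B)" "(A ** B) $ 1 $ 1 = A $ 1 $ 1 * B $ 1 $ 1"
    "(A ** B) $ 2 $ 2 = A $ 2 $ 2 * B $ 2 $ 2"
  using assms by (simp_all add: upper_triangular_def matrix_matrix_mult_def sum_2)

theorem indecomposable_not_coboundary: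
  fixes S :: "complex^2^2"
  assumes \<rho>: "linear_representation G \<rho>" and X: "X \<subseteq> carrier G" "generate G X = carrier G"
    and ind: "indecomposable G \<rho>" and S: "invertible S"
    and upper: "\<And>x. x \<in> X \<Longrightarrow> upper_triangular (matrix_inv S ** \<rho> x ** S)"
  obtains x where "x \<in> X" "(matrix_inv S ** \<rho> x ** S) $ 1 $ 2 \<noteq>
    s * ((matrix_inv S ** \<rho> x ** S) $ 1 $ 1 - (matrix_inv S ** \<rho> x ** S) $ 2 $ 2)"
proof -
  let ?P = "S ** shear (- s) 1"
  have "invertible ?P" by (intro invertible_mult S invertible_shear) simp
  then obtain x j where x: "x \<in> carrier G" and "\<not> preserves_line (\<rho> x) (column j ?P)"
    using indecomposable_no_common_eigenbasis[OF ind] by blast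
  then obtain v where v: "v = vector [1, 0] \<or> v = vector [- s, 1]" "\<not> preserves_line (\<rho> x) (S *v v)"
    using exhaust_2[of j] by (metis column_matrix_mult_shear)
  then obtain y where "y \<in> X" "\<not> preserves_line (\<rho> y) (S *v v)"
    using linear_representation.preserves_line_generate[OF \<rho> X(1)] x X(2) by blast
  then show thesis
    using that v(1) preserves_line_upper_triangular[OF upper]
      preserves_line_conjugate[OF matrix_inv_mult[OF S]]
    by metis
qed

section \<open>The monodromy representation\<close>

context riemann_data
begin

lemma solution_row_eventually_eq:
  assumes x: "x \<in> - D" and b: "branch U \<Psi>" "branch V \<Psi>'"
    and "cross_ratio x \<in> U" "cross_ratio x \<in> V" "\<Psi> (cross_ratio x) = \<Psi>' (cross_ratio x)"
  shows "\<forall>\<^sub>F y in nhds x. solution_row (\<Psi> (cross_ratio y)) = solution_row (\<Psi>' (cross_ratio y))"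
  using eventually_nhds_pullback[OF x eventually_section_eq[OF b assms(4-6)]]
  by eventually_elim simp

lemma solution_row_holomorphic:
  assumes "branch U \<Psi>"
  shows "cp1_holomorphic_on (\<lambda>x. solution_row (\<Psi> (cross_ratio x)) $ j) (pullback U)"
  using solution_holomorphic[OF assms] by (cases "j = 1") (simp_all add: solution_row_def)

lemma lift_near_branch:
  assumes g: "path g" "path_image g \<subseteq> - D" and m: "lift (cross_ratio \<circ> g) m" and t: "t \<in> {0..1}"
    and b: "branch U \<Psi>" "cross_ratio (g t) \<in> U" "m t = \<Psi> (cross_ratio (g t))"
  obtains e where "e > 0"
    "\<forall>s\<in>{0..1}. \<bar>s - t\<bar> < e \<longrightarrow> g s \<in> pullback U \<and> m s = \<Psi> (cross_ratio (g s))"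
proof -
  have gt: "g t \<in> pullback U" using g(2) t b(2) unfolding pullback_def path_image_def by blast
  have "open (pullback U)" using b(1) by (intro open_pullback branchD)
  then have "\<forall>\<^sub>F s in at t within {0..1}. g s \<in> pullback U"
    using g(1) t gt by (intro continuous_on_eventually_in_open) (auto simp: path_def)
  moreover have "\<forall>\<^sub>F s in at t within {0..1}. m s = \<Psi> (cross_ratio (g s))"
    using lift_on_eventually_eq_section[OF m t b(1)] b(2,3) by simp
  ultimately have "\<forall>\<^sub>F s in at t within {0..1}. g s \<in> pullback U \<and> m s = \<Psi> (cross_ratio (g s))"
    by (rule eventually_conj)
  then show thesis
    using that gt b(3) unfolding eventually_at dist_real_def
    by (metis abs_le_zero_iff eq_iff_diff_eq_0 linorder_not_le)
qed

lemma continuation_along_lift: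
  assumes g: "path g" "path_image g \<subseteq> - D" and m: "lift (cross_ratio \<circ> g) m"
    and start: "branch U \<Psi>" "cross_ratio (pathstart g) \<in> U" "\<Psi> (cross_ratio (pathstart g)) = m 0"
    and finish: "branch V \<Psi>'" "cross_ratio (pathfinish g) \<in> V"
      "\<Psi>' (cross_ratio (pathfinish g)) = m 1"
  shows "continuation_along g (\<lambda>x. solution_row (\<Psi> (cross_ratio x)))
    (\<lambda>x. solution_row (\<Psi>' (cross_ratio x)))"
proof -
  have gD: "g t \<in> - D" if "t \<in> {0..1}" for t
    using g(2) that unfolding path_image_def by blast
  obtain W P where P: "\<And>t. t \<in> {0..1} \<Longrightarrow> branch (W t) (P t)"
    "\<And>t. t \<in> {0..1} \<Longrightarrow> cross_ratio (g t) \<in> W t" "\<And>t. t \<in> {0..1} \<Longrightarrow> m t = P t (cross_ratio (g t))"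
    using lift_on_choose_sections[OF m] unfolding comp_apply by metis
  show ?thesis
    unfolding continuation_along_def
  proof (intro exI[of _ "\<lambda>t x. solution_row (P t (cross_ratio x))"] conjI ballI)
    show "\<forall>\<^sub>F x in nhds (pathstart g). solution_row (P 0 (cross_ratio x)) =
        solution_row (\<Psi> (cross_ratio x))"
      using gD[of 0] P[of 0] start
      by (intro solution_row_eventually_eq[OF _ P(1) start(1)]) (auto simp: pathstart_def)
    show "\<forall>\<^sub>F x in nhds (pathfinish g). solution_row (P 1 (cross_ratio x)) =
        solution_row (\<Psi>' (cross_ratio x))"
      using gD[of 1] P[of 1] finish
      by (intro solution_row_eventually_eq[OF _ P(1) finish(1)]) (auto simp: pathfinish_def)
    fix t :: real assume t: "t \<in> {0..1}"
    have N: "open (pullback (W t))" "g t \<in> pullback (W t)"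
      using gD[OF t] P(1,2)[OF t] open_pullback branchD(1) by (auto simp: pullback_def)
    obtain e where e: "e > 0"
      and near: "\<forall>s\<in>{0..1}. \<bar>s - t\<bar> < e \<longrightarrow> g s \<in> pullback (W t) \<and> m s = P t (cross_ratio (g s))"
      by (rule lift_near_branch[OF g m t P[OF t]])
    have "\<forall>\<^sub>F x in nhds (g s). solution_row (P s (cross_ratio x)) =
        solution_row (P t (cross_ratio x))"
      if s: "s \<in> {0..1}" "\<bar>s - t\<bar> < e" for s
      using near s P(2,3)[OF s(1)] gD[OF s(1)]
      by (intro solution_row_eventually_eq[OF _ P(1)[OF s(1)] P(1)[OF t]]) (auto simp: pullback_def)
    then show "\<exists>N. open N \<and> g t \<in> N \<and>
        (\<forall>j. cp1_holomorphic_on (\<lambda>x. solution_row (P t (cross_ratio x)) $ j) N) \<and>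
        (\<exists>e>0. \<forall>s\<in>{0..1}. \<bar>s - t\<bar> < e \<longrightarrow> g s \<in> N \<and>
          (\<forall>\<^sub>F x in nhds (g s). solution_row (P s (cross_ratio x)) =
            solution_row (P t (cross_ratio x))))"
      using N solution_row_holomorphic[OF P(1)[OF t]] e near
      by (intro exI[of _ "pullback (W t)"] conjI allI exI[of _ e]) auto
  qed
qed

definition deck_matrix :: "branch_value \<Rightarrow> complex^2^2" where
  "deck_matrix d = (\<chi> i j.
     if i = 1 then if j = 1 then 1 / amplitude d else - prim d / (amplitude d * integrand d)
     else if j = 1 then 0 else 1 / (amplitude d * integrand d))"

lemma deck_matrix_nth:
  "deck_matrix d $ 1 $ 1 = 1 / amplitude d"
  "deck_matrix d $ 1 $ 2 = - prim d / (amplitude d * integrand d)"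
  "deck_matrix d $ 2 $ 1 = 0" "deck_matrix d $ 2 $ 2 = 1 / (amplitude d * integrand d)"
  by (simp_all add: deck_matrix_def)

lemma amplitude_nonzero [simp]: "amplitude v \<noteq> 0"
  by (simp add: amplitude_def)

lemma amplitude_deck: "amplitude (deck d v) = amplitude d * amplitude v"
  by (simp add: amplitude_def deck_def algebra_simps exp_add)

lemma integrand_deck: "integrand (deck d v) = integrand d * integrand v"
  by (simp add: deck_def algebra_simps exp_add)

lemma prim_deck: "prim (deck d v) = integrand d * prim v + prim d"
  by (simp add: deck_def)

lemma solution_row_deck: "solution_row (deck d v) v* deck_matrix d = solution_row v"
proof -
  define B where "B = integrand d"
  have "B \<noteq> 0" by (simp add: B_def)
  then show ?thesis
    unfolding vec_eq_iff forall_2 vector_matrix_mult_2 deck_matrix_nth solution_row_def solution_def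
      amplitude_deck prim_deck B_def[symmetric]
    by (simp add: field_simps)
qed

lemma deck_matrix_deck: "deck_matrix (deck d d') = deck_matrix d ** deck_matrix d'"
proof -
  define B B' where "B = integrand d" and "B' = integrand d'"
  have "B \<noteq> 0" "B' \<noteq> 0" by (simp_all add: B_def B'_def)
  then show ?thesis
    unfolding vec_eq_iff forall_2 matrix_matrix_mult_def sum_2 deck_matrix_nth vec_lambda_beta
      amplitude_deck integrand_deck prim_deck B_def[symmetric] B'_def[symmetric]
    by (simp add: field_simps)
qed

lemma invertible_deck_matrix: "invertible (deck_matrix d)"
  by (simp add: invertible_det_nz det_2 deck_matrix_nth)

definition monodromy :: "(real \<Rightarrow> cp1) set \<Rightarrow> complex^2^2" where
  "monodromy C = deck_matrix (SOME d. \<exists>g\<in>C. has_deck (cross_ratio \<circ> g) d)"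

lemma monodromy_loop_class:
  assumes d: "has_deck (cross_ratio \<circ> g) d" and g: "g \<in> loops (- D) p"
  shows "monodromy (loop_class (- D) g) = deck_matrix d"
proof -
  have "has_deck (cross_ratio \<circ> h) d" if h: "h \<in> loop_class (- D) g" for h
  proof -
    have "homotopic_paths (- {0, 1}) (cross_ratio \<circ> g) (cross_ratio \<circ> h)"
      using h cross_ratio_continuous cross_ratio_in unfolding loop_class_def
      by (intro homotopic_paths_continuous_image[where S = "- D"]) auto
    then show ?thesis using d by (rule has_deck_homotopic)
  qed
  moreover have "g \<in> loop_class (- D) g" using g by (simp add: loop_class_def loops_def)
  ultimately have "(\<exists>h\<in>loop_class (- D) g. has_deck (cross_ratio \<circ> h) d') \<longleftrightarrow> d' = d" for d'
    using has_deck_unique by blast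
  then show ?thesis by (simp add: monodromy_def)
qed

lemma monodromy_hom:
  assumes p: "p \<in> - D"
  shows "monodromy \<in> hom (fundamental_group (- D) p) GL"
proof (rule homI)
  let ?cls = "loop_class (- D)"
  fix x y assume "x \<in> carrier (fundamental_group (- D) p)" "y \<in> carrier (fundamental_group (- D) p)"
  then obtain g h where g: "g \<in> loops (- D) p" "x = ?cls g" and h: "h \<in> loops (- D) p" "y = ?cls h"
    by (auto simp: fundamental_group_def)
  obtain d where d: "has_deck (cross_ratio \<circ> g) d"
    using has_deck_exists[OF cross_ratio_compose_loops[OF g(1)]] .
  obtain d' where d': "has_deck (cross_ratio \<circ> h) d'"
    using has_deck_exists[OF cross_ratio_compose_loops[OF h(1)]] .
  show "monodromy x \<in> carrier GL"
    unfolding g(2) monodromy_loop_class[OF d g(1)] by (simp add: GL_def invertible_deck_matrix)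
  have dd': "has_deck (cross_ratio \<circ> (g +++ h)) (deck d d')"
    unfolding path_compose_join using g(1) h(1)
    by (intro has_deck_join d d') (auto simp: loops_def pathstart_compose pathfinish_compose)
  show "monodromy (x \<otimes>\<^bsub>fundamental_group (- D) p\<^esub> y) = monodromy x \<otimes>\<^bsub>GL\<^esub> monodromy y"
    unfolding g(2) h(2) loop_class_mult[OF g(1) h(1)] monodromy_loop_class[OF d g(1)]
      monodromy_loop_class[OF d' h(1)] monodromy_loop_class[OF dd' loops_join[OF g(1) h(1)]]
      deck_matrix_deck
    by (simp add: GL_def)
qed

theorem realizes_monodromy:
  assumes p: "p \<in> - D"
  shows "realizes D p b1 b2 monodromy"
proof -
  let ?x = "cross_ratio p"
  obtain e where e: "e > 0" "ball ?x e \<subseteq> - {0, 1}"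
    using openE[OF open_base cross_ratio_in[OF p]] .
  then obtain \<Psi> where \<Psi>: "branch (ball ?x e) \<Psi>" "\<Psi> ?x = base_value ?x"
    using section_exists base_value_in_fibre[OF cross_ratio_in[OF p]] by blast
  let ?Y = "\<lambda>x. solution_row (\<Psi> (cross_ratio x))"
  have "monodromy_matrix ?Y g (monodromy (loop_class (- D) g))" if g: "g \<in> loops (- D) p" for g
  proof -
    have "pathstart (cross_ratio \<circ> g) = ?x" using g by (simp add: loops_def pathstart_compose)
    moreover obtain d where d: "has_deck (cross_ratio \<circ> g) d"
      using has_deck_exists[OF cross_ratio_compose_loops[OF g]] .
    ultimately obtain m where m: "lift (cross_ratio \<circ> g) m" "m 0 = base_value ?x"
      "m 1 = deck d (base_value ?x)"
      unfolding has_deck_def by auto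
    have "d \<in> periods"
      using g by (intro has_deck_periods[OF d])
        (simp add: loops_def pathstart_compose pathfinish_compose)
    then have "branch (ball ?x e) (\<lambda>x. deck d (\<Psi> x))"
      by (rule branch_deck[OF \<Psi>(1)])
    then have "continuation_along g ?Y (\<lambda>x. solution_row (deck d (\<Psi> (cross_ratio x))))"
      using g e(1) \<Psi> m by (intro continuation_along_lift[OF _ _ m(1) \<Psi>(1)]) (auto simp: loops_def)
    then show ?thesis
      unfolding monodromy_matrix_def monodromy_loop_class[OF d g]
      by (intro exI[of _ "\<lambda>x. solution_row (deck d (\<Psi> (cross_ratio x)))"])
        (simp add: solution_row_deck)
  qed
  moreover have "solution_basis b1 b2 p ?Y"
    using p e(1) by (intro solution_basis_branch[OF \<Psi>(1)]) (simp add: pullback_def)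
  ultimately show ?thesis unfolding realizes_def by blast
qed

lemma has_deck_loop_around:
  assumes "has_deck (cross_ratio \<circ> g) d" "loop_around D p a g" "a \<in> {a1, a2}"
  shows "log0 d = (if a = a1 then two_pi_i else 0)" "log1 d = (if a = a2 then two_pi_i else 0)"
  using winding_number_cross_ratio_loop_around[OF assms(2,3), of a1]
    winding_number_cross_ratio_loop_around[OF assms(2,3), of a2]
    has_deck_log[OF assms(1)] by (auto simp: cross_ratio_a1 cross_ratio_a2)

lemma monodromy_loop_around:
  assumes g: "g \<in> loops (- D) p" "loop_around D p a g" and a: "a \<in> {a1, a2}"
  shows "upper_triangular (monodromy (loop_class (- D) g))"
    and "monodromy (loop_class (- D) g) $ 1 $ 1 = 1 / exp (two_pi_i * amplitude_residue a)"
    and "monodromy (loop_class (- D) g) $ 2 $ 2 =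
      1 / (exp (two_pi_i * amplitude_residue a) * exp (two_pi_i * prim_residue a))"
proof -
  obtain d where d: "has_deck (cross_ratio \<circ> g) d"
    using has_deck_exists[OF cross_ratio_compose_loops[OF g(1)]] .
  note matrix = monodromy_loop_class[OF d g(1)] and log = has_deck_loop_around[OF d g(2) a]
  show "upper_triangular (monodromy (loop_class (- D) g))"
    by (simp add: upper_triangular_def matrix deck_matrix_nth)
  have "amplitude d = exp (two_pi_i * amplitude_residue a)"
    "integrand d = exp (two_pi_i * prim_residue a)"
    using a distinct unfolding amplitude_def log
    by (auto simp: amplitude_residue_def prim_residue_def mult.commute)
  then show "monodromy (loop_class (- D) g) $ 1 $ 1 = 1 / exp (two_pi_i * amplitude_residue a)"
    "monodromy (loop_class (- D) g) $ 2 $ 2 =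
      1 / (exp (two_pi_i * amplitude_residue a) * exp (two_pi_i * prim_residue a))"
    by (simp_all only: matrix deck_matrix_nth)
qed

lemma monodromy_loop_around_logarithm:
  assumes \<beta>: "\<beta>0 = - 1" "\<beta>1 = 0" and g: "g \<in> loops (- D) p" "loop_around D p a g"
    and a: "a \<in> {a1, a2}"
  shows "monodromy (loop_class (- D) g) $ 1 $ 2 = 0 \<longleftrightarrow> a = a2"
proof -
  obtain d where d: "has_deck (cross_ratio \<circ> g) d"
    using has_deck_exists[OF cross_ratio_compose_loops[OF g(1)]] .
  show ?thesis
    unfolding monodromy_loop_class[OF d g(1)] deck_matrix_nth has_deck_logarithm[OF \<beta> d]
      has_deck_loop_around[OF d g(2) a]
    using a distinct by auto
qed

theorem monodromy_not_preserves_line: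
  assumes p: "p \<in> - D"
    and "exp (two_pi_i * \<beta>0) \<noteq> 1" "exp (two_pi_i * \<beta>1) \<noteq> 1" "Re (\<beta>0 + \<beta>1) > - 2"
  obtains C where "C \<in> carrier (fundamental_group (- D) p)"
    "\<not> preserves_line (monodromy C) (vector [- s, 1])"
proof -
  obtain h d where h: "h \<in> loops (- {0, 1}) (cross_ratio p)" and d: "has_deck h d"
    and ne: "prim d \<noteq> s * (1 - integrand d)"
    using deck_not_coboundary[OF cross_ratio_in[OF p] assms(2-4)] .
  define g where "g = cross_ratio_inv \<circ> h"
  have g: "g \<in> loops (- D) p" using cross_ratio_inv_compose_loops[OF p h] by (simp add: g_def)
  have "cross_ratio \<circ> g = h" by (simp add: g_def fun_eq_iff cross_ratio_cross_ratio_inv)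
  then have "monodromy (loop_class (- D) g) = deck_matrix d"
    using monodromy_loop_class[OF _ g] d by simp
  moreover have "deck_matrix d $ 1 $ 2 \<noteq> s * (deck_matrix d $ 1 $ 1 - deck_matrix d $ 2 $ 2)"
  proof -
    define B where "B = integrand d"
    have "B \<noteq> 0" by (simp add: B_def)
    then show ?thesis
      using ne unfolding deck_matrix_nth B_def[symmetric] by (simp add: field_simps)
  qed
  moreover have "upper_triangular (deck_matrix d)"
    by (simp add: upper_triangular_def deck_matrix_nth)
  ultimately show thesis
    using that[of "loop_class (- D) g"] g
    by (simp add: fundamental_group_def preserves_line_upper_triangular(2))
qed

end

section \<open>Realization of triangular representations\<close>

lemma exp_two_pi_i_exponent:
  assumes "z \<noteq> 0"
  obtains b where "Re b > - 1" "exp (two_pi_i * b) = z"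
proof
  have "- (2 * pi) < Im (Ln z)" using mpi_less_Im_Ln[OF assms] pi_gt_zero by linarith
  moreover have "Re (Ln z / two_pi_i) = Im (Ln z) / (2 * pi)"
    by (simp add: Re_divide power2_eq_square)
  ultimately show "Re (Ln z / two_pi_i) > - 1" by (simp add: less_divide_eq)
  show "exp (two_pi_i * (Ln z / two_pi_i)) = z" using assms by simp
qed


lemma not_coboundary_proportional:
  fixes \<delta> \<epsilon> x y z w :: "'a::field"
  assumes \<delta>: "\<delta> \<noteq> 0" and x: "\<And>s. \<not> (x = s * \<delta> \<and> y = s * \<epsilon>)" and z: "\<And>s. \<not> (z = s * \<delta> \<and> w = s * \<epsilon>)"
  obtains k s where "k \<noteq> 0" "z = k * x + s * \<delta>" "w = k * y + s * \<epsilon>"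
proof -
  define k where "k = (z * \<epsilon> - w * \<delta>) / (x * \<epsilon> - y * \<delta>)"
  have nz: "x * \<epsilon> - y * \<delta> \<noteq> 0" "z * \<epsilon> - w * \<delta> \<noteq> 0"
    using x[of "x / \<delta>"] z[of "z / \<delta>"] \<delta> by (auto simp: field_simps)
  then have "k * (x * \<epsilon> - y * \<delta>) = z * \<epsilon> - w * \<delta>" by (simp add: k_def)
  then have "(z - k * x) / \<delta> * \<epsilon> = w - k * y" using \<delta> by (simp add: field_simps)
  then show thesis
    using nz \<delta> by (intro that[of k "(z - k * x) / \<delta>"]) (auto simp: k_def)
qed

locale triangular_representation = three_points +
  fixes p :: cp1 and g1 g2 :: "real \<Rightarrow> cp1" and \<rho> :: "(real \<Rightarrow> cp1) set \<Rightarrow> complex^2^2"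
    and S :: "complex^2^2"
  assumes base: "p \<in> - D"
    and g1: "g1 \<in> loops (- D) p" "loop_around D p a1 g1"
    and g2: "g2 \<in> loops (- D) p" "loop_around D p a2 g2"
    and generators: "generate (fundamental_group (- D) p) {loop_class (- D) g1, loop_class (- D) g2}
      = carrier (fundamental_group (- D) p)"
    and hom: "\<rho> \<in> hom (fundamental_group (- D) p) GL"
    and indecomposable: "indecomposable (fundamental_group (- D) p) \<rho>"
    and S: "invertible S"
    and upper: "upper_triangular (matrix_inv S ** \<rho> (loop_class (- D) g1) ** S)"
      "upper_triangular (matrix_inv S ** \<rho> (loop_class (- D) g2) ** S)"
begin

abbreviation G :: "(real \<Rightarrow> cp1) set monoid" where
  "G \<equiv> fundamental_group (- D) p"

abbreviation c1 :: "(real \<Rightarrow> cp1) set" where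
  "c1 \<equiv> loop_class (- D) g1"

abbreviation c2 :: "(real \<Rightarrow> cp1) set" where
  "c2 \<equiv> loop_class (- D) g2"

abbreviation H1 :: "complex^2^2" where
  "H1 \<equiv> matrix_inv S ** \<rho> c1 ** S"

abbreviation H2 :: "complex^2^2" where
  "H2 \<equiv> matrix_inv S ** \<rho> c2 ** S"

lemma linear_representation_GI: "\<sigma> \<in> hom G GL \<Longrightarrow> linear_representation G \<sigma>"
  using base
  by (intro linear_representation.intro group_fundamental_group linear_representation_axioms.intro)

lemma c_carrier: "{c1, c2} \<subseteq> carrier G"
  using g1(1) g2(1) by (simp add: fundamental_group_def)

lemma not_coboundary:
  "\<not> (H1 $ 1 $ 2 = s * (H1 $ 1 $ 1 - H1 $ 2 $ 2) \<and> H2 $ 1 $ 2 = s * (H2 $ 1 $ 1 - H2 $ 2 $ 2))"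
  using indecomposable_not_coboundary[OF linear_representation_GI[OF hom] c_carrier generators
    indecomposable S, of s] upper
  by blast

lemma diagonal_nonzero: "H1 $ 1 $ 1 \<noteq> 0" "H1 $ 2 $ 2 \<noteq> 0" "H2 $ 1 $ 1 \<noteq> 0" "H2 $ 2 $ 2 \<noteq> 0"
proof -
  have "invertible (\<rho> c1)" "invertible (\<rho> c2)" using hom c_carrier by (auto simp: hom_def GL_def)
  moreover have "invertible (matrix_inv S)"
    using matrix_inv_mult[OF S] by (auto simp: invertible_def)
  ultimately have "invertible H1" "invertible H2" using S by (auto intro: invertible_mult)
  then show "H1 $ 1 $ 1 \<noteq> 0" "H1 $ 2 $ 2 \<noteq> 0" "H2 $ 1 $ 1 \<noteq> 0" "H2 $ 2 $ 2 \<noteq> 0"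
    using upper by (auto simp: invertible_det_nz det_2 upper_triangular_def)
qed

end

locale matched_exponents =
  triangular_representation a1 a2 a3 p g1 g2 \<rho> S + riemann_data a1 a2 a3 \<beta>0 \<beta>1 \<alpha>0 \<alpha>1
  for a1 a2 a3 p g1 g2 \<rho> S \<beta>0 \<beta>1 \<alpha>0 \<alpha>1 +
  assumes amplitude_exponents: "exp (two_pi_i * \<alpha>0) = 1 / H1 $ 1 $ 1"
    "exp (two_pi_i * \<alpha>1) = 1 / H2 $ 1 $ 1"
    and prim_exponents: "exp (two_pi_i * \<beta>0) = H1 $ 1 $ 1 / H1 $ 2 $ 2"
      "exp (two_pi_i * \<beta>1) = H2 $ 1 $ 1 / H2 $ 2 $ 2"
begin

abbreviation M1 :: "complex^2^2" where
  "M1 \<equiv> monodromy c1"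

abbreviation M2 :: "complex^2^2" where
  "M2 \<equiv> monodromy c2"

lemma monodromy_upper_triangular: "upper_triangular M1" "upper_triangular M2"
  using monodromy_loop_around(1)[OF g1] monodromy_loop_around(1)[OF g2] by auto

lemma monodromy_diagonal:
  "M1 $ 1 $ 1 = H1 $ 1 $ 1" "M1 $ 2 $ 2 = H1 $ 2 $ 2"
  "M2 $ 1 $ 1 = H2 $ 1 $ 1" "M2 $ 2 $ 2 = H2 $ 2 $ 2"
  using monodromy_loop_around(2,3)[OF g1] monodromy_loop_around(2,3)[OF g2]
    distinct diagonal_nonzero
  by (simp_all add: amplitude_residue_def prim_residue_def amplitude_exponents prim_exponents)

lemma realizes_if_proportional:
  assumes k: "k \<noteq> 0"
    and "H1 $ 1 $ 2 = k * M1 $ 1 $ 2 + s * (M1 $ 1 $ 1 - M1 $ 2 $ 2)"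
      "H2 $ 1 $ 2 = k * M2 $ 1 $ 2 + s * (M2 $ 1 $ 1 - M2 $ 2 $ 2)"
  shows "realizes D p b1 b2 \<rho>"
proof (rule realizes_conjugate[OF realizes_monodromy[OF base]])
  let ?R = "shear s k ** matrix_inv S"
  show "invertible ?R"
    using matrix_inv_mult[OF S]
    by (intro invertible_mult invertible_shear k) (auto simp: invertible_def)
  have "?R ** \<rho> c = monodromy c ** ?R"
    if "shear s k ** (matrix_inv S ** \<rho> c ** S) = monodromy c ** shear s k" for c
  proof -
    have "?R ** \<rho> c = shear s k ** (matrix_inv S ** \<rho> c ** S) ** matrix_inv S"
      by (simp add: matrix_inv_mult[OF S] flip: matrix_mul_assoc)
    then show ?thesis unfolding that by (simp add: matrix_mul_assoc)
  qed
  then have generators_intertwined: "?R ** \<rho> c = monodromy c ** ?R" if "c \<in> {c1, c2}" for c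
    using that assms shear_intertwines[OF upper(1) monodromy_upper_triangular(1), of k s]
      shear_intertwines[OF upper(2) monodromy_upper_triangular(2), of k s]
      monodromy_diagonal by auto
  show "?R ** \<rho> (loop_class (- D) g) = monodromy (loop_class (- D) g) ** ?R"
    if "g \<in> loops (- D) p" for g
  proof (rule linear_representation.intertwine_generate[OF _ _ c_carrier generators_intertwined])
    show "linear_representation G \<rho>" "linear_representation G monodromy"
      using hom monodromy_hom[OF base] by (auto intro: linear_representation_GI)
    show "loop_class (- D) g \<in> generate G {c1, c2}"
      using that generators by (simp add: fundamental_group_def)
  qed
qed

lemma monodromy_not_coboundary:
  assumes ne: "H1 $ 1 $ 1 \<noteq> H1 $ 2 $ 2" "H2 $ 1 $ 1 \<noteq> H2 $ 2 $ 2" and "Re (\<beta>0 + \<beta>1) > - 2"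
  shows "\<not> (M1 $ 1 $ 2 = s * (M1 $ 1 $ 1 - M1 $ 2 $ 2) \<and>
    M2 $ 1 $ 2 = s * (M2 $ 1 $ 1 - M2 $ 2 $ 2))"
proof
  assume "M1 $ 1 $ 2 = s * (M1 $ 1 $ 1 - M1 $ 2 $ 2) \<and> M2 $ 1 $ 2 = s * (M2 $ 1 $ 1 - M2 $ 2 $ 2)"
  then have line: "preserves_line (monodromy c) (vector [- s, 1])" if "c \<in> {c1, c2}" for c
    using that preserves_line_upper_triangular(2)[OF monodromy_upper_triangular(1)]
      preserves_line_upper_triangular(2)[OF monodromy_upper_triangular(2)] by auto
  have "exp (two_pi_i * \<beta>0) \<noteq> 1" "exp (two_pi_i * \<beta>1) \<noteq> 1"
    using ne diagonal_nonzero by (simp_all add: prim_exponents)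
  then obtain C where "C \<in> carrier G" "\<not> preserves_line (monodromy C) (vector [- s, 1])"
    using monodromy_not_preserves_line[OF base _ _ assms(3)] by blast
  then show False
    using linear_representation.preserves_line_generate[
        OF linear_representation_GI[OF monodromy_hom[OF base]]
        c_carrier line] generators by simp
qed

lemma realizes_if_distinct_eigenvalues:
  assumes "H1 $ 1 $ 1 \<noteq> H1 $ 2 $ 2" "H2 $ 1 $ 1 \<noteq> H2 $ 2 $ 2" and "Re (\<beta>0 + \<beta>1) > - 2"
  shows "realizes D p b1 b2 \<rho>"
proof -
  have "M1 $ 1 $ 1 - M1 $ 2 $ 2 \<noteq> 0" using assms(1) by (simp add: monodromy_diagonal)
  then obtain k s where "k \<noteq> 0" "H1 $ 1 $ 2 = k * M1 $ 1 $ 2 + s * (M1 $ 1 $ 1 - M1 $ 2 $ 2)"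
    "H2 $ 1 $ 2 = k * M2 $ 1 $ 2 + s * (M2 $ 1 $ 1 - M2 $ 2 $ 2)"
    using not_coboundary_proportional monodromy_not_coboundary[OF assms]
      not_coboundary[folded monodromy_diagonal]
    by blast
  then show ?thesis by (rule realizes_if_proportional)
qed

lemma realizes_if_logarithmic:
  assumes \<beta>: "\<beta>0 = - 1" "\<beta>1 = 0" and "H2 $ 1 $ 2 = 0"
  shows "realizes D p b1 b2 \<rho>"
proof (rule realizes_if_proportional)
  have "M1 $ 1 $ 2 \<noteq> 0" "M2 $ 1 $ 2 = 0"
    using monodromy_loop_around_logarithm[OF \<beta> g1] monodromy_loop_around_logarithm[OF \<beta> g2] distinct
    by auto
  moreover have "H1 $ 1 $ 2 \<noteq> 0" using not_coboundary[of 0] assms(3) by simp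
  ultimately show "H1 $ 1 $ 2 / M1 $ 1 $ 2 \<noteq> 0"
    "H1 $ 1 $ 2 = H1 $ 1 $ 2 / M1 $ 1 $ 2 * M1 $ 1 $ 2 + 0 * (M1 $ 1 $ 1 - M1 $ 2 $ 2)"
    "H2 $ 1 $ 2 = H1 $ 1 $ 2 / M1 $ 1 $ 2 * M2 $ 1 $ 2 + 0 * (M2 $ 1 $ 1 - M2 $ 2 $ 2)"
    using assms(3) by simp_all
qed

end

context triangular_representation
begin

theorem realized:
  assumes "H1 $ 1 $ 1 \<noteq> H1 $ 2 $ 2 \<and> H2 $ 1 $ 1 \<noteq> H2 $ 2 $ 2 \<or>
    H1 $ 1 $ 1 = H1 $ 2 $ 2 \<and> H2 $ 1 $ 1 = H2 $ 2 $ 2 \<and> H2 $ 1 $ 2 = 0"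
  shows "\<exists>b1 b2. riemann_equation D b1 b2 \<and> realizes D p b1 b2 \<rho>"
proof -
  obtain \<alpha>0 \<alpha>1 where \<alpha>: "exp (two_pi_i * \<alpha>0) = 1 / H1 $ 1 $ 1"
    "exp (two_pi_i * \<alpha>1) = 1 / H2 $ 1 $ 1"
    using diagonal_nonzero exp_two_pi_i_exponent by (metis divide_eq_0_iff one_neq_zero)
  from assms show ?thesis
  proof (elim disjE conjE)
    assume ne: "H1 $ 1 $ 1 \<noteq> H1 $ 2 $ 2" "H2 $ 1 $ 1 \<noteq> H2 $ 2 $ 2"
    obtain \<beta>0 where \<beta>0: "Re \<beta>0 > - 1" "exp (two_pi_i * \<beta>0) = H1 $ 1 $ 1 / H1 $ 2 $ 2"
      using diagonal_nonzero exp_two_pi_i_exponent by (metis divide_eq_0_iff)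
    obtain \<beta>1 where \<beta>1: "Re \<beta>1 > - 1" "exp (two_pi_i * \<beta>1) = H2 $ 1 $ 1 / H2 $ 2 $ 2"
      using diagonal_nonzero exp_two_pi_i_exponent by (metis divide_eq_0_iff)
    interpret matched_exponents a1 a2 a3 p g1 g2 \<rho> S \<beta>0 \<beta>1 \<alpha>0 \<alpha>1
      by unfold_locales (fact \<alpha> \<beta>0 \<beta>1)+
    show ?thesis
      using riemann_equation_b1_b2 realizes_if_distinct_eigenvalues[OF ne] \<beta>0(1) \<beta>1(1) by auto
  next
    assume eq: "H1 $ 1 $ 1 = H1 $ 2 $ 2" "H2 $ 1 $ 1 = H2 $ 2 $ 2" "H2 $ 1 $ 2 = 0"
    interpret matched_exponents a1 a2 a3 p g1 g2 \<rho> S "- 1" 0 \<alpha>0 \<alpha>1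
      using \<alpha> eq diagonal_nonzero by unfold_locales (auto simp: exp_minus)
    show ?thesis
      using riemann_equation_b1_b2 realizes_if_logarithmic[OF refl refl eq(3)] by blast
  qed
qed

end

section \<open>Cyclic triples of generators\<close>

lemma numeral_3_cyclic: "(4::3) = 1" "(5::3) = 2"
  by simp_all

lemma add_3_cyclic: "i + 3 = i" for i :: 3
  by simp

lemma range_cyclic: "range a = {a i, a (i + 1), a (i + 2)}" for a :: "3 \<Rightarrow> 'a" and i :: 3
proof -
  have "i = 1 \<or> i = 2 \<or> i = 3" by (rule exhaust_3)
  then show ?thesis by (auto simp: UNIV_3 numeral_3_cyclic)
qed

lemma (in group) mult_eq_one_cyclic:
  assumes "x \<in> carrier G" "y \<in> carrier G" "z \<in> carrier G" "x \<otimes> y \<otimes> z = \<one>"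
  shows "y \<otimes> z \<otimes> x = \<one>"
  using assms inv_comm[of x "y \<otimes> z"] by (simp add: m_assoc)

lemma (in group) generate_two_of_three:
  assumes carrier: "x \<in> carrier G" "y \<in> carrier G" "z \<in> carrier G" and "x \<otimes> y \<otimes> z = \<one>"
    and gen: "generate G {x, y, z} = carrier G"
  shows "generate G {x, y} = carrier G"
proof
  have sub: "subgroup (generate G {x, y}) G" using carrier by (intro generate_is_subgroup) auto
  have "x \<in> generate G {x, y}" "y \<in> generate G {x, y}" by (auto intro: generate.incl)
  moreover have "z = inv (x \<otimes> y)"
    using assms inv_equality[of z "x \<otimes> y"] inv_comm[of "x \<otimes> y" z] by simp
  ultimately have subset: "{x, y, z} \<subseteq> generate G {x, y}"
    using subgroup.m_closed[OF sub] subgroup.m_inv_closed[OF sub] by simp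
  show "carrier G \<subseteq> generate G {x, y}" using generate_subgroup_incl[OF subset sub] gen by simp
  show "generate G {x, y} \<subseteq> carrier G" using carrier by (intro generate_incl) simp
qed

lemma cyclic_dichotomy:
  fixes P :: "3 \<Rightarrow> bool"
  assumes "\<And>i. P i \<Longrightarrow> P (i + 1) \<Longrightarrow> P (i + 2)"
  obtains i where "\<not> P i" "\<not> P (i + 1)" | "\<forall>i. P i"
proof -
  have "P i" if "\<And>i. P i \<or> P (i + 1)" for i
    using that[of i] that[of "i + 2"] assms[of "i + 1"] by (auto simp: add.assoc add_3_cyclic)
  then show thesis using that by blast
qed

lemma standard_generators_product:
  assumes p: "p \<notin> range a" and \<gamma>: "standard_generators a p \<gamma>"
  defines "G \<equiv> fundamental_group (- range a) p" and "c \<equiv> \<lambda>i. loop_class (- range a) (\<gamma> i)"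
  shows "c i \<in> carrier G" "c i \<otimes>\<^bsub>G\<^esub> c (i + 1) \<otimes>\<^bsub>G\<^esub> c (i + 2) = \<one>\<^bsub>G\<^esub>"
    "generate G {c i, c (i + 1)} = carrier G"
proof -
  interpret group G unfolding G_def using p by (intro group_fundamental_group) simp
  have carrier: "c i \<in> carrier G" for i
    using \<gamma> by (simp add: standard_generators_def Let_def G_def c_def fundamental_group_def)
  then show "c i \<in> carrier G" .
  have "c 1 \<otimes>\<^bsub>G\<^esub> c 2 \<otimes>\<^bsub>G\<^esub> c 3 = \<one>\<^bsub>G\<^esub>" and gen: "generate G (range c) = carrier G"
    using \<gamma> by (simp_all add: standard_generators_def Let_def G_def c_def)
  moreover from this have "c 2 \<otimes>\<^bsub>G\<^esub> c 3 \<otimes>\<^bsub>G\<^esub> c 1 = \<one>\<^bsub>G\<^esub>" "c 3 \<otimes>\<^bsub>G\<^esub> c 1 \<otimes>\<^bsub>G\<^esub> c 2 = \<one>\<^bsub>G\<^esub>"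
    using mult_eq_one_cyclic carrier by metis+
  ultimately show product: "c i \<otimes>\<^bsub>G\<^esub> c (i + 1) \<otimes>\<^bsub>G\<^esub> c (i + 2) = \<one>\<^bsub>G\<^esub>"
    using exhaust_3[of i] by (auto simp: numeral_3_cyclic)
  show "generate G {c i, c (i + 1)} = carrier G"
    using gen range_cyclic[of c i]
    by (intro generate_two_of_three[OF carrier carrier carrier product]) simp
qed

lemma standard_generators_triangular_representation:
  assumes a: "inj a" and p: "p \<notin> range a" and \<gamma>: "standard_generators a p \<gamma>"
    and "\<rho> \<in> hom (fundamental_group (- range a) p) GL"
      "indecomposable (fundamental_group (- range a) p) \<rho>"
    and "invertible S"
      "\<And>i. upper_triangular (matrix_inv S ** \<rho> (loop_class (- range a) (\<gamma> i)) ** S)"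
  shows "triangular_representation (a i) (a (i + 1)) (a (i + 2)) p (\<gamma> i) (\<gamma> (i + 1)) \<rho> S"
  unfolding triangular_representation_def three_points_def triangular_representation_axioms_def
    range_cyclic[of a i, symmetric]
proof (intro conjI)
  show "a i \<noteq> a (i + 1)" "a (i + 1) \<noteq> a (i + 2)" "a i \<noteq> a (i + 2)"
    using a by (auto dest: injD)
  show "\<gamma> i \<in> loops (- range a) p" "loop_around (range a) p (a i) (\<gamma> i)"
    "\<gamma> (i + 1) \<in> loops (- range a) p" "loop_around (range a) p (a (i + 1)) (\<gamma> (i + 1))"
    using \<gamma> by (simp_all add: standard_generators_def Let_def)
qed (use assms standard_generators_product(3)[OF p \<gamma>] in simp_all)

lemma conjugate_mult:
  assumes "invertible S"
  shows "(matrix_inv S ** A ** S) ** (matrix_inv S ** B ** S) = matrix_inv S ** (A ** B) ** S"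
proof -
  have "(matrix_inv S ** A ** S) ** (matrix_inv S ** B ** S)
      = matrix_inv S ** A ** (S ** matrix_inv S) ** B ** S"
    by (simp only: matrix_mul_assoc)
  then show ?thesis by (simp add: matrix_inv_mult[OF assms] matrix_mul_assoc)
qed

lemma equal_eigenvalues_if_product_eq_1:
  assumes "upper_triangular A" "upper_triangular B" "upper_triangular C" and "A ** B ** C = mat 1"
    and "A $ 1 $ 1 = A $ 2 $ 2" "B $ 1 $ 1 = B $ 2 $ 2"
  shows "C $ 1 $ 1 = C $ 2 $ 2"
proof -
  have "A $ 1 $ 1 * B $ 1 $ 1 * C $ 1 $ 1 = (A ** B ** C) $ 1 $ 1"
    "A $ 2 $ 2 * B $ 2 $ 2 * C $ 2 $ 2 = (A ** B ** C) $ 2 $ 2"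
    using assms(1-3) by (simp_all add: upper_triangular_mult)
  then have "A $ 2 $ 2 * B $ 2 $ 2 * C $ 1 $ 1 = 1" "A $ 2 $ 2 * B $ 2 $ 2 * C $ 2 $ 2 = 1"
    using assms(4-6) by (simp_all add: mat_def)
  then show ?thesis by (metis mult_cancel_left mult_zero_left zero_neq_one)
qed

lemma standard_generators_equal_eigenvalues:
  fixes S :: "complex^2^2"
  assumes p: "p \<notin> range a" and \<gamma>: "standard_generators a p \<gamma>"
    and hom: "\<rho> \<in> hom (fundamental_group (- range a) p) GL" and S: "invertible S"
  defines "H \<equiv> \<lambda>i. matrix_inv S ** \<rho> (loop_class (- range a) (\<gamma> i)) ** S"
  assumes upper: "\<And>i. upper_triangular (H i)"
    and "H i $ 1 $ 1 = H i $ 2 $ 2" "H (i + 1) $ 1 $ 1 = H (i + 1) $ 2 $ 2"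
  shows "H (i + 2) $ 1 $ 1 = H (i + 2) $ 2 $ 2"
proof -
  let ?G = "fundamental_group (- range a) p" and ?c = "\<lambda>i. loop_class (- range a) (\<gamma> i)"
  interpret linear_representation ?G \<rho>
    using p hom
    by (intro linear_representation.intro group_fundamental_group linear_representation_axioms.intro)
      auto
  note c = standard_generators_product[OF p \<gamma>]
  have "\<rho> (?c i) ** \<rho> (?c (i + 1)) ** \<rho> (?c (i + 2)) = mat 1"
    using c(2)[of i] one by (simp add: c(1) flip: mult)
  then have "H i ** H (i + 1) ** H (i + 2) = mat 1"
    by (simp add: H_def conjugate_mult[OF S] matrix_inv_mult[OF S])
  then show ?thesis by (rule equal_eigenvalues_if_product_eq_1[OF upper upper upper _ assms(7,8)])
qed

theorem theorem1p3:
  fixes a :: "3 \<Rightarrow> cp1" and p :: cp1 and \<gamma> :: "3 \<Rightarrow> real \<Rightarrow> cp1"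
    and \<rho> :: "(real \<Rightarrow> cp1) set \<Rightarrow> complex^2^2"
  assumes "inj a"
    and "p \<notin> range a"
    and "standard_generators a p \<gamma>"
    and "\<rho> \<in> hom (fundamental_group (- range a) p) GL"
    and "reducible (fundamental_group (- range a) p) \<rho>"
    and "indecomposable (fundamental_group (- range a) p) \<rho>"
    and "\<exists>S::complex^2^2. invertible S \<and>
           (\<forall>i. upper_triangular (matrix_inv S ** \<rho> (loop_class (- range a) (\<gamma> i)) ** S)) \<and>
           (\<exists>i. diagonal (matrix_inv S ** \<rho> (loop_class (- range a) (\<gamma> i)) ** S))"
  shows "\<exists>b1 b2. riemann_equation (range a) b1 b2 \<and> realizes (range a) p b1 b2 \<rho>"
proof -
  obtain S :: "complex^2^2" and j where S: "invertible S"
    and upper: "\<And>i. upper_triangular (matrix_inv S ** \<rho> (loop_class (- range a) (\<gamma> i)) ** S)"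
    and diagonal: "diagonal (matrix_inv S ** \<rho> (loop_class (- range a) (\<gamma> j)) ** S)"
    using assms(7) by blast
  define H where "H i = matrix_inv S ** \<rho> (loop_class (- range a) (\<gamma> i)) ** S" for i
  note representation = standard_generators_triangular_representation[OF assms(1-4,6) S upper]
  note realized =
    triangular_representation.realized[OF representation, folded range_cyclic, folded H_def]
  have "H (i + 2) $ 1 $ 1 = H (i + 2) $ 2 $ 2"
    if "H i $ 1 $ 1 = H i $ 2 $ 2" "H (i + 1) $ 1 $ 1 = H (i + 1) $ 2 $ 2" for i
    using that standard_generators_equal_eigenvalues[OF assms(2-4) S upper] unfolding H_def by blast
  then consider (distinct) i where "H i $ 1 $ 1 \<noteq> H i $ 2 $ 2"
    "H (i + 1) $ 1 $ 1 \<noteq> H (i + 1) $ 2 $ 2"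
    | (equal) "\<forall>i. H i $ 1 $ 1 = H i $ 2 $ 2"
    by (rule cyclic_dichotomy[where P = "\<lambda>i. H i $ 1 $ 1 = H i $ 2 $ 2"])
  then show ?thesis
  proof cases
    case distinct
    then show ?thesis using realized by blast
  next
    case equal
    moreover have "H (j + 2 + 1) $ 1 $ 2 = 0"
      using diagonal by (simp add: diagonal_def H_def add.assoc add_3_cyclic)
    ultimately show ?thesis using realized by blast
  qed
qed

end
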